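(* Let $\phi:\widehat X\to X$ be the substitution map and let $\Phi_\phi$ be the map on regular translation invariant states of the SSM given by $$\Phi_\phi(\hat\nu)=Z_{\hat\nu}^{-1}\sum_{n\ge0}\sum_{j=0}^{n}(\tau^{-j}\circ\phi)_*\bigl(\hat\nu|_{\{\mathbf n:\mathbf n(1)=n\}}\bigr),\qquad Z_{\hat\nu}=\sum_{n\ge 0}(n+1)\,\hat\nu(\{\mathbf n:\mathbf n(1)=n\}).$$ Then $\Phi_\phi$ is a bijection $\mathcal M(\widehat X)\to\mathcal M(X)$ which satisfies $\Phi_\phi(\overline{\mathcal M}(\widehat X))=\overline{\mathcal M}(X)$, $\Phi_\phi(\mathcal M_s(\widehat X))=\mathcal M_s(X)$, and $\Phi_\phi(\overline{\mathcal M}_s(\widehat X))=\overline{\mathcal M}_s(X)$. $\Phi_\phi$ carries states of density $\hat\rho$ to states of density $\hat\rho/(1+\hat\rho)$. Moreover, if $\widehat A\subset\widehat X$ is a translation invariant Borel set and $A$ is the minimal translation invariant subset of $X$ containing $\phi(\widehat A)$, then the same formula defines a bijection from $\mathcal M(\widehat A)$ to $\mathcal M(A)$, and likewise from $\overline{\mathcal M}(\widehat A)$ to $\overline{\mathcal M}(A)$, from $\mathcal M_s(\widehat A)$ to $\mathcal M_s(A)$, and from $\overline{\mathcal M}_s(\widehat A)$ to $\overline{\mathcal M}_s(A)$.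
   Context: F-SSEP: the discrete-time Markov process on $X=\{0,1\}^{\mathbb Z}$ in which, in passing from $\eta_t$ to $\eta_{t+1}$, every particle (site $i$ with $\eta_t(i)=1$) with exactly one occupied neighboring site attempts to jump to its empty neighboring site; the jump takes place unless two particles attempt to jump to the same site, in which case one of the two, chosen with probability $1/2$ each (independently for different sites), succeeds. SSM (symmetric stack model): the discrete-time Markov process on $\widehat X=\mathbb Z_+^{\mathbb Z}$, $\mathbb Z_+=\{0,1,2,\dots\}$. A stack $\mathbf n(i)$ is short if $\mathbf n(i)\le1$ and tall otherwise. In passing from $\mathbf n_t$ to $\mathbf n_{t+1}$, simultaneously for each bond $\langle k,k+1\rangle$: if both stacks are short no particle crosses the bond; if one is short and one tall, one particle moves from the tall to the short stack; if both are tall, one particle moves across the bond in a direction chosen with probability $1/2$ each (independently for different bonds). Substitution map $\phi:\widehat X\to X$: $\phi(\mathbf n)$ is obtained by replacing each $\mathbf n(i)$ by the word $0\,1^{\mathbf n(i)}$ and concatenating, with the word for $\mathbf n(1)$ beginning at site 1. Translation on $X$: $(\tau\eta)(i)=\eta(i-1)$; similarly on $\widehat X$. $f_*\lambda$ denotes the image (push-forward) measure. States are Borel probability measures. TI = translation invariant; ETI = extremal TI (ergodic under translations); TIS = TI and stationary for the dynamics (F-SSEP on $X$, SSM on $\widehat X$); ETIS = extremal among TIS states. A TI state on $\widehat X$ is regular if the expected value of $\mathbf n(0)$ is finite; a TI state on $X$ is regular if it gives probability zero to the configuration with $\eta(i)=1$ for all $i$. $\mathcal M$, $\overline{\mathcal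 M}$, $\mathcal M_s$, $\overline{\mathcal M}_s$ of $X$ (resp. $\widehat X$) denote the sets of regular TI, ETI, TIS, and ETIS states; for a TI set $A\subset X$ (resp. $\widehat A\subset \widehat X$), $\mathcal M(A)$, etc. denote the corresponding sets of states supported on $A$ (resp. $\widehat A$). A TI state has density $\rho$ if almost every configuration $\eta$ satisfies $\lim_{N\to\infty}\frac1N\sum_{i=1}^N\eta(i)=\lim_{N\to\infty}\frac1N\sum_{i=-N}^{-1}\eta(i)=\rho$ (on $\widehat X$ the same with $\mathbf n$ and $\hat\rho<\infty$). *)

theory Defs
  imports "HOL-Probability.Probability"
begin

text \<open>
  Configurations are functions on \<open>int\<close>, with values in \<open>bool\<close> for the F-SSEP (\<open>True\<close> = occupied)
  and in \<open>nat\<close> for the SSM. The measurable structure is \<^const>\<open>borel\<close> for the product topology.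
\<close>

instance bool :: second_countable_topology
proof
  show "\<exists>B::bool set set. countable B \<and> open = generate_topology B"
    by (intro exI[of _ "range lessThan \<union> range greaterThan"])
      (auto simp: open_bool_def intro: countable_finite)
qed

text \<open>\<open>shift k\<close> is the \<open>k\<close>-th power of the translation \<open>\<tau> = shift 1\<close>, for any integer \<open>k\<close>.\<close>

definition shift :: "int \<Rightarrow> (int \<Rightarrow> 'a) \<Rightarrow> (int \<Rightarrow> 'a)"
  where "shift k \<eta> = (\<lambda>i. \<eta> (i - k))"

lemma shift_0: "shift 0 = id"
  and shift_add: "shift (k + l) = shift k \<circ> shift l"
  by (auto simp: shift_def fun_eq_iff algebra_simps)

definition ti_set :: "(int \<Rightarrow> 'a) set \<Rightarrow> bool"
  where "ti_set A \<longleftrightarrow> shift 1 ` A = A"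

definition ti_hull :: "(int \<Rightarrow> 'a) set \<Rightarrow> (int \<Rightarrow> 'a) set"
  where "ti_hull A = \<Inter>{B. ti_set B \<and> A \<subseteq> B}"

section \<open>Dynamics\<close>

definition coins :: "(int \<Rightarrow> bool) measure"
  where "coins = PiM UNIV (\<lambda>_. measure_pmf (bernoulli_pmf (1/2)))"

definition jumps_right :: "(int \<Rightarrow> bool) \<Rightarrow> int \<Rightarrow> bool"
  where "jumps_right \<eta> i \<longleftrightarrow> \<eta> i \<and> \<eta> (i - 1) \<and> \<not> \<eta> (i + 1)"

definition jumps_left :: "(int \<Rightarrow> bool) \<Rightarrow> int \<Rightarrow> bool"
  where "jumps_left \<eta> i \<longleftrightarrow> \<eta> i \<and> \<eta> (i + 1) \<and> \<not> \<eta> (i - 1)"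

text \<open>
  \<open>jumps_right\<close> and \<open>jumps_left\<close> describe attempted jumps. The coin at an empty site is used only if
  that site is the target of two particles: heads lets the one coming from the left succeed.
\<close>

definition right_succeeds :: "(int \<Rightarrow> bool) \<Rightarrow> (int \<Rightarrow> bool) \<Rightarrow> int \<Rightarrow> bool"
  where "right_succeeds \<omega> \<eta> i \<longleftrightarrow> jumps_right \<eta> i \<and> (jumps_left \<eta> (i + 2) \<longrightarrow> \<omega> (i + 1))"

definition left_succeeds :: "(int \<Rightarrow> bool) \<Rightarrow> (int \<Rightarrow> bool) \<Rightarrow> int \<Rightarrow> bool"
  where "left_succeeds \<omega> \<eta> i \<longleftrightarrow> jumps_left \<eta> i \<and> (jumps_right \<eta> (i - 2) \<longrightarrow> \<not> \<omega> (i - 1))"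

definition fssep_step :: "(int \<Rightarrow> bool) \<Rightarrow> (int \<Rightarrow> bool) \<Rightarrow> (int \<Rightarrow> bool)"
  where "fssep_step \<omega> \<eta> = (\<lambda>i.
    (\<eta> i \<and> \<not> right_succeeds \<omega> \<eta> i \<and> \<not> left_succeeds \<omega> \<eta> i)
    \<or> right_succeeds \<omega> \<eta> (i - 1) \<or> left_succeeds \<omega> \<eta> (i + 1))"

definition fssep_kernel :: "(int \<Rightarrow> bool) \<Rightarrow> (int \<Rightarrow> bool) measure"
  where "fssep_kernel \<eta> = distr coins borel (\<lambda>\<omega>. fssep_step \<omega> \<eta>)"

definition tall :: "nat \<Rightarrow> bool"
  where "tall m \<longleftrightarrow> m > 1"

text \<open>
  \<open>ssm_flux \<omega> n k\<close> is the net number of particles crossing the bond \<open>\<langle>k, k + 1\<rangle>\<close> from \<open>k\<close> to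
  \<open>k + 1\<close>; the coin \<open>\<omega> k\<close> belongs to this bond.
\<close>

definition ssm_flux :: "(int \<Rightarrow> bool) \<Rightarrow> (int \<Rightarrow> nat) \<Rightarrow> int \<Rightarrow> int"
  where "ssm_flux \<omega> n k =
    (if tall (n k) \<and> tall (n (k + 1)) then (if \<omega> k then 1 else -1)
     else if tall (n k) then 1
     else if tall (n (k + 1)) then -1
     else 0)"

definition ssm_step :: "(int \<Rightarrow> bool) \<Rightarrow> (int \<Rightarrow> nat) \<Rightarrow> (int \<Rightarrow> nat)"
  where "ssm_step \<omega> n = (\<lambda>k. nat (int (n k) + ssm_flux \<omega> n (k - 1) - ssm_flux \<omega> n k))"

text \<open>The truncation in \<^const>\<open>ssm_step\<close> never takes effect.\<close>

lemma ssm_step_no_truncation: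
  "int (ssm_step \<omega> n k) = int (n k) + ssm_flux \<omega> n (k - 1) - ssm_flux \<omega> n k"
  by (auto simp: ssm_step_def ssm_flux_def tall_def)

definition ssm_kernel :: "(int \<Rightarrow> nat) \<Rightarrow> (int \<Rightarrow> nat) measure"
  where "ssm_kernel n = distr coins borel (\<lambda>\<omega>. ssm_step \<omega> n)"

definition stationary :: "('c::topological_space \<Rightarrow> 'c measure) \<Rightarrow> 'c measure \<Rightarrow> bool"
  where "stationary K \<nu> \<longleftrightarrow> (\<forall>B\<in>sets borel. (\<integral>\<^sup>+ x. emeasure (K x) B \<partial>\<nu>) = emeasure \<nu> B)"


lemma coin_measurable: "(\<lambda>\<omega>. \<omega> k) \<in> measurable coins (count_space UNIV)"
proof -
  have "(\<lambda>\<omega>. \<omega> k) \<in> measurable coins (measure_pmf (bernoulli_pmf (1/2)))"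
    unfolding coins_def by (rule measurable_component_singleton) simp
  then show ?thesis by (simp cong: measurable_cong_sets)
qed

lemma prob_space_fssep_kernel: "prob_space (fssep_kernel \<eta>)"
proof -
  note [measurable] = coin_measurable
  interpret prob_space coins
    unfolding coins_def by (intro prob_space_PiM measure_pmf.prob_space_axioms)
  have "(\<lambda>\<omega>. fssep_step \<omega> \<eta> i) \<in> borel_measurable coins" for i
  proof -
    have "(\<lambda>\<omega>. fssep_step \<omega> \<eta> i) \<in> measurable coins (count_space UNIV)"
      unfolding fssep_step_def right_succeeds_def left_succeeds_def by measurable
    then show ?thesis by (rule measurable_compose) simp
  qed
  then show ?thesis unfolding fssep_kernel_def
    by (intro prob_space_distr measurable_coordinatewise_then_product)
qed

lemma prob_space_ssm_kernel: "prob_space (ssm_kernel n)"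
proof -
  note [measurable] = coin_measurable
  interpret prob_space coins
    unfolding coins_def by (intro prob_space_PiM measure_pmf.prob_space_axioms)
  have "(\<lambda>\<omega>. ssm_step \<omega> n i) \<in> borel_measurable coins" for i
  proof -
    have "(\<lambda>\<omega>. ssm_step \<omega> n i) \<in> measurable coins (count_space UNIV)"
      unfolding ssm_step_def ssm_flux_def by measurable
    then show ?thesis by (rule measurable_compose) simp
  qed
  then show ?thesis unfolding ssm_kernel_def
    by (intro prob_space_distr measurable_coordinatewise_then_product)
qed

section \<open>Classes of states\<close>

definition state :: "'c::topological_space measure \<Rightarrow> bool"
  where "state \<nu> \<longleftrightarrow> prob_space \<nu> \<and> sets \<nu> = sets borel"

definition TI :: "(int \<Rightarrow> 'a::topological_space) measure set"
  where "TI = {\<nu>. state \<nu> \<and> distr \<nu> borel (shift 1) = \<nu>}"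

definition TIS :: "((int \<Rightarrow> 'a::topological_space) \<Rightarrow> (int \<Rightarrow> 'a) measure) \<Rightarrow> (int \<Rightarrow> 'a) measure set"
  where "TIS K = {\<nu>\<in>TI. stationary K \<nu>}"

definition extremal :: "'c::topological_space measure set \<Rightarrow> 'c measure set"
  where "extremal S = {\<nu>\<in>S. \<forall>\<mu>\<^sub>1\<in>S. \<forall>\<mu>\<^sub>2\<in>S. \<forall>t::real. 0 < t \<and> t < 1 \<and>
    (\<forall>B\<in>sets borel. measure \<nu> B = t * measure \<mu>\<^sub>1 B + (1 - t) * measure \<mu>\<^sub>2 B)
      \<longrightarrow> \<mu>\<^sub>1 = \<nu> \<and> \<mu>\<^sub>2 = \<nu>}"

definition regular_ssm :: "(int \<Rightarrow> nat) measure \<Rightarrow> bool"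
  where "regular_ssm \<nu> \<longleftrightarrow> (\<integral>\<^sup>+ n. of_nat (n 0) \<partial>\<nu>) < \<infinity>"

definition regular_fssep :: "(int \<Rightarrow> bool) measure \<Rightarrow> bool"
  where "regular_fssep \<nu> \<longleftrightarrow> measure \<nu> {\<lambda>_. True} = 0"

definition supported_on :: "'c measure set \<Rightarrow> 'c set \<Rightarrow> 'c measure set"
  where "supported_on S A = {\<nu>\<in>S. measure \<nu> A = 1}"

text \<open>
  Regular TI, ETI, TIS and ETIS states, in this order, for the SSM and for the F-SSEP. Extremality is
  taken among all TI (resp. TIS) states, regular or not.
\<close>

definition M_ssm :: "(int \<Rightarrow> nat) measure set"
  where "M_ssm = {\<nu>\<in>TI. regular_ssm \<nu>}"
definition Mbar_ssm :: "(int \<Rightarrow> nat) measure set"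
  where "Mbar_ssm = {\<nu>\<in>extremal TI. regular_ssm \<nu>}"
definition Ms_ssm :: "(int \<Rightarrow> nat) measure set"
  where "Ms_ssm = {\<nu>\<in>TIS ssm_kernel. regular_ssm \<nu>}"
definition Mbars_ssm :: "(int \<Rightarrow> nat) measure set"
  where "Mbars_ssm = {\<nu>\<in>extremal (TIS ssm_kernel). regular_ssm \<nu>}"

definition M_fssep :: "(int \<Rightarrow> bool) measure set"
  where "M_fssep = {\<nu>\<in>TI. regular_fssep \<nu>}"
definition Mbar_fssep :: "(int \<Rightarrow> bool) measure set"
  where "Mbar_fssep = {\<nu>\<in>extremal TI. regular_fssep \<nu>}"
definition Ms_fssep :: "(int \<Rightarrow> bool) measure set"
  where "Ms_fssep = {\<nu>\<in>TIS fssep_kernel. regular_fssep \<nu>}"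
definition Mbars_fssep :: "(int \<Rightarrow> bool) measure set"
  where "Mbars_fssep = {\<nu>\<in>extremal (TIS fssep_kernel). regular_fssep \<nu>}"

text \<open>\<open>v\<close> converts the value at a site to a particle number (\<open>of_bool\<close> or \<open>real\<close>).\<close>

definition has_density :: "('a \<Rightarrow> real) \<Rightarrow> (int \<Rightarrow> 'a) measure \<Rightarrow> real \<Rightarrow> bool"
  where "has_density v \<nu> \<rho> \<longleftrightarrow> (AE \<eta> in \<nu>.
    (\<lambda>N. (\<Sum>i\<in>{1..int N}. v (\<eta> i)) / real N) \<longlonglongrightarrow> \<rho> \<and>
    (\<lambda>N. (\<Sum>i\<in>{- int N..-1}. v (\<eta> i)) / real N) \<longlonglongrightarrow> \<rho>)"

section \<open>The substitution map\<close>

text \<open>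
  \<open>word_start n i\<close> is the site at which the word replacing \<open>n i\<close> (a hole followed by \<open>n i\<close> particles)
  begins. At most one of the two sums is over a nonempty range.
\<close>

definition word_start :: "(int \<Rightarrow> nat) \<Rightarrow> int \<Rightarrow> int"
  where "word_start n i =
    1 + (\<Sum>k\<in>{1..<i}. int (n k) + 1) - (\<Sum>k\<in>{i..<1}. int (n k) + 1)"

lemma word_start_1: "word_start n 1 = 1"
  by (simp add: word_start_def)

lemma word_start_step: "word_start n (i + 1) = word_start n i + int (n i) + 1"
proof (cases "i \<ge> 1")
  case True
  then have "{1..<i+1} = insert i {1..<i}" "{i..<1} = {}" "{i+1..<1} = {}" by auto
  then show ?thesis by (simp add: word_start_def)
next
  case False
  then have "{i..<1} = insert i {i+1..<1}" "{1..<i} = {}" "{1..<i+1} = {}" by auto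
  then show ?thesis by (simp add: word_start_def)
qed

definition subst_map :: "(int \<Rightarrow> nat) \<Rightarrow> (int \<Rightarrow> bool)"
  where "subst_map n = (\<lambda>x. \<exists>i. word_start n i < x \<and> x \<le> word_start n i + int (n i))"

definition Z_norm :: "(int \<Rightarrow> nat) measure \<Rightarrow> ennreal"
  where "Z_norm \<nu> = (\<Sum>m. of_nat (m + 1) * emeasure \<nu> {n. n 1 = m})"

definition Phi :: "(int \<Rightarrow> nat) measure \<Rightarrow> (int \<Rightarrow> bool) measure"
  where "Phi \<nu> = measure_of UNIV (sets borel) (\<lambda>B. inverse (Z_norm \<nu>) *
    (\<Sum>m. \<Sum>j=0..m. emeasure
      (distr (restrict_space \<nu> {n. n 1 = m}) borel (shift (- int j) \<circ> subst_map)) B))"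

end

theory Submission
  imports Defs
begin

text \<open>
  The substitution map is a bijection onto the configurations that have a hole at site 1 and infinitely
  many holes on both sides, and it turns the shift into the first-return map to \<open>{\<eta>. \<not> \<eta> 1}\<close>. Thus
  \<open>Phi\<close> is the suspension of \<open>\<nu>\<close>, and its inverse \<open>Psi\<close> conditions on a hole at site 1 and then applies
  the inverse substitution. Surjectivity is Kac's lemma: by Poincare recurrence a regular state
  has almost surely holes arbitrarily far out on both sides.

  A step of the F-SSEP from \<open>subst_map n\<close> moves the hole in front of stack \<open>i\<close> by minus the flux across
  the bond \<open>\<langle>i - 1, i\<rangle>\<close>, so it is a step of the SSM followed by a random translation; under a translation
  invariant state this translation is invisible, whence \<open>Phi\<close> intertwines the two evolutions.
  Stationarity then transfers in both directions by injectivity. \<open>Phi\<close> and \<open>Psi\<close> are linear up to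
  normalisation and regular states form a face, which gives the extremal classes.
\<close>

text \<open>The obstacle is that \<open>subst_map\<close> pins a hole to site 1, while the F-SSEP
  moves that hole. The translation that repairs this is by \<open>- ssm_flux \<omega> n 0\<close>,
  which depends on the configuration and on the coins, so invariance under fixed translations does
  not apply to it directly. The cure is to compare sums of an observable over all sites of word 1.
  The random translation alters such a sum only at the two ends of the word, and the error at bond
  (1, 2) is a translate of the error at bond (0, 1), so the errors cancel after integration.
  Cancellation in \<open>ennreal\<close> needs finite errors, hence the bound by 1 on the
  observables.

  The coins sit at sites for one model and on bonds for the other. The two contenders for the hole
  in front of stack i come from stacks i - 1 and i, so the coin at that hole plays the coin of bond
  (i - 1, i). Distinct holes read distinct coins, and the law of the coins survives this
  relabelling.

  The normalisation Z depends on the state, so mixing weights change: t and 1 - t become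
  proportional to t times Z of the first component and 1 - t times Z of the second.\<close>

section \<open>Positions of the words and holes of a substituted configuration\<close>

lemma word_start_unique:
  assumes "p 1 = 1" "\<And>i. p (i + 1) = p i + int (n i) + 1"
  shows "p = word_start n"
proof
  fix i :: int
  show "p i = word_start n i"
  proof (induction i rule: int_induct[where k = 1])
    case (step2 i)
    then show ?case
      using assms(2)[of "i - 1"] word_start_step[of n "i - 1"] by simp
  qed (simp_all add: assms word_start_1 word_start_step)
qed

lemma word_start_mono: "strict_mono (word_start n)"
proof -
  have "word_start n i < word_start n j" if "i < j" for i j
    using that
    by (induction j rule: int_gr_induct) (simp_all add: word_start_step)
  then show ?thesis by (simp add: strict_mono_def)
qed

lemma word_start_less_iff [simp]: "word_start n i < word_start n j \<longleftrightarrow> i < j"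
  and word_start_le_iff [simp]: "word_start n i \<le> word_start n j \<longleftrightarrow> i \<le> j"
  and word_start_eq_iff [simp]: "word_start n i = word_start n j \<longleftrightarrow> i = j"
  using word_start_mono by (auto simp: strict_mono_less strict_mono_less_eq strict_mono_eq)

text \<open>Every word contains at least its hole, so a site that leaves a word by one step enters
  the neighbouring word; this allows induction outward from site 1.\<close>

lemma word_cover: "\<exists>i. word_start n i \<le> x \<and> x < word_start n (i + 1)"
proof (induction x rule: int_induct[where k = 1])
  case base
  show ?case using word_start_step[of n 1] by (intro exI[of _ 1]) (simp add: word_start_1)
next
  case (step1 x)
  then obtain i where "word_start n i \<le> x" "x < word_start n (i + 1)" by auto
  then show ?case
    using word_start_step[of n "i + 1"]
    by (cases "x + 1 < word_start n (i + 1)") (auto intro: exI[of _ i] exI[of _ "i + 1"])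
next
  case (step2 x)
  then obtain i where "word_start n i \<le> x" "x < word_start n (i + 1)" by auto
  then show ?case
    using word_start_step[of n "i - 1"]
    by (cases "word_start n i \<le> x - 1") (auto intro: exI[of _ i] exI[of _ "i - 1"])
qed

text \<open>Each site lies in exactly one word, and only the first site of a word is empty. Later
  arguments use \<open>subst_map\<close> through this description, comparing configurations by their
  sets of holes.\<close>

lemma hole_subst_map: "\<not> subst_map n x \<longleftrightarrow> x \<in> range (word_start n)"
proof -
  obtain i where i: "word_start n i \<le> x" "x < word_start n (i + 1)"
    using word_cover by blast
  have j: "j = i" if "word_start n j \<le> x" "x < word_start n (j + 1)" for j
  proof -
    have "word_start n j < word_start n (i + 1)" "word_start n i < word_start n (j + 1)"
      using i that by linarith+
    then show ?thesis by simp
  qed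
  have "subst_map n x \<longleftrightarrow> x \<noteq> word_start n i"
  proof
    assume "subst_map n x"
    then obtain k where k: "word_start n k < x" "x \<le> word_start n k + int (n k)"
      by (auto simp: subst_map_def)
    then have "k = i" by (intro j) (simp_all add: word_start_step)
    with k show "x \<noteq> word_start n i" by simp
  next
    assume "x \<noteq> word_start n i"
    with i show "subst_map n x"
      by (auto simp: subst_map_def word_start_step intro!: exI[of _ i])
  qed
  moreover have "x \<in> range (word_start n) \<longleftrightarrow> x = word_start n i"
    using j by (auto simp: word_start_step)
  ultimately show ?thesis by simp
qed

text \<open>After renumbering, old word 1 + k becomes word 1 and must begin at site 1; subtracting
  its old position and adding 1 achieves this, and the recursion does the rest.\<close>

lemma word_start_shift:
  "word_start (shift (- k) n) i = word_start n (i + k) - word_start n (1 + k) + 1"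
proof -
  have "(\<lambda>i. word_start n (i + k) - word_start n (1 + k) + 1) = word_start (shift (- k) n)"
    using word_start_step[of n "i + k" for i]
    by (intro word_start_unique) (simp_all add: shift_def algebra_simps)
  from fun_cong[OF this, of i] show ?thesis by simp
qed

lemma subst_map_shift:
  "subst_map (shift (- k) n) = shift (1 - word_start n (1 + k)) (subst_map n)"
proof
  fix x
  have "x \<in> range (word_start (shift (- k) n)) \<longleftrightarrow>
      x - (1 - word_start n (1 + k)) \<in> range (word_start n)"
  proof
    assume "x - (1 - word_start n (1 + k)) \<in> range (word_start n)"
    then obtain i where "x - (1 - word_start n (1 + k)) = word_start n i" by auto
    then have "x = word_start (shift (- k) n) (i - k)" by (simp add: word_start_shift)
    then show "x \<in> range (word_start (shift (- k) n))" by blast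
  qed (auto simp: word_start_shift)
  then show "subst_map (shift (- k) n) x = shift (1 - word_start n (1 + k)) (subst_map n) x"
    using hole_subst_map[of "shift (- k) n" x] hole_subst_map[of n "x - (1 - word_start n (1 + k))"]
    unfolding shift_def[of "1 - word_start n (1 + k)"] by blast
qed

lemma shift_shift: "shift k (shift l \<eta>) = shift (k + l) \<eta>"
  by (simp add: shift_add)

text \<open>The return time to a hole at site 1 is the length \<open>n 1 + 1\<close> of word 1; this
  is the roof function of the suspension.\<close>

lemma subst_map_shift1: "subst_map (shift (- 1) n) = shift (- int (n 1 + 1)) (subst_map n)"
  using subst_map_shift[of 1 n] word_start_step[of n 1] by (simp add: word_start_1)

lemma subst_map_in_word: "0 < j \<Longrightarrow> j \<le> int (n i) \<Longrightarrow> subst_map n (word_start n i + j)"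
  by (auto simp: subst_map_def intro!: exI[of _ i])

lemma not_subst_map_word_start [simp]: "\<not> subst_map n (word_start n i)"
  by (simp add: hole_subst_map)

section \<open>Conjugation of the dynamics\<close>

text \<open>A particle with an empty right neighbour is the last of its word, and it has an occupied
  left neighbour exactly when its stack is tall. Its target is the hole of the next word, whence the
  index \<open>i - 1\<close>.\<close>

lemma jumps_right_subst_map:
  "jumps_right (subst_map n) x \<longleftrightarrow> (\<exists>i. x + 1 = word_start n i \<and> tall (n (i - 1)))"
proof
  assume "jumps_right (subst_map n) x"
  then have x: "subst_map n x" "subst_map n (x - 1)" "\<not> subst_map n (x + 1)"
    by (simp_all add: jumps_right_def)
  then obtain i where i: "x + 1 = word_start n i" by (auto simp: hole_subst_map)
  have s: "word_start n i = word_start n (i - 1) + int (n (i - 1)) + 1"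
    using word_start_step[of n "i - 1"] by simp
  have "x \<noteq> word_start n (i - 1)" "x - 1 \<noteq> word_start n (i - 1)"
    using x(1,2) not_subst_map_word_start[of n "i - 1"] by metis+
  then have "tall (n (i - 1))" using i s by (simp add: tall_def)
  with i show "\<exists>i. x + 1 = word_start n i \<and> tall (n (i - 1))" by blast
next
  assume "\<exists>i. x + 1 = word_start n i \<and> tall (n (i - 1))"
  then obtain i where i: "x + 1 = word_start n i" "tall (n (i - 1))" by blast
  have s: "word_start n i = word_start n (i - 1) + int (n (i - 1)) + 1"
    using word_start_step[of n "i - 1"] by simp
  have "subst_map n x" "subst_map n (x - 1)"
    using subst_map_in_word[of "int (n (i - 1))" n "i - 1"]
      subst_map_in_word[of "int (n (i - 1)) - 1" n "i - 1"] i s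
    by (simp_all add: tall_def algebra_simps)
  with i show "jumps_right (subst_map n) x" by (simp add: jumps_right_def)
qed

text \<open>Mirror image: the jumping particle is the first of its word and aims at the hole of that
  same word. Hence the hole in front of stack i is contested by the two stacks of bond (i - 1,
  i).\<close>

lemma jumps_left_subst_map:
  "jumps_left (subst_map n) x \<longleftrightarrow> (\<exists>i. x - 1 = word_start n i \<and> tall (n i))"
proof
  assume "jumps_left (subst_map n) x"
  then have x: "subst_map n x" "subst_map n (x + 1)" "\<not> subst_map n (x - 1)"
    by (simp_all add: jumps_left_def)
  then obtain i where i: "x - 1 = word_start n i" by (auto simp: hole_subst_map)
  have "x \<noteq> word_start n (i + 1)" "x + 1 \<noteq> word_start n (i + 1)"
    using x(1,2) not_subst_map_word_start[of n "i + 1"] by metis+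
  then have "tall (n i)" using i word_start_step[of n i] by (simp add: tall_def)
  with i show "\<exists>i. x - 1 = word_start n i \<and> tall (n i)" by blast
next
  assume "\<exists>i. x - 1 = word_start n i \<and> tall (n i)"
  then obtain i where i: "x - 1 = word_start n i" "tall (n i)" by blast
  then have "x = word_start n i + 1" "x + 1 = word_start n i + 2" by simp_all
  then have "subst_map n x" "subst_map n (x + 1)"
    using subst_map_in_word[of 1 n i] subst_map_in_word[of 2 n i] i(2)
    by (simp_all add: tall_def add.commute)
  with i show "jumps_left (subst_map n) x" by (simp add: jumps_left_def)
qed

text \<open>A particle that jumps right into the hole in front of stack i leaves stack i - 1 and
  joins stack i, which is flux 1. Heads favours it in both models, so no coin has to be
  flipped.\<close>

lemma right_succeeds_subst_map:
  "right_succeeds \<omega> (subst_map n) x \<longleftrightarrow>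
    (\<exists>i. x + 1 = word_start n i \<and> ssm_flux (\<lambda>k. \<omega> (word_start n (k + 1))) n (i - 1) = 1)"
proof (cases "\<exists>i. x + 1 = word_start n i")
  case True
  then obtain i where i: "x + 1 = word_start n i" by blast
  then have u: "(\<exists>j. x + 1 = word_start n j \<and> P j) \<longleftrightarrow> P i" for P by auto
  moreover have "x + 2 - 1 = x + 1" by simp
  ultimately have "jumps_right (subst_map n) x \<longleftrightarrow> tall (n (i - 1))"
    "jumps_left (subst_map n) (x + 2) \<longleftrightarrow> tall (n i)"
    unfolding jumps_right_subst_map jumps_left_subst_map by (simp_all only:)
  with u[of "\<lambda>i. ssm_flux (\<lambda>k. \<omega> (word_start n (k + 1))) n (i - 1) = 1"] show ?thesis
    unfolding right_succeeds_def using i by (simp add: ssm_flux_def)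
next
  case False
  then show ?thesis unfolding right_succeeds_def jumps_right_subst_map by blast
qed

lemma left_succeeds_subst_map:
  "left_succeeds \<omega> (subst_map n) x \<longleftrightarrow>
    (\<exists>i. x - 1 = word_start n i \<and> ssm_flux (\<lambda>k. \<omega> (word_start n (k + 1))) n (i - 1) = - 1)"
proof (cases "\<exists>i. x - 1 = word_start n i")
  case True
  then obtain i where i: "x - 1 = word_start n i" by blast
  then have "(\<exists>j. x - 1 = word_start n j \<and> P j) \<longleftrightarrow> P i" for P by auto
  moreover have "x - 2 + 1 = x - 1" by simp
  ultimately show ?thesis
    unfolding left_succeeds_def jumps_right_subst_map jumps_left_subst_map
    using i by (simp add: ssm_flux_def)
next
  case False
  then show ?thesis unfolding left_succeeds_def jumps_left_subst_map by blast
qed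

lemma ssm_flux_cases: "ssm_flux \<omega> n k = 0 \<or> ssm_flux \<omega> n k = 1 \<or> ssm_flux \<omega> n k = - 1"
  by (simp add: ssm_flux_def)

text \<open>A successful jump exchanges a particle with a hole, so the hole moves opposite to the
  particle: one site left for flux 1, one site right for flux -1.\<close>

lemma hole_fssep_step_subst_map:
  "\<not> fssep_step \<omega> (subst_map n) x \<longleftrightarrow>
    (\<exists>i. x = word_start n i - ssm_flux (\<lambda>k. \<omega> (word_start n (k + 1))) n (i - 1))"
    (is "_ \<longleftrightarrow> (\<exists>i. x = ?w i - ?f i)")
proof -
  let ?R = "right_succeeds \<omega> (subst_map n)" and ?L = "left_succeeds \<omega> (subst_map n)"
  have "\<not> fssep_step \<omega> (subst_map n) x \<longleftrightarrow>
      \<not> subst_map n x \<and> \<not> ?R (x - 1) \<and> \<not> ?L (x + 1) \<or> ?R x \<or> ?L x"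
    by (auto simp: fssep_step_def right_succeeds_def left_succeeds_def
        jumps_right_def jumps_left_def)
  also have "\<dots> \<longleftrightarrow> (\<exists>i. x = ?w i \<and> ?f i = 0) \<or> (\<exists>i. x + 1 = ?w i \<and> ?f i = 1) \<or>
      (\<exists>i. x - 1 = ?w i \<and> ?f i = - 1)"
    unfolding right_succeeds_subst_map left_succeeds_subst_map hole_subst_map
    using ssm_flux_cases[of "\<lambda>k. \<omega> (?w (k + 1))" n] by fastforce
  also have "\<dots> \<longleftrightarrow> (\<exists>i. x = ?w i - ?f i)"
    using ssm_flux_cases[of "\<lambda>k. \<omega> (?w (k + 1))" n] by (smt (verit))
  finally show ?thesis .
qed

text \<open>The gap between two consecutive holes changes by incoming minus outgoing flux, which is
  the stack update; only the absolute position of the holes differs.\<close>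

lemma fssep_step_subst_map:
  assumes "\<And>k. \<omega>' k = \<omega> (word_start n (k + 1))"
  shows "fssep_step \<omega> (subst_map n) = shift (- ssm_flux \<omega>' n 0) (subst_map (ssm_step \<omega>' n))"
proof
  fix x
  let ?f = "ssm_flux \<omega>' n"
  \<comment> \<open>Adding \<open>?f 0\<close> puts hole 1 back at site 1, as the anchor of
    \<open>word_start_unique\<close> demands.\<close>
  have "(\<lambda>i. word_start n i - ?f (i - 1) + ?f 0) = word_start (ssm_step \<omega>' n)"
    by (rule word_start_unique)
      (simp_all add: word_start_1 word_start_step ssm_step_no_truncation)
  then have w: "word_start (ssm_step \<omega>' n) i = word_start n i - ?f (i - 1) + ?f 0" for i
    by (metis (no_types))
  have \<omega>': "\<omega>' = (\<lambda>k. \<omega> (word_start n (k + 1)))" using assms by blast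
  have "\<not> fssep_step \<omega> (subst_map n) x \<longleftrightarrow> x + ?f 0 \<in> range (word_start (ssm_step \<omega>' n))"
    unfolding hole_fssep_step_subst_map image_iff w by (auto simp: \<omega>' algebra_simps)
  then show "fssep_step \<omega> (subst_map n) x =
      shift (- ?f 0) (subst_map (ssm_step \<omega>' n)) x"
    unfolding hole_subst_map[symmetric] by (simp add: shift_def)
qed

lemma fssep_step_shift: "fssep_step \<omega> (shift k \<eta>) = shift k (fssep_step (shift (- k) \<omega>) \<eta>)"
  by (auto simp: fun_eq_iff fssep_step_def right_succeeds_def left_succeeds_def
      jumps_right_def jumps_left_def shift_def algebra_simps)

lemma ssm_step_shift: "ssm_step \<omega> (shift k n) = shift k (ssm_step (shift (- k) \<omega>) n)"
  by (simp add: fun_eq_iff ssm_step_def ssm_flux_def shift_def algebra_simps)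

lemma ssm_flux_shift: "ssm_flux \<omega> (shift k n) i = ssm_flux (shift (- k) \<omega>) n (i - k)"
  by (simp add: ssm_flux_def shift_def algebra_simps)

section \<open>Measurability of the substitution map\<close>

text \<open>All subsets of a countable Hausdorff space are Borel, so coordinates may be treated as
  discrete random variables and combined by arbitrary functions.\<close>

lemma measurable_coord [measurable]:
  "(\<lambda>\<eta>::int \<Rightarrow> 'a::{countable, t2_space}. \<eta> i) \<in> measurable borel (count_space UNIV)"
proof -
  have "(\<lambda>\<eta>::int \<Rightarrow> 'a. \<eta> i) \<in> borel_measurable borel"
    by (intro borel_measurable_continuous_onI continuous_on_product_coordinates)
  then show ?thesis
    by (simp add: measurable_def sets_borel_eq_count_space)
qed

lemma measurable_config:
  fixes f :: "'b \<Rightarrow> int \<Rightarrow> 'a::second_countable_topology"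
  assumes "\<And>i. (\<lambda>x. f x i) \<in> measurable M (count_space UNIV)"
  shows "f \<in> borel_measurable M"
proof (rule measurable_coordinatewise_then_product)
  show "(\<lambda>x. f x i) \<in> borel_measurable M" for i
    using assms[of i] by (rule measurable_compose) simp
qed

lemma measurable_shift [measurable]:
  "shift k \<in> measurable borel
    (borel :: (int \<Rightarrow> 'a::{countable, t2_space, second_countable_topology}) measure)"
  by (rule measurable_config) (simp add: shift_def)

lemma measurable_countable_op2:
  fixes f :: "'a \<Rightarrow> 'b::countable" and g :: "'a \<Rightarrow> 'c::countable"
  assumes "f \<in> measurable M (count_space UNIV)" "g \<in> measurable M (count_space UNIV)"
  shows "(\<lambda>x. h (f x) (g x)) \<in> measurable M (count_space UNIV)"
proof (rule measurable_compose_countable[OF _ assms(1)])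
  show "(\<lambda>x. h i (g x)) \<in> measurable M (count_space UNIV)" for i
    using assms(2) by (rule measurable_compose) simp
qed

lemma measurable_word_start [measurable]:
  "(\<lambda>n. word_start n i) \<in> measurable borel (count_space UNIV)"
proof (induction i rule: int_induct[where k = 1])
  case (step1 i)
  then show ?case unfolding word_start_step add.assoc
    by (intro measurable_countable_op2[where h = "\<lambda>a b. a + (int b + 1)"]) simp_all
next
  case (step2 i)
  have "word_start n (i - 1) = word_start n i - (int (n (i - 1)) + 1)" for n
    using word_start_step[of n "i - 1"] by simp
  with step2 show ?case
    by (auto intro: measurable_countable_op2[where h = "\<lambda>a b. a - (int b + 1)"])
qed (simp add: word_start_1)

lemma measurable_subst_map [measurable]: "subst_map \<in> measurable borel borel"
proof (rule measurable_config)
  fix x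
  have "subst_map n x \<longleftrightarrow> \<not> (\<exists>i. word_start n i = x)" for n
    using hole_subst_map[of n x] by auto
  then show "(\<lambda>n. subst_map n x) \<in> measurable borel (count_space UNIV)" by simp
qed

section \<open>States and the map Phi\<close>

lemma space_state: "state \<nu> \<Longrightarrow> space \<nu> = UNIV"
  by (metis sets_eq_imp_space_eq space_borel state_def)

lemma sets_state: "state \<nu> \<Longrightarrow> sets \<nu> = sets borel"
  by (simp add: state_def)

lemma prob_space_state: "state \<nu> \<Longrightarrow> prob_space \<nu>"
  by (simp add: state_def)

text \<open>The integral of F over the fibre of the suspension above n: the translates bring each of
  the \<open>n 1 + 1\<close> sites of word 1, hole included, to site 1.\<close>

definition word_sum :: "((int \<Rightarrow> bool) \<Rightarrow> ennreal) \<Rightarrow> (int \<Rightarrow> nat) \<Rightarrow> ennreal"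
  where "word_sum F n = (\<Sum>j\<le>n 1. F (shift (- int j) (subst_map n)))"

lemma measurable_word_sum [measurable]:
  assumes [measurable]: "F \<in> borel_measurable borel"
  shows "word_sum F \<in> borel_measurable borel"
  unfolding word_sum_def
  by (rule measurable_compose_countable[where g = "\<lambda>n. n 1"]) measurable

text \<open>Bridges the sum over stack heights in \<open>Z_norm\<close> and \<open>Phi\<close> and a
  single integral in which the height is a function of n.\<close>

lemma nn_integral_split_stack:
  assumes "state \<nu>" and [measurable]: "\<And>m. G m \<in> borel_measurable borel"
  shows "(\<integral>\<^sup>+ n. G (n i) n \<partial>\<nu>) = (\<Sum>m. \<integral>\<^sup>+ n. G m n * indicator {n. n i = m} n \<partial>\<nu>)"
proof -
  note [measurable_cong] = sets_state[OF assms(1)]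
  have "(\<Sum>m. G m n * indicator {n. n i = m} n) = G (n i) n" for n
    by (rule suminf_cmult_indicator) (auto simp: disjoint_family_on_def)
  then have "(\<integral>\<^sup>+ n. G (n i) n \<partial>\<nu>) = (\<integral>\<^sup>+ n. (\<Sum>m. G m n * indicator {n. n i = m} n) \<partial>\<nu>)"
    by simp
  also have "\<dots> = (\<Sum>m. \<integral>\<^sup>+ n. G m n * indicator {n. n i = m} n \<partial>\<nu>)"
    by (rule nn_integral_suminf) measurable
  finally show ?thesis .
qed

lemma Z_norm_eq:
  assumes "state \<nu>"
  shows "Z_norm \<nu> = (\<integral>\<^sup>+ n. of_nat (n 1 + 1) \<partial>\<nu>)"
proof -
  note [measurable_cong] = sets_state[OF assms(1)]
  have "(\<integral>\<^sup>+ n. of_nat (n 1 + 1) \<partial>\<nu>) =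
      (\<Sum>m. \<integral>\<^sup>+ n. of_nat (m + 1) * indicator {n. n 1 = m} n \<partial>\<nu>)"
    by (rule nn_integral_split_stack[OF assms, where G = "\<lambda>m n. of_nat (m + 1)"]) simp
  also have "\<dots> = Z_norm \<nu>"
    unfolding Z_norm_def by (simp add: nn_integral_cmult_indicator del: of_nat_add)
  finally show ?thesis ..
qed

lemma word_sum_one: "word_sum (\<lambda>_. 1) = (\<lambda>n. of_nat (n 1 + 1))"
  by (simp add: word_sum_def fun_eq_iff)

text \<open>Countable additivity of the set function is still open at this point. Since
  \<open>measure_of\<close> depends only on the values on the sigma algebra, agreement there
  suffices.\<close>

lemma Phi_eq_measure_of:
  assumes "state \<nu>"
  shows "Phi \<nu> = measure_of UNIV (sets borel)
    (\<lambda>B. inverse (Z_norm \<nu>) * (\<integral>\<^sup>+ n. word_sum (indicator B) n \<partial>\<nu>))"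
  unfolding Phi_def
proof (rule measure_of_eq)
  note [measurable_cong] = sets_state[OF assms(1)]
  fix B :: "(int \<Rightarrow> bool) set"
  assume "B \<in> sigma_sets UNIV (sets borel)"
  then have [measurable]: "B \<in> sets borel"
    using sets.sigma_sets_eq[of "borel :: (int \<Rightarrow> bool) measure"] by simp
  have *: "emeasure (distr (restrict_space \<nu> {n. n 1 = m}) borel (shift (- int j) \<circ> subst_map)) B =
     (\<integral>\<^sup>+ n. indicator B (shift (- int j) (subst_map n)) * indicator {n. n 1 = m} n \<partial>\<nu>)" for m j
  proof -
    have [measurable]: "shift (- int j) \<circ> subst_map \<in> measurable (restrict_space \<nu> {n. n 1 = m}) borel"
      by (rule measurable_restrict_space1) measurable
    have "emeasure (distr (restrict_space \<nu> {n. n 1 = m}) borel (shift (- int j) \<circ> subst_map)) B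
      = (\<integral>\<^sup>+ x. indicator B x \<partial>distr (restrict_space \<nu> {n. n 1 = m}) borel (shift (- int j) \<circ> subst_map))"
      by simp
    also have "\<dots> = (\<integral>\<^sup>+ n. indicator B ((shift (- int j) \<circ> subst_map) n)
        \<partial>restrict_space \<nu> {n. n 1 = m})"
      by (rule nn_integral_distr) measurable
    also have "\<dots> = (\<integral>\<^sup>+ n. indicator B (shift (- int j) (subst_map n)) *
        indicator {n. n 1 = m} n \<partial>\<nu>)"
      by (subst nn_integral_restrict_space) (simp_all add: space_state[OF assms])
    finally show ?thesis .
  qed
  have "(\<integral>\<^sup>+ n. word_sum (indicator B) n \<partial>\<nu>) = (\<Sum>m. \<integral>\<^sup>+ n.
      (\<Sum>j\<le>m. indicator B (shift (- int j) (subst_map n))) * indicator {n. n 1 = m} n \<partial>\<nu>)"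
    unfolding word_sum_def by (rule nn_integral_split_stack[OF assms(1)]) measurable
  also have "\<dots> = (\<Sum>m. \<Sum>j=0..m. emeasure
      (distr (restrict_space \<nu> {n. n 1 = m}) borel (shift (- int j) \<circ> subst_map)) B)"
    unfolding * sum_distrib_right atLeast0AtMost
    by (subst nn_integral_sum) simp_all
  finally show "inverse (Z_norm \<nu>) * (\<Sum>m. \<Sum>j=0..m. emeasure
      (distr (restrict_space \<nu> {n. n 1 = m}) borel (shift (- int j) \<circ> subst_map)) B) =
    inverse (Z_norm \<nu>) * (\<integral>\<^sup>+ n. word_sum (indicator B) n \<partial>\<nu>)"
    by simp
qed simp

text \<open>The measure \<open>N\<close> exhibits Phi as a suspension: \<open>\<nu>\<close> times counting measure, cut off at height \<open>n 1\<close>.\<close>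

lemma
  assumes "state \<nu>"
  shows sets_Phi [measurable_cong]: "sets (Phi \<nu>) = sets borel"
    and nn_integral_Phi: "F \<in> borel_measurable borel \<Longrightarrow>
      (\<integral>\<^sup>+ \<eta>. F \<eta> \<partial>Phi \<nu>) = inverse (Z_norm \<nu>) * (\<integral>\<^sup>+ n. word_sum F n \<partial>\<nu>)"
proof -
  note [measurable_cong] = sets_state[OF assms(1)]
  define N where "N = distr (density (\<nu> \<Otimes>\<^sub>M count_space UNIV)
      (\<lambda>(n, j). inverse (Z_norm \<nu>) * indicator {..n 1} j)) borel
    (\<lambda>(n, j). shift (- int j) (subst_map n))"
  have [measurable]: "(\<lambda>(n, j). shift (- int j) (subst_map n)) \<in>
      measurable (\<nu> \<Otimes>\<^sub>M count_space UNIV) borel"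
    unfolding split_beta'
    by (rule measurable_compose_countable[where g = snd]) measurable
  have ind [measurable]: "(\<lambda>(n, j). inverse (Z_norm \<nu>) * indicator {..n 1} j) \<in>
      borel_measurable (\<nu> \<Otimes>\<^sub>M count_space (UNIV :: nat set))"
    unfolding split_beta' indicator_def atMost_iff by measurable
  have int: "(\<integral>\<^sup>+ \<eta>. F \<eta> \<partial>N) = inverse (Z_norm \<nu>) * (\<integral>\<^sup>+ n. word_sum F n \<partial>\<nu>)"
    if [measurable]: "F \<in> borel_measurable borel" for F
  proof -
    interpret sigma_finite_measure "count_space (UNIV :: nat set)"
      by (rule sigma_finite_measure_count_space)
    have "(\<integral>\<^sup>+ \<eta>. F \<eta> \<partial>N) = (\<integral>\<^sup>+ x. (case x of (n, j) \<Rightarrow> inverse (Z_norm \<nu>) * indicator {..n 1} j *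
        F (shift (- int j) (subst_map n))) \<partial>(\<nu> \<Otimes>\<^sub>M count_space UNIV))"
      unfolding N_def by (simp add: nn_integral_distr nn_integral_density split_beta')
    also have "\<dots> = (\<integral>\<^sup>+ n. \<integral>\<^sup>+ j. inverse (Z_norm \<nu>) * indicator {..n 1} j *
        F (shift (- int j) (subst_map n)) \<partial>count_space UNIV \<partial>\<nu>)"
      by (subst nn_integral_fst[symmetric]) (simp_all add: split_beta')
    also have "\<dots> = (\<integral>\<^sup>+ n. inverse (Z_norm \<nu>) * word_sum F n \<partial>\<nu>)"
    proof (rule nn_integral_cong)
      fix n
      have "(\<integral>\<^sup>+ j. inverse (Z_norm \<nu>) * indicator {..n 1} j *
          F (shift (- int j) (subst_map n)) \<partial>count_space UNIV) =
        (\<integral>\<^sup>+ j. inverse (Z_norm \<nu>) * F (shift (- int j) (subst_map n)) * indicator {..n 1} j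
          \<partial>count_space UNIV)"
        by (simp add: ac_simps)
      also have "\<dots> = (\<integral>\<^sup>+ j. inverse (Z_norm \<nu>) * F (shift (- int j) (subst_map n))
          \<partial>count_space {..n 1})"
        by (simp add: nn_integral_count_space_indicator)
      also have "\<dots> = inverse (Z_norm \<nu>) * word_sum F n"
        by (simp add: nn_integral_count_space_finite word_sum_def sum_distrib_left)
      finally show "(\<integral>\<^sup>+ j. inverse (Z_norm \<nu>) * indicator {..n 1} j *
          F (shift (- int j) (subst_map n)) \<partial>count_space UNIV) = \<dots>" .
    qed
    also have "\<dots> = inverse (Z_norm \<nu>) * (\<integral>\<^sup>+ n. word_sum F n \<partial>\<nu>)"
      by (rule nn_integral_cmult) measurable
    finally show ?thesis .
  qed
  \<comment> \<open>N is a genuine measure with the prescribed values, so \<open>measure_of\<close>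
    returns these values and not its default, the zero measure.\<close>
  have "Phi \<nu> = measure_of (space N) (sets N) (emeasure N)"
    unfolding Phi_eq_measure_of[OF assms]
  proof (simp add: N_def, fold N_def, rule measure_of_eq)
    fix B :: "(int \<Rightarrow> bool) set"
    assume "B \<in> sigma_sets UNIV (sets borel)"
    then have [measurable]: "B \<in> sets borel"
      using sets.sigma_sets_eq[of "borel :: (int \<Rightarrow> bool) measure"] by simp
    then have "B \<in> sets N" by (simp add: N_def)
    then show "inverse (Z_norm \<nu>) * (\<integral>\<^sup>+ n. word_sum (indicator B) n \<partial>\<nu>) = emeasure N B"
      by (simp flip: int)
  qed simp
  then have "Phi \<nu> = N" by (simp only: measure_of_of_measure)
  then show "sets (Phi \<nu>) = sets borel"
    "F \<in> borel_measurable borel \<Longrightarrow>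
      (\<integral>\<^sup>+ \<eta>. F \<eta> \<partial>Phi \<nu>) = inverse (Z_norm \<nu>) * (\<integral>\<^sup>+ n. word_sum F n \<partial>\<nu>)"
    using int by (simp_all add: N_def)
qed

section \<open>The inverse substitution\<close>

text \<open>Holes are numbered so that the first one at a site \<open>x \<ge> 1\<close> has number 1. The values of
  \<open>stack_map\<close> at configurations without enough holes are irrelevant.\<close>

definition hole_count :: "(int \<Rightarrow> bool) \<Rightarrow> int \<Rightarrow> int"
  where "hole_count \<eta> x = (\<Sum>k\<in>{1..x}. of_bool (\<not> \<eta> k)) - (\<Sum>k\<in>{x+1..0}. of_bool (\<not> \<eta> k))"

definition stack_map :: "(int \<Rightarrow> bool) \<Rightarrow> (int \<Rightarrow> nat)"
  where "stack_map \<eta> i = (LEAST m. \<exists>x. hole_count \<eta> x = i \<and> \<not> \<eta> x \<and> \<not> \<eta> (x + 1 + int m))"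

lemma hole_count_step: "hole_count \<eta> (x + 1) = hole_count \<eta> x + of_bool (\<not> \<eta> (x + 1))"
proof (cases "x \<ge> 0")
  case True
  then have "{1..x+1} = insert (x+1) {1..x}" "{x+1..0} = {}" "{x+1+1..0} = {}" by auto
  then show ?thesis by (simp add: hole_count_def)
next
  case False
  then have "{x+1..0} = insert (x+1) {x+1+1..0}" "{1..x} = {}" "{1..x+1} = {}" by auto
  then show ?thesis by (simp add: hole_count_def)
qed

lemma hole_count_const:
  assumes "x \<le> y" "\<And>z. x < z \<Longrightarrow> z \<le> y \<Longrightarrow> \<eta> z"
  shows "hole_count \<eta> y = hole_count \<eta> x"
  using assms by (induction y rule: int_ge_induct) (simp_all add: hole_count_step)

lemma hole_count_next:
  assumes "x < y" "\<not> \<eta> y" "\<And>z. x < z \<Longrightarrow> z < y \<Longrightarrow> \<eta> z"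
  shows "hole_count \<eta> y = hole_count \<eta> x + 1"
proof -
  have "hole_count \<eta> (y - 1) = hole_count \<eta> x"
    by (rule hole_count_const) (use assms in auto)
  with hole_count_step[of \<eta> "y - 1"] assms(2) show ?thesis by simp
qed

lemma hole_count_mono: "x \<le> y \<Longrightarrow> hole_count \<eta> x \<le> hole_count \<eta> y"
  by (induction y rule: int_ge_induct) (simp_all add: hole_count_step)

lemma hole_count_less: "x < y \<Longrightarrow> \<not> \<eta> y \<Longrightarrow> hole_count \<eta> x < hole_count \<eta> y"
  using hole_count_mono[of x "y - 1" \<eta>] hole_count_step[of \<eta> "y - 1"] by simp

lemma hole_count_inj:
  "\<not> \<eta> x \<Longrightarrow> \<not> \<eta> y \<Longrightarrow> hole_count \<eta> x = hole_count \<eta> y \<Longrightarrow> x = y"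
  by (metis hole_count_less less_irrefl linorder_neqE)

lemma hole_count_1: "\<not> \<eta> 1 \<Longrightarrow> hole_count \<eta> 1 = 1"
  by (simp add: hole_count_def)

lemma between_words:
  assumes "word_start n i < z" "z < word_start n (i + 1)"
  shows "subst_map n z"
  using subst_map_in_word[of "z - word_start n i" n i] assms by (simp add: word_start_step)

lemma hole_count_subst_map: "hole_count (subst_map n) (word_start n i) = i"
proof (induction i rule: int_induct[where k = 1])
  case base
  show ?case using not_subst_map_word_start[of n 1] by (simp add: word_start_1 hole_count_1)
next
  case (step1 i)
  have "hole_count (subst_map n) (word_start n (i + 1)) =
      hole_count (subst_map n) (word_start n i) + 1"
    by (rule hole_count_next) (auto intro: between_words)
  with step1 show ?case by simp
next
  case (step2 i)
  have "hole_count (subst_map n) (word_start n i) =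
      hole_count (subst_map n) (word_start n (i - 1)) + 1"
    by (rule hole_count_next) (auto intro: between_words[of n "i - 1"])
  with step2 show ?case by simp
qed

text \<open>Hole numbers increase strictly along the holes, so the hole numbered i can only be
  \<open>word_start n i\<close>; the least gap to a further hole is then \<open>n i\<close>. In
  particular \<open>subst_map\<close> is injective.\<close>

lemma stack_map_subst_map [simp]: "stack_map (subst_map n) = n"
proof
  fix i
  have *: "x = word_start n i" if "hole_count (subst_map n) x = i" "\<not> subst_map n x" for x
    by (rule hole_count_inj[of "subst_map n"]) (use that in \<open>simp_all add: hole_count_subst_map\<close>)
  show "stack_map (subst_map n) i = n i"
    unfolding stack_map_def
  proof (rule Least_equality)
    have "word_start n i + 1 + int (n i) = word_start n (i + 1)" by (simp add: word_start_step)
    then show "\<exists>x. hole_count (subst_map n) x = i \<and> \<not> subst_map n x \<and>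
        \<not> subst_map n (x + 1 + int (n i))"
      by (intro exI[of _ "word_start n i"]) (simp add: hole_count_subst_map)
  next
    fix m
    assume "\<exists>x. hole_count (subst_map n) x = i \<and> \<not> subst_map n x \<and>
        \<not> subst_map n (x + 1 + int m)"
    then have "\<not> subst_map n (word_start n i + (1 + int m))"
      using * by (auto simp: add.assoc)
    then show "n i \<le> m"
      using subst_map_in_word[of "1 + int m" n i] by linarith
  qed
qed

definition two_sided :: "(int \<Rightarrow> bool) \<Rightarrow> bool"
  where "two_sided \<eta> \<longleftrightarrow> (\<forall>k. (\<exists>i>k. \<not> \<eta> i) \<and> (\<exists>i<k. \<not> \<eta> i))"

lemma two_sided_next_hole:
  assumes "two_sided \<eta>"
  obtains j where "\<not> \<eta> (x + 1 + int j)" "\<And>z. x < z \<Longrightarrow> z < x + 1 + int j \<Longrightarrow> \<eta> z"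
proof -
  let ?P = "\<lambda>j. \<not> \<eta> (x + 1 + int j)"
  obtain i where "i > x" "\<not> \<eta> i" using assms by (auto simp: two_sided_def)
  then have "?P (nat (i - x - 1))" by simp
  then have "?P (LEAST j. ?P j)" by (rule LeastI)
  moreover have "\<eta> z" if "x < z" "z < x + 1 + int (LEAST j. ?P j)" for z
    using not_less_Least[of "nat (z - x - 1)" ?P] that by auto
  ultimately show ?thesis by (rule that)
qed

lemma two_sided_prev_hole:
  assumes "two_sided \<eta>"
  obtains j where "\<not> \<eta> (x - int j)" "\<And>z. x - int j < z \<Longrightarrow> z \<le> x \<Longrightarrow> \<eta> z"
proof -
  let ?P = "\<lambda>j. \<not> \<eta> (x - int j)"
  obtain i where "i < x" "\<not> \<eta> i" using assms by (auto simp: two_sided_def)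
  then have "?P (nat (x - i))" by simp
  then have "?P (LEAST j. ?P j)" by (rule LeastI)
  moreover have "\<eta> z" if "x - int (LEAST j. ?P j) < z" "z \<le> x" for z
    using not_less_Least[of "nat (x - z)" ?P] that by auto
  ultimately show ?thesis by (rule that)
qed

lemma two_sided_ex_hole_count:
  assumes "two_sided \<eta>" "\<not> \<eta> 1"
  shows "\<exists>x. \<not> \<eta> x \<and> hole_count \<eta> x = i"
proof (induction i rule: int_induct[where k = 1])
  case base
  show ?case using assms(2) hole_count_1 by blast
next
  case (step1 i)
  then obtain x where x: "\<not> \<eta> x" "hole_count \<eta> x = i" by blast
  obtain j where j: "\<not> \<eta> (x + 1 + int j)" "\<And>z. x < z \<Longrightarrow> z < x + 1 + int j \<Longrightarrow> \<eta> z"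
    using two_sided_next_hole[OF assms(1)] by blast
  then have "hole_count \<eta> (x + 1 + int j) = hole_count \<eta> x + 1"
    by (intro hole_count_next) auto
  with x j show ?case by auto
next
  case (step2 i)
  then obtain x where x: "\<not> \<eta> x" "hole_count \<eta> x = i" by blast
  obtain j where j: "\<not> \<eta> (x - 1 - int j)" "\<And>z. x - 1 - int j < z \<Longrightarrow> z \<le> x - 1 \<Longrightarrow> \<eta> z"
    using two_sided_prev_hole[OF assms(1)] by blast
  then have "hole_count \<eta> x = hole_count \<eta> (x - 1 - int j) + 1"
    using x(1) by (intro hole_count_next) auto
  with x j show ?case by auto
qed

text \<open>With holes on both sides, every integer numbers a hole. The gaps between consecutive
  holes define n, and the recursion identifies the hole positions with
  \<open>word_start n\<close>.\<close>

lemma two_sided_subst_map: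
  assumes "two_sided \<eta>" "\<not> \<eta> 1"
  shows "subst_map (stack_map \<eta>) = \<eta>"
proof -
  obtain p where p: "\<And>i. \<not> \<eta> (p i)" "\<And>i. hole_count \<eta> (p i) = i"
    using two_sided_ex_hole_count[OF assms] by metis
  define n where "n i = nat (p (i + 1) - p i - 1)" for i
  have nxt: "p i < p (i + 1) \<and> (\<forall>z. p i < z \<and> z < p (i + 1) \<longrightarrow> \<eta> z)" for i
  proof -
    obtain j where j: "\<not> \<eta> (p i + 1 + int j)" "\<And>z. p i < z \<Longrightarrow> z < p i + 1 + int j \<Longrightarrow> \<eta> z"
      using two_sided_next_hole[OF assms(1)] by blast
    then have "hole_count \<eta> (p i + 1 + int j) = hole_count \<eta> (p i) + 1"
      by (intro hole_count_next) auto
    then have "p (i + 1) = p i + 1 + int j"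
      using hole_count_inj[of \<eta> "p (i + 1)" "p i + 1 + int j"] j(1) p by simp
    with j(2) show ?thesis by simp
  qed
  have "p 1 = 1" using hole_count_inj[of \<eta> "p 1" 1] p assms(2) by (simp add: hole_count_1)
  then have w: "p = word_start n"
    using nxt by (intro word_start_unique) (simp_all add: n_def)
  have "subst_map n x = \<eta> x" for x
  proof -
    obtain i where i: "p i \<le> x" "x < p (i + 1)" using word_cover[of n x] w by auto
    show ?thesis
    proof (cases "x = p i")
      case True
      then show ?thesis using p(1) by (simp add: w)
    next
      case False
      with i have "subst_map n x" by (intro between_words[of n i]) (simp_all add: w)
      with False i nxt[of i] show ?thesis by auto
    qed
  qed
  then have "subst_map n = \<eta>" by blast
  \<comment> \<open>The left inverse gives \<open>stack_map \<eta> = n\<close> without evaluating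
    the LEAST again.\<close>
  then show ?thesis by (metis stack_map_subst_map)
qed

lemma measurable_hole_count [measurable]:
  "(\<lambda>\<eta>. hole_count \<eta> x) \<in> measurable borel (count_space UNIV)"
proof (induction x rule: int_induct[where k = 0])
  case (step1 i)
  then show ?case unfolding hole_count_step
    by (intro measurable_countable_op2[where h = "\<lambda>a b. a + of_bool (\<not> b)"]) simp_all
next
  case (step2 i)
  have "hole_count \<eta> (i - 1) = hole_count \<eta> i - of_bool (\<not> \<eta> i)" for \<eta>
    using hole_count_step[of \<eta> "i - 1"] by simp
  with step2 show ?case
    by (auto intro: measurable_countable_op2[where h = "\<lambda>a b. a - of_bool (\<not> b)"])
qed (simp add: hole_count_def)

lemma measurable_stack_map [measurable]: "stack_map \<in> measurable borel borel"
  by (rule measurable_config) (unfold stack_map_def, measurable)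

section \<open>Translation invariant states\<close>

lemma TI_state: "\<mu> \<in> TI \<Longrightarrow> state \<mu>"
  by (simp add: TI_def)

lemma TI_distr_shift:
  fixes \<mu> :: "(int \<Rightarrow> 'a::{countable, t2_space, second_countable_topology}) measure"
  assumes "\<mu> \<in> TI"
  shows "distr \<mu> borel (shift k) = \<mu>"
proof -
  note [measurable_cong] = sets_state[OF TI_state[OF assms]]
  have 1: "distr \<mu> borel (shift 1) = \<mu>" using assms by (simp add: TI_def)
  have comp: "distr (distr \<mu> borel (shift k)) borel (shift l) = distr \<mu> borel (shift (l + k))" for k l
    by (subst distr_distr) (simp_all add: comp_def shift_shift)
  show ?thesis
  proof (induction k rule: int_induct[where k = 0])
    case base
    show ?case
      using distr_id2[of borel \<mu>] sets_state[OF TI_state[OF assms]] by (simp add: shift_0 id_def)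
  next
    case (step1 k)
    then show ?case using comp[of k 1] 1 by (simp add: add.commute)
  next
    case (step2 k)
    then show ?case using comp[of 1 "k - 1"] 1 by simp
  qed
qed

lemma TI_nn_integral_shift:
  fixes \<mu> :: "(int \<Rightarrow> 'a::{countable, t2_space, second_countable_topology}) measure"
  assumes "\<mu> \<in> TI" and [measurable]: "F \<in> borel_measurable borel"
  shows "(\<integral>\<^sup>+ \<eta>. F (shift k \<eta>) \<partial>\<mu>) = (\<integral>\<^sup>+ \<eta>. F \<eta> \<partial>\<mu>)"
proof -
  note [measurable_cong] = sets_state[OF TI_state[OF assms(1)]]
  have "(\<integral>\<^sup>+ \<eta>. F \<eta> \<partial>\<mu>) = (\<integral>\<^sup>+ \<eta>. F \<eta> \<partial>distr \<mu> borel (shift k))"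
    by (simp add: TI_distr_shift[OF assms(1)])
  also have "\<dots> = (\<integral>\<^sup>+ \<eta>. F (shift k \<eta>) \<partial>\<mu>)" by (simp add: nn_integral_distr)
  finally show ?thesis ..
qed

lemma state_eqI:
  assumes "sets \<mu> = sets borel" "sets \<nu> = sets borel"
    and "\<And>B. B \<in> sets borel \<Longrightarrow> (\<integral>\<^sup>+ x. indicator B x \<partial>\<mu>) = (\<integral>\<^sup>+ x. indicator B x \<partial>\<nu>)"
  shows "\<mu> = \<nu>"
  using assms by (intro measure_eqI) simp_all

lemma TI_I:
  fixes \<mu> :: "(int \<Rightarrow> 'a::{countable, t2_space, second_countable_topology}) measure"
  assumes "state \<mu>"
    and eq: "\<And>B. B \<in> sets borel \<Longrightarrow>
      (\<integral>\<^sup>+ \<eta>. indicator B (shift 1 \<eta>) \<partial>\<mu>) = (\<integral>\<^sup>+ \<eta>. indicator B \<eta> \<partial>\<mu>)"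
  shows "\<mu> \<in> TI"
proof -
  note [measurable_cong] = sets_state[OF assms(1)]
  have "distr \<mu> borel (shift 1) = \<mu>"
  proof (rule state_eqI)
    show "(\<integral>\<^sup>+ x. indicator B x \<partial>distr \<mu> borel (shift 1)) = (\<integral>\<^sup>+ x. indicator B x \<partial>\<mu>)"
      if [measurable]: "B \<in> sets borel" for B
      by (subst nn_integral_distr) (simp_all add: eq[OF that])
  qed (simp_all add: sets_state[OF assms(1)])
  with assms(1) show ?thesis by (simp add: TI_def)
qed

text \<open>The events that k is the last hole in direction s are disjoint for different k and
  equally likely. Infinitely many such events in a probability space are null.\<close>

lemma TI_no_extreme_hole:
  fixes \<mu> :: "(int \<Rightarrow> bool) measure"
  assumes "\<mu> \<in> TI" and s: "s = 1 \<or> s = - 1"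
  shows "AE \<eta> in \<mu>. \<not> (\<not> \<eta> k \<and> (\<forall>i>0. \<eta> (k + s * i)))"
proof -
  note [measurable_cong] = sets_state[OF TI_state[OF assms(1)]]
  note [simp] = sets_state[OF TI_state[OF assms(1)]] space_state[OF TI_state[OF assms(1)]]
  interpret prob_space \<mu> by (rule prob_space_state[OF TI_state[OF assms(1)]])
  define E where "E k = {\<eta>. \<not> \<eta> k \<and> (\<forall>i>0. \<eta> (k + s * i))}" for k :: int
  have [measurable]: "E k \<in> sets borel" for k
  proof -
    have "Measurable.pred borel (\<lambda>\<eta>::int\<Rightarrow>bool. \<not> \<eta> k \<and> (\<forall>i>0. \<eta> (k + s * i)))" by measurable
    then show ?thesis by (simp add: E_def pred_def)
  qed
  have em: "emeasure \<mu> (E k) = emeasure \<mu> (E 0)" for k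
  proof -
    have "emeasure \<mu> (E k) = (\<integral>\<^sup>+ \<eta>. indicator (E 0) (shift (- k) \<eta>) \<partial>\<mu>)"
      by (subst nn_integral_indicator[symmetric], simp, intro nn_integral_cong)
        (auto simp: E_def shift_def indicator_def add.commute)
    also have "\<dots> = (\<integral>\<^sup>+ \<eta>. indicator (E 0) \<eta> \<partial>\<mu>)"
      by (rule TI_nn_integral_shift[OF assms(1)]) measurable
    finally show ?thesis by simp
  qed
  have eq: "measure \<mu> (E k) = measure \<mu> (E 0)" for k
    using em[of k] by (simp add: measure_def)
  have "k = l" if "\<eta> \<in> E k" "\<eta> \<in> E l" for k l \<eta>
  proof (rule ccontr)
    assume "k \<noteq> l"
    then consider "s * (l - k) > 0" | "s * (k - l) > 0" using s by (cases "k < l") auto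
    then show False
    proof cases
      case 1
      with that s show False by (auto simp: E_def dest!: spec[of _ "s * (l - k)"])
    next
      case 2
      with that s show False by (auto simp: E_def dest!: spec[of _ "s * (k - l)"])
    qed
  qed
  then have "disjoint_family (\<lambda>i::nat. E (int i))"
    by (fastforce simp: disjoint_family_on_def)
  then have "(\<lambda>i::nat. measure \<mu> (E (int i))) sums measure \<mu> (\<Union>i. E (int i))"
    by (intro finite_measure_UNION) auto
  then have "summable (\<lambda>i::nat. measure \<mu> (E (int i)))" by (simp add: sums_iff)
  moreover have "(\<lambda>i::nat. measure \<mu> (E (int i))) = (\<lambda>i. measure \<mu> (E 0))"
    using eq by blast
  ultimately have "summable (\<lambda>i::nat. measure \<mu> (E 0))" by (simp only:)
  then have "measure \<mu> (E k) = 0" using eq[of k] by (simp add: summable_const_iff)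
  then have "emeasure \<mu> (E k) = 0" by (simp add: emeasure_eq_measure)
  then show ?thesis
    by (intro AE_I[where N = "E k"]) (auto simp: E_def)
qed

lemma const_True_measurable [measurable]: "{\<lambda>_. True} \<in> sets (borel :: (int \<Rightarrow> bool) measure)"
proof -
  have "Measurable.pred borel (\<lambda>\<eta>::int \<Rightarrow> bool. \<forall>i. \<eta> i)" by measurable
  moreover have "{\<eta>::int \<Rightarrow> bool. \<forall>i. \<eta> i} = {\<lambda>_. True}" by auto
  ultimately show ?thesis by (simp add: pred_def)
qed

text \<open>Regularity supplies one hole, and almost surely no hole is extreme on either side, so
  passing from hole to hole leaves every bounded region.\<close>

lemma TI_two_sided:
  assumes "\<mu> \<in> TI" "regular_fssep \<mu>"
  shows "AE \<eta> in \<mu>. two_sided \<eta>"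
proof -
  note [simp] = sets_state[OF TI_state[OF assms(1)]] space_state[OF TI_state[OF assms(1)]]
  interpret prob_space \<mu> by (rule prob_space_state[OF TI_state[OF assms(1)]])
  have 0: "AE \<eta> in \<mu>. \<eta> \<noteq> (\<lambda>_. True)"
    using assms(2) by (intro AE_I[where N = "{\<lambda>_. True}"])
      (auto simp: regular_fssep_def emeasure_eq_measure)
  have 1: "AE \<eta> in \<mu>. \<forall>k::int. \<not> (\<not> \<eta> k \<and> (\<forall>i>0. \<eta> (k + 1 * i)))"
    using TI_no_extreme_hole[OF assms(1), of 1] by (simp add: AE_all_countable)
  have 2: "AE \<eta> in \<mu>. \<forall>k::int. \<not> (\<not> \<eta> k \<and> (\<forall>i>0. \<eta> (k + (- 1) * i)))"
    using TI_no_extreme_hole[OF assms(1), of "- 1"] by (simp add: AE_all_countable)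
  show ?thesis
    using 0 1 2
  proof eventually_elim
    case (elim \<eta>)
    obtain h where h: "\<not> \<eta> h" using elim(1) by auto
    have right: "\<exists>i>k. \<not> \<eta> i" if "\<not> \<eta> k" for k
      using elim(2) that by (metis mult_1 less_add_same_cancel1)
    have left: "\<exists>i<k. \<not> \<eta> i" if "\<not> \<eta> k" for k
      using elim(3)[rule_format, of k] that by (metis add_less_same_cancel1 mult_minus1 neg_less_0_iff_less)
    have "\<exists>i>k. \<not> \<eta> i" for k
    proof (cases "k \<le> h")
      case True
      then show ?thesis using right[OF h] by (meson le_less_trans)
    next
      case False
      then have "h \<le> k" by simp
      then show ?thesis
        using h right
      proof (induction k rule: int_ge_induct)
        case (step k)
        then obtain i where i: "i > k" "\<not> \<eta> i" by blast
        then show ?case using right[OF i(2)] by (cases "i > k + 1") (auto intro: less_trans)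
      qed auto
    qed
    moreover have "\<exists>i<k. \<not> \<eta> i" for k
    proof (cases "h \<le> k")
      case True
      then show ?thesis using left[OF h] by (meson less_le_trans)
    next
      case False
      then have "k \<le> h" by simp
      then show ?thesis
        using h left
      proof (induction k rule: int_le_induct)
        case (step k)
        then obtain i where i: "i < k" "\<not> \<eta> i" by blast
        then show ?case using left[OF i(2)] by (cases "i < k - 1") (auto intro: less_trans)
      qed auto
    qed
    ultimately show "two_sided \<eta>" by (auto simp: two_sided_def)
  qed
qed

section \<open>Phi on regular translation invariant states\<close>

lemma M_ssm_TI: "\<nu> \<in> M_ssm \<Longrightarrow> \<nu> \<in> TI"
  and M_fssep_TI: "\<mu> \<in> M_fssep \<Longrightarrow> \<mu> \<in> TI"
  by (simp_all add: M_ssm_def M_fssep_def)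

lemma M_ssm_state: "\<nu> \<in> M_ssm \<Longrightarrow> state \<nu>"
  and M_fssep_state: "\<mu> \<in> M_fssep \<Longrightarrow> state \<mu>"
  by (simp_all add: TI_state M_ssm_TI M_fssep_TI)

lemma nn_integral_one_state: "state \<nu> \<Longrightarrow> (\<integral>\<^sup>+ x. 1 \<partial>\<nu>) = 1"
  by (simp add: prob_space.emeasure_space_1 prob_space_state)

lemma Z_norm_ge_1:
  assumes "state \<nu>"
  shows "Z_norm \<nu> \<ge> 1"
proof -
  have "(\<integral>\<^sup>+ n. 1 \<partial>\<nu>) \<le> (\<integral>\<^sup>+ n. of_nat (n 1 + 1) \<partial>\<nu>)"
    by (intro nn_integral_mono) simp
  then show ?thesis by (simp only: Z_norm_eq[OF assms] nn_integral_one_state[OF assms])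
qed

lemma Z_norm_finite_iff:
  assumes "\<nu> \<in> TI"
  shows "Z_norm \<nu> < \<infinity> \<longleftrightarrow> regular_ssm \<nu>"
proof -
  note [measurable_cong] = sets_state[OF TI_state[OF assms]]
  have "Z_norm \<nu> = (\<integral>\<^sup>+ n. of_nat (n 1) + 1 \<partial>\<nu>)"
    by (simp add: Z_norm_eq[OF TI_state[OF assms]] add.commute)
  also have "\<dots> = (\<integral>\<^sup>+ n. of_nat (n 1) \<partial>\<nu>) + (\<integral>\<^sup>+ n. 1 \<partial>\<nu>)"
    by (rule nn_integral_add) measurable
  \<comment> \<open>\<open>Z_norm\<close> looks at stack 1, regularity at stack 0; invariance
    identifies the two means.\<close>
  also have "(\<integral>\<^sup>+ n. of_nat (n 1) \<partial>\<nu>) = (\<integral>\<^sup>+ n. of_nat (shift 1 n 1) \<partial>\<nu>)"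
    by (rule TI_nn_integral_shift[OF assms, symmetric]) measurable
  also have "(\<integral>\<^sup>+ n. 1 \<partial>\<nu>) = 1" by (rule nn_integral_one_state[OF TI_state[OF assms]])
  finally show ?thesis by (simp add: regular_ssm_def shift_def less_top)
qed

lemma M_ssm_Z_norm:
  assumes "\<nu> \<in> M_ssm"
  shows "Z_norm \<nu> \<noteq> 0" "Z_norm \<nu> \<noteq> \<infinity>" "inverse (Z_norm \<nu>) \<noteq> 0" "inverse (Z_norm \<nu>) \<noteq> \<infinity>"
    "inverse (Z_norm \<nu>) * Z_norm \<nu> = 1"
proof -
  show *: "Z_norm \<nu> \<noteq> 0" "Z_norm \<nu> \<noteq> \<infinity>"
    using Z_norm_ge_1[OF M_ssm_state[OF assms]] Z_norm_finite_iff[OF M_ssm_TI[OF assms]] assms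
    by (auto simp: M_ssm_def)
  then show "inverse (Z_norm \<nu>) \<noteq> 0" "inverse (Z_norm \<nu>) \<noteq> \<infinity>"
    "inverse (Z_norm \<nu>) * Z_norm \<nu> = 1"
    by (simp_all add: ennreal_inverse_eq_0_iff ennreal_inverse_eq_top_iff mult.commute
        flip: divide_ennreal_def) (simp add: less_top)
qed

lemma state_Phi:
  assumes "\<nu> \<in> M_ssm"
  shows "state (Phi \<nu>)"
  unfolding state_def
proof
  note st = M_ssm_state[OF assms]
  show "sets (Phi \<nu>) = sets borel" by (rule sets_Phi[OF st])
  have "emeasure (Phi \<nu>) (space (Phi \<nu>)) = (\<integral>\<^sup>+ \<eta>. 1 \<partial>Phi \<nu>)" by simp
  also have "\<dots> = inverse (Z_norm \<nu>) * Z_norm \<nu>"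
    by (subst nn_integral_Phi[OF st]) (measurable, simp only: word_sum_one Z_norm_eq[OF st])
  finally show "prob_space (Phi \<nu>)" by (intro prob_spaceI) (simp add: M_ssm_Z_norm[OF assms])
qed

text \<open>Boundary terms stand on both sides because subtraction in \<open>ennreal\<close> would
  not cancel infinite values.\<close>

lemma telescope:
  fixes g :: "int \<Rightarrow> ennreal"
  shows "(\<Sum>j\<le>m. g (int j - 1)) + g (int m) = (\<Sum>j\<le>m. g (int j)) + g (- 1)"
proof (induction m)
  case (Suc m)
  have "(\<Sum>j\<le>Suc m. g (int j - 1)) + g (int (Suc m)) =
      (\<Sum>j\<le>m. g (int j - 1)) + g (int m) + g (int (Suc m))"
    by simp
  with Suc show ?case by (simp add: ac_simps)
qed (simp add: add.commute)

lemma nn_integral_indicator_finite: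
  assumes "state \<nu>"
  shows "(\<integral>\<^sup>+ x. indicator B (f x) \<partial>\<nu>) \<noteq> (\<infinity>::ennreal)"
proof -
  have "(\<integral>\<^sup>+ x. indicator B (f x) \<partial>\<nu>) \<le> (\<integral>\<^sup>+ x. (1::ennreal) \<partial>\<nu>)"
    by (intro nn_integral_mono) (simp add: indicator_def)
  also have "\<dots> = 1" by (rule nn_integral_one_state[OF assms])
  finally show ?thesis by (auto simp: top_unique)
qed

text \<open>Translating by one site drops the last site of word 1 and gains the site before its
  hole. By \<open>subst_map_shift1\<close> the dropped term is the gained one evaluated at the next
  stack, so both have the same finite integral, that of G.\<close>

lemma Phi_TI:
  assumes "\<nu> \<in> M_ssm"
  shows "Phi \<nu> \<in> TI"
proof (rule TI_I[OF state_Phi[OF assms]])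
  fix B :: "(int \<Rightarrow> bool) set"
  assume [measurable]: "B \<in> sets borel"
  note st = M_ssm_state[OF assms]
  note [measurable_cong] = sets_state[OF st]
  define G :: "(int \<Rightarrow> nat) \<Rightarrow> ennreal" where "G n = indicator B (shift 1 (subst_map n))" for n
  have [measurable]: "G \<in> borel_measurable borel" unfolding G_def by measurable
  have G: "(\<integral>\<^sup>+ n. G n \<partial>\<nu>) \<noteq> \<infinity>"
    unfolding G_def by (rule nn_integral_indicator_finite[OF st])
  have "word_sum (\<lambda>\<eta>. indicator B (shift 1 \<eta>)) n + G (shift (- 1) n) = word_sum (indicator B) n + G n" for n
    using telescope[of "\<lambda>j. indicator B (shift (- j) (subst_map n))" "n 1"]
    by (simp add: word_sum_def G_def shift_shift subst_map_shift1)
  then have "(\<integral>\<^sup>+ n. word_sum (\<lambda>\<eta>. indicator B (shift 1 \<eta>)) n + G (shift (- 1) n) \<partial>\<nu>) =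
      (\<integral>\<^sup>+ n. word_sum (indicator B) n + G n \<partial>\<nu>)"
    by simp
  then have "(\<integral>\<^sup>+ n. word_sum (\<lambda>\<eta>. indicator B (shift 1 \<eta>)) n \<partial>\<nu>) + (\<integral>\<^sup>+ n. G (shift (- 1) n) \<partial>\<nu>) =
      (\<integral>\<^sup>+ n. word_sum (indicator B) n \<partial>\<nu>) + (\<integral>\<^sup>+ n. G n \<partial>\<nu>)"
    by (simp add: nn_integral_add)
  moreover have "(\<integral>\<^sup>+ n. G (shift (- 1) n) \<partial>\<nu>) = (\<integral>\<^sup>+ n. G n \<partial>\<nu>)"
    by (rule TI_nn_integral_shift[OF M_ssm_TI[OF assms]]) measurable
  ultimately have "(\<integral>\<^sup>+ n. word_sum (\<lambda>\<eta>. indicator B (shift 1 \<eta>)) n \<partial>\<nu>) =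
      (\<integral>\<^sup>+ n. word_sum (indicator B) n \<partial>\<nu>)"
    using G ennreal_add_left_cancel[of "\<integral>\<^sup>+ n. G n \<partial>\<nu>"] by (simp add: add.commute)
  then show "(\<integral>\<^sup>+ \<eta>. indicator B (shift 1 \<eta>) \<partial>Phi \<nu>) = (\<integral>\<^sup>+ \<eta>. indicator B \<eta> \<partial>Phi \<nu>)"
    by (simp add: nn_integral_Phi[OF st] del: nn_integral_indicator)
qed

lemma Phi_regular:
  assumes "\<nu> \<in> M_ssm"
  shows "regular_fssep (Phi \<nu>)"
proof -
  note st = M_ssm_state[OF assms]
  have "shift k (subst_map n) \<noteq> (\<lambda>_. True)" for k n
  proof
    assume "shift k (subst_map n) = (\<lambda>_. True)"
    then have "shift k (subst_map n) (word_start n 1 + k)" by simp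
    then show False by (simp add: shift_def)
  qed
  then have "word_sum (indicator {\<lambda>_. True}) n = 0" for n
    by (simp add: word_sum_def)
  then have "emeasure (Phi \<nu>) {\<lambda>_. True} = 0"
    using nn_integral_Phi[OF st, of "indicator {\<lambda>_. True}"] by (simp add: sets_Phi[OF st])
  then show ?thesis by (simp add: regular_fssep_def measure_def)
qed

lemma Phi_in_M_fssep: "\<nu> \<in> M_ssm \<Longrightarrow> Phi \<nu> \<in> M_fssep"
  by (simp add: M_fssep_def Phi_TI Phi_regular)

section \<open>The inverse of \<open>Phi\<close> and Kac's formula\<close>

abbreviation hole_at_1 :: "(int \<Rightarrow> bool) set"
  where "hole_at_1 \<equiv> {\<eta>. \<not> \<eta> 1}"

text \<open>The Palm measure of the point process of holes, with its configurations read as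
  sequences of stacks.\<close>

definition Psi :: "(int \<Rightarrow> bool) measure \<Rightarrow> (int \<Rightarrow> nat) measure"
  where "Psi \<mu> = distr (uniform_measure \<mu> hole_at_1) borel stack_map"

lemma hole_at_1_measurable [measurable]: "hole_at_1 \<in> sets borel"
proof -
  have "Measurable.pred borel (\<lambda>\<eta>::int \<Rightarrow> bool. \<not> \<eta> 1)" by measurable
  then show ?thesis by (simp add: pred_def)
qed

lemma nn_integral_Psi:
  assumes "state \<mu>" and [measurable]: "F \<in> borel_measurable borel"
  shows "(\<integral>\<^sup>+ n. F n \<partial>Psi \<mu>) =
    (\<integral>\<^sup>+ \<eta>. F (stack_map \<eta>) * indicator hole_at_1 \<eta> \<partial>\<mu>) / emeasure \<mu> hole_at_1"
proof -
  note [measurable_cong] = sets_state[OF assms(1)]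
  have [measurable]: "stack_map \<in> measurable (uniform_measure \<mu> hole_at_1) borel"
    by (simp add: measurable_def sets_state[OF assms(1)] space_state[OF assms(1)])
      (use measurable_stack_map in \<open>simp add: measurable_def\<close>)
  show ?thesis
    unfolding Psi_def by (subst nn_integral_distr) (simp_all add: nn_integral_uniform_measure)
qed

text \<open>Among the sites of word 1 only the first is empty, so conditioning on a hole at site 1
  selects the base j = 0 of the suspension.\<close>

lemma word_sum_hole:
  "word_sum (\<lambda>\<eta>. G \<eta> * indicator hole_at_1 \<eta>) = (\<lambda>n. G (subst_map n))"
proof
  fix n
  have "indicator hole_at_1 (shift (- int j) (subst_map n)) = (if j = 0 then 1 else 0 :: ennreal)"
    if "j \<le> n 1" for j
    using subst_map_in_word[of "int j" n 1] not_subst_map_word_start[of n 1] that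
    by (auto simp: shift_def word_start_1)
  then have "word_sum (\<lambda>\<eta>. G \<eta> * indicator hole_at_1 \<eta>) n =
      (\<Sum>j\<le>n 1. if j = 0 then G (shift (- int j) (subst_map n)) else 0)"
    unfolding word_sum_def by (intro sum.cong) auto
  also have "\<dots> = G (subst_map n)" by (simp add: shift_0)
  finally show "word_sum (\<lambda>\<eta>. G \<eta> * indicator hole_at_1 \<eta>) n = G (subst_map n)" .
qed

lemma emeasure_Phi_hole:
  assumes "\<nu> \<in> M_ssm"
  shows "emeasure (Phi \<nu>) hole_at_1 = inverse (Z_norm \<nu>)"
proof -
  note st = M_ssm_state[OF assms]
  have "emeasure (Phi \<nu>) hole_at_1 = (\<integral>\<^sup>+ \<eta>. 1 * indicator hole_at_1 \<eta> \<partial>Phi \<nu>)"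
    by (simp add: sets_Phi[OF st])
  also have "\<dots> = inverse (Z_norm \<nu>) * (\<integral>\<^sup>+ n. 1 \<partial>\<nu>)"
    by (subst nn_integral_Phi[OF st]) (measurable, simp only: word_sum_hole)
  finally show ?thesis by (simp only: nn_integral_one_state[OF st] mult_1_right)
qed

lemma Psi_Phi:
  assumes "\<nu> \<in> M_ssm"
  shows "Psi (Phi \<nu>) = \<nu>"
proof (rule state_eqI)
  note st = M_ssm_state[OF assms]
  fix B :: "(int \<Rightarrow> nat) set"
  assume [measurable]: "B \<in> sets borel"
  have "(\<integral>\<^sup>+ n. indicator B n \<partial>Psi (Phi \<nu>)) =
      (\<integral>\<^sup>+ \<eta>. indicator B (stack_map \<eta>) * indicator hole_at_1 \<eta> \<partial>Phi \<nu>) / inverse (Z_norm \<nu>)"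
    by (subst nn_integral_Psi[OF state_Phi[OF assms]]) (simp_all add: emeasure_Phi_hole[OF assms])
  also have "(\<integral>\<^sup>+ \<eta>. indicator B (stack_map \<eta>) * indicator hole_at_1 \<eta> \<partial>Phi \<nu>) =
      inverse (Z_norm \<nu>) * (\<integral>\<^sup>+ n. indicator B n \<partial>\<nu>)"
    by (subst nn_integral_Phi[OF st])
      (measurable, simp only: word_sum_hole stack_map_subst_map)
  also have "inverse (Z_norm \<nu>) * (\<integral>\<^sup>+ n. indicator B n \<partial>\<nu>) / inverse (Z_norm \<nu>) =
      (\<integral>\<^sup>+ n. indicator B n \<partial>\<nu>)"
    by (subst mult.commute, intro ennreal_mult_divide_eq)
      (use M_ssm_Z_norm[OF assms] in simp_all)
  finally show "(\<integral>\<^sup>+ n. indicator B n \<partial>Psi (Phi \<nu>)) = (\<integral>\<^sup>+ n. indicator B n \<partial>\<nu>)" .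
qed (use assms in \<open>simp_all add: Psi_def M_ssm_state sets_state\<close>)

text \<open>Were site 1 almost surely occupied, invariance would fill every site, against
  \<open>two_sided\<close>. Thus \<open>Psi\<close> conditions on an event of positive
  probability.\<close>

lemma M_fssep_hole_pos:
  assumes "\<mu> \<in> M_fssep"
  shows "emeasure \<mu> hole_at_1 \<noteq> 0" "emeasure \<mu> hole_at_1 \<noteq> \<infinity>"
proof -
  note st = M_fssep_state[OF assms]
  note [measurable_cong] = sets_state[OF st]
  interpret prob_space \<mu> by (rule prob_space_state[OF st])
  show "emeasure \<mu> hole_at_1 \<noteq> \<infinity>" by simp
  show "emeasure \<mu> hole_at_1 \<noteq> 0"
  proof
    assume "emeasure \<mu> hole_at_1 = 0"
    then have 0: "(\<integral>\<^sup>+ \<eta>. indicator hole_at_1 \<eta> \<partial>\<mu>) = 0" by (simp add: sets_state[OF st])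
    have "AE \<eta> in \<mu>. \<eta> i" for i
    proof -
      have "(\<integral>\<^sup>+ \<eta>. indicator hole_at_1 (shift (1 - i) \<eta>) \<partial>\<mu>) = 0"
        by (subst TI_nn_integral_shift[OF M_fssep_TI[OF assms]]) (simp_all add: 0 del: nn_integral_indicator)
      then have "AE \<eta> in \<mu>. indicator hole_at_1 (shift (1 - i) \<eta>) = (0::ennreal)"
        by (subst (asm) nn_integral_0_iff_AE) simp_all
      then show ?thesis by eventually_elim (simp add: shift_def indicator_def split: if_splits)
    qed
    then have "AE \<eta> in \<mu>. \<forall>i. \<eta> i" by (simp add: AE_all_countable)
    moreover have "AE \<eta> in \<mu>. two_sided \<eta>"
      using assms TI_two_sided by (simp add: M_fssep_def)
    ultimately have "AE \<eta> in \<mu>. False"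
      by eventually_elim (auto simp: two_sided_def)
    then show False by simp
  qed
qed

text \<open>Mass transport: almost every configuration has exactly one last hole at or before site 1,
  and the \<open>j\<close>-th summand collects the configurations whose last hole is at \<open>1 - j\<close>.\<close>

lemma M_fssep_mass_transport:
  assumes "\<mu> \<in> M_fssep" and [measurable]: "F \<in> borel_measurable borel"
  shows "(\<Sum>j. \<integral>\<^sup>+ \<eta>. indicator {\<eta>. \<not> \<eta> 1 \<and> (\<forall>i. 1 < i \<and> i \<le> 1 + int j \<longrightarrow> \<eta> i)} \<eta> *
      F (shift (- int j) \<eta>) \<partial>\<mu>) = (\<integral>\<^sup>+ \<eta>. F \<eta> \<partial>\<mu>)"
proof -
  note st = M_fssep_state[OF assms(1)]
  note [measurable_cong] = sets_state[OF st]
  let ?E = "\<lambda>j. {\<eta>::int \<Rightarrow> bool. \<not> \<eta> (1 - int j) \<and> (\<forall>i. 1 - int j < i \<and> i \<le> 1 \<longrightarrow> \<eta> i)}"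
  have [measurable]: "?E j \<in> sets borel" for j
  proof -
    have "Measurable.pred borel (\<lambda>\<eta>::int \<Rightarrow> bool. \<not> \<eta> (1 - int j) \<and>
        (\<forall>i. 1 - int j < i \<and> i \<le> 1 \<longrightarrow> \<eta> i))" by measurable
    then show ?thesis by (simp add: pred_def)
  qed
  \<comment> \<open>Translating by -j turns a hole at 1 followed by j particles into a hole at 1 - j
    with particles from there up to site 1.\<close>
  have "(\<integral>\<^sup>+ \<eta>. indicator {\<eta>. \<not> \<eta> 1 \<and> (\<forall>i. 1 < i \<and> i \<le> 1 + int j \<longrightarrow> \<eta> i)} \<eta> *
      F (shift (- int j) \<eta>) \<partial>\<mu>) = (\<integral>\<^sup>+ \<eta>. indicator (?E j) \<eta> * F \<eta> \<partial>\<mu>)" for j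
  proof -
    have "(\<forall>i. 1 < i \<and> i \<le> 1 + int j \<longrightarrow> \<eta> i) \<longleftrightarrow>
        (\<forall>i. 1 - int j < i \<and> i \<le> 1 \<longrightarrow> \<eta> (i + int j))" for \<eta> :: "int \<Rightarrow> bool"
      by (auto dest: spec[of _ "_ + int j"] spec[of _ "_ - int j"])
    then have "(\<integral>\<^sup>+ \<eta>. indicator {\<eta>. \<not> \<eta> 1 \<and> (\<forall>i. 1 < i \<and> i \<le> 1 + int j \<longrightarrow> \<eta> i)} \<eta> *
        F (shift (- int j) \<eta>) \<partial>\<mu>) =
      (\<integral>\<^sup>+ \<eta>. (\<lambda>\<eta>. indicator (?E j) \<eta> * F \<eta>) (shift (- int j) \<eta>) \<partial>\<mu>)"
      by (intro nn_integral_cong) (simp add: indicator_def shift_def)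
    also have "\<dots> = (\<integral>\<^sup>+ \<eta>. indicator (?E j) \<eta> * F \<eta> \<partial>\<mu>)"
      by (rule TI_nn_integral_shift[OF M_fssep_TI[OF assms(1)]]) measurable
    finally show ?thesis .
  qed
  then have "(\<Sum>j. \<integral>\<^sup>+ \<eta>. indicator {\<eta>. \<not> \<eta> 1 \<and> (\<forall>i. 1 < i \<and> i \<le> 1 + int j \<longrightarrow> \<eta> i)} \<eta> *
      F (shift (- int j) \<eta>) \<partial>\<mu>) = (\<integral>\<^sup>+ \<eta>. (\<Sum>j. F \<eta> * indicator (?E j) \<eta>) \<partial>\<mu>)"
    by (subst nn_integral_suminf) (simp_all add: mult.commute)
  also have "\<dots> = (\<integral>\<^sup>+ \<eta>. F \<eta> \<partial>\<mu>)"
  proof (rule nn_integral_cong_AE)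
    have "AE \<eta> in \<mu>. two_sided \<eta>"
      using assms TI_two_sided by (simp add: M_fssep_def)
    then show "AE \<eta> in \<mu>. (\<Sum>j. F \<eta> * indicator (?E j) \<eta>) = F \<eta>"
    proof eventually_elim
      case (elim \<eta>)
      obtain j where j: "\<not> \<eta> (1 - int j)" "\<And>z. 1 - int j < z \<Longrightarrow> z \<le> 1 \<Longrightarrow> \<eta> z"
        using two_sided_prev_hole[OF elim, of 1] by blast
      have "disjoint_family ?E"
      proof (unfold disjoint_family_on_def, intro ballI impI)
        fix k l :: nat
        assume "k \<noteq> l"
        then consider "1 - int k < 1 - int l" | "1 - int l < 1 - int k" by linarith
        then show "?E k \<inter> ?E l = {}" by cases auto
      qed
      then show ?case
        by (intro suminf_cmult_indicator[where f = "\<lambda>_. F \<eta>" and i = j]) (use j in auto)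
    qed
  qed
  finally show ?thesis .
qed

lemma M_fssep_AE_subst_map:
  assumes "\<mu> \<in> M_fssep"
  shows "AE \<eta> in \<mu>. \<not> \<eta> 1 \<longrightarrow> (\<exists>n. subst_map n = \<eta>)"
proof -
  have "AE \<eta> in \<mu>. two_sided \<eta>"
    using assms TI_two_sided by (simp add: M_fssep_def)
  then show ?thesis by eventually_elim (blast intro: two_sided_subst_map)
qed

text \<open>The first hole beyond site 1 is at \<open>2 + int (n 1)\<close>. This rewrites the
  events of the mass transport as conditions on the height of stack 1.\<close>

lemma subst_map_occupied_iff:
  "(\<forall>i. 1 < i \<and> i \<le> 1 + int j \<longrightarrow> subst_map n i) \<longleftrightarrow> j \<le> n 1"
proof
  assume *: "\<forall>i. 1 < i \<and> i \<le> 1 + int j \<longrightarrow> subst_map n i"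
  have "word_start n (1 + 1) = 2 + int (n 1)"
    unfolding word_start_step word_start_1 by simp
  then have "\<not> subst_map n (2 + int (n 1))"
    using not_subst_map_word_start[of n "1 + 1"] by simp
  with * have "\<not> 2 + int (n 1) \<le> 1 + int j" by auto
  then show "j \<le> n 1" by simp
next
  assume "j \<le> n 1"
  then show "\<forall>i. 1 < i \<and> i \<le> 1 + int j \<longrightarrow> subst_map n i"
    using subst_map_in_word[of "i - 1" n 1 for i] by (auto simp: word_start_1)
qed

lemma state_Psi:
  assumes "\<mu> \<in> M_fssep"
  shows "state (Psi \<mu>)"
  unfolding state_def
proof
  note st = M_fssep_state[OF assms]
  show "sets (Psi \<mu>) = sets borel" by (simp add: Psi_def)
  have "emeasure (Psi \<mu>) (space (Psi \<mu>)) = (\<integral>\<^sup>+ \<eta>. 1 \<partial>Psi \<mu>)" by simp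
  also have "\<dots> = 1"
    using M_fssep_hole_pos[OF assms]
    by (subst nn_integral_Psi[OF st]) (simp_all add: sets_state[OF st] less_top)
  finally show "prob_space (Psi \<mu>)" by (rule prob_spaceI)
qed

text \<open>A first-return map preserves the conditioned measure. The configuration is split by the
  height j of stack 1; the next stack is seen after translating by j + 1, and mass transport
  reassembles the pieces into a single integral of H, which is invariant.\<close>

lemma Psi_TI:
  assumes "\<mu> \<in> M_fssep"
  shows "Psi \<mu> \<in> TI"
proof -
  note st = M_fssep_state[OF assms]
  note [measurable_cong] = sets_state[OF st]
  have eq: "(\<integral>\<^sup>+ n. F (shift (- 1) n) \<partial>Psi \<mu>) = (\<integral>\<^sup>+ n. F n \<partial>Psi \<mu>)"
    if [measurable]: "F \<in> borel_measurable borel" for F :: "(int \<Rightarrow> nat) \<Rightarrow> ennreal"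
  proof -
    define H where "H \<eta> = F (stack_map \<eta>) * indicator hole_at_1 \<eta>" for \<eta>
    have [measurable]: "H \<in> borel_measurable borel" unfolding H_def by measurable
    let ?D = "\<lambda>j. {\<eta>. \<not> \<eta> 1 \<and> (\<forall>i. 1 < i \<and> i \<le> 1 + int j \<longrightarrow> \<eta> i)}"
    have [measurable]: "?D j \<in> sets borel" for j
    proof -
      have "Measurable.pred borel (\<lambda>\<eta>::int \<Rightarrow> bool. \<not> \<eta> 1 \<and>
          (\<forall>i. 1 < i \<and> i \<le> 1 + int j \<longrightarrow> \<eta> i))" by measurable
      then show ?thesis by (simp add: pred_def)
    qed
    have "AE \<eta> in \<mu>. F (shift (- 1) (stack_map \<eta>)) * indicator hole_at_1 \<eta> =
        (\<Sum>j. indicator (?D j) \<eta> * H (shift (- 1) (shift (- int j) \<eta>)))"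
      using M_fssep_AE_subst_map[OF assms]
    proof eventually_elim
      case (elim \<eta>)
      show ?case
      proof (cases "\<eta> 1")
        case False
        with elim obtain n where n: "\<eta> = subst_map n" by auto
        have "indicator (?D j) \<eta> * H (shift (- 1) (shift (- int j) \<eta>)) =
            F (shift (- 1) n) * indicator {j} (n 1)" for j
        proof (cases "j = n 1")
          case True
          then have "shift (- 1) (shift (- int j) \<eta>) = subst_map (shift (- 1) n)"
            by (simp add: n subst_map_shift1 shift_shift)
          moreover have "\<eta> \<in> ?D j" using False n True subst_map_occupied_iff[of j n] by simp
          ultimately show ?thesis
            using True not_subst_map_word_start[of "shift (- 1) n" 1]
            by (simp add: H_def word_start_1)
        next
          case neq: False
          \<comment> \<open>The two ways to miss \<open>n 1\<close>: for smaller j, site j + 2 still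
            lies in word 1, so H vanishes; for larger j, the indicator of \<open>?D j\<close>
            vanishes.\<close>
          have "\<eta> (1 + int (j + 1))" if "j \<le> n 1"
            using that neq subst_map_occupied_iff[of "j + 1" n] by (auto simp: n)
          moreover have "\<eta> \<notin> ?D j" if "\<not> j \<le> n 1"
            using that subst_map_occupied_iff[of j n] by (simp add: n)
          ultimately show ?thesis
            using neq by (cases "j \<le> n 1") (simp_all add: H_def shift_def algebra_simps)
        qed
        moreover have "(\<Sum>j. F (shift (- 1) n) * indicator {j} (n 1)) = F (shift (- 1) n)"
          by (rule suminf_cmult_indicator[where i = "n 1"]) (auto simp: disjoint_family_on_def)
        ultimately show ?thesis using False by (simp add: n)
      qed simp
    qed
    then have "(\<integral>\<^sup>+ \<eta>. F (shift (- 1) (stack_map \<eta>)) * indicator hole_at_1 \<eta> \<partial>\<mu>) =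
        (\<integral>\<^sup>+ \<eta>. (\<Sum>j. indicator (?D j) \<eta> * H (shift (- 1) (shift (- int j) \<eta>))) \<partial>\<mu>)"
      by (rule nn_integral_cong_AE)
    also have "\<dots> = (\<Sum>j. \<integral>\<^sup>+ \<eta>. indicator (?D j) \<eta> * H (shift (- 1) (shift (- int j) \<eta>)) \<partial>\<mu>)"
      by (rule nn_integral_suminf) measurable
    also have "\<dots> = (\<integral>\<^sup>+ \<eta>. H (shift (- 1) \<eta>) \<partial>\<mu>)"
      by (rule M_fssep_mass_transport[OF assms, where F = "\<lambda>\<eta>. H (shift (- 1) \<eta>)"]) measurable
    also have "\<dots> = (\<integral>\<^sup>+ \<eta>. H \<eta> \<partial>\<mu>)"
      by (rule TI_nn_integral_shift[OF M_fssep_TI[OF assms]]) measurable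
    finally show ?thesis by (simp add: nn_integral_Psi[OF st] H_def)
  qed
  show ?thesis
  proof (rule TI_I[OF state_Psi[OF assms]])
    fix B :: "(int \<Rightarrow> nat) set"
    assume [measurable]: "B \<in> sets borel"
    \<comment> \<open>Returns run to the right, so \<open>eq\<close> is about
      \<open>shift (- 1)\<close>; applied to a translated indicator it yields the other
      direction.\<close>
    show "(\<integral>\<^sup>+ n. indicator B (shift 1 n) \<partial>Psi \<mu>) = (\<integral>\<^sup>+ n. indicator B n \<partial>Psi \<mu>)"
      using eq[of "\<lambda>n. indicator B (shift 1 n)"] by (simp add: shift_shift shift_0 del: nn_integral_indicator)
  qed
qed

text \<open>The sum over \<open>j \<le> n 1\<close> is a sum over all j cut off by the event that
  the j sites after the hole are occupied, which is the left side of the mass transport.\<close>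

lemma nn_integral_word_sum_Psi:
  assumes "\<mu> \<in> M_fssep" and [measurable]: "F \<in> borel_measurable borel"
  shows "(\<integral>\<^sup>+ n. word_sum F n \<partial>Psi \<mu>) = (\<integral>\<^sup>+ \<eta>. F \<eta> \<partial>\<mu>) / emeasure \<mu> hole_at_1"
proof -
  note st = M_fssep_state[OF assms(1)]
  note [measurable_cong] = sets_state[OF st]
  let ?D = "\<lambda>j. {\<eta>. \<not> \<eta> 1 \<and> (\<forall>i. 1 < i \<and> i \<le> 1 + int j \<longrightarrow> \<eta> i)}"
  have [measurable]: "?D j \<in> sets borel" for j
  proof -
    have "Measurable.pred borel (\<lambda>\<eta>::int \<Rightarrow> bool. \<not> \<eta> 1 \<and>
        (\<forall>i. 1 < i \<and> i \<le> 1 + int j \<longrightarrow> \<eta> i))" by measurable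
    then show ?thesis by (simp add: pred_def)
  qed
  have "AE \<eta> in \<mu>. word_sum F (stack_map \<eta>) * indicator hole_at_1 \<eta> =
      (\<Sum>j. indicator (?D j) \<eta> * F (shift (- int j) \<eta>))"
    using M_fssep_AE_subst_map[OF assms(1)]
  proof eventually_elim
    case (elim \<eta>)
    show ?case
    proof (cases "\<eta> 1")
      case False
      with elim obtain n where n: "\<eta> = subst_map n" by auto
      have "(\<Sum>j. indicator (?D j) \<eta> * F (shift (- int j) \<eta>)) =
          (\<Sum>j\<le>n 1. indicator (?D j) \<eta> * F (shift (- int j) \<eta>))"
        using subst_map_occupied_iff[of _ n] by (intro suminf_finite) (auto simp: n)
      also have "\<dots> = word_sum F n"
        unfolding word_sum_def
        using subst_map_occupied_iff[of _ n] False by (intro sum.cong) (auto simp: n)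
      finally show ?thesis using False by (simp add: n)
    qed simp
  qed
  then have "(\<integral>\<^sup>+ \<eta>. word_sum F (stack_map \<eta>) * indicator hole_at_1 \<eta> \<partial>\<mu>) =
      (\<integral>\<^sup>+ \<eta>. (\<Sum>j. indicator (?D j) \<eta> * F (shift (- int j) \<eta>)) \<partial>\<mu>)"
    by (rule nn_integral_cong_AE)
  also have "\<dots> = (\<Sum>j. \<integral>\<^sup>+ \<eta>. indicator (?D j) \<eta> * F (shift (- int j) \<eta>) \<partial>\<mu>)"
    by (rule nn_integral_suminf) measurable
  also have "\<dots> = (\<integral>\<^sup>+ \<eta>. F \<eta> \<partial>\<mu>)" by (rule M_fssep_mass_transport) fact+
  finally show ?thesis by (simp add: nn_integral_Psi[OF st])
qed

text \<open>Kac's formula, the case F = 1: the mean return time to a hole is the reciprocal of its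
  probability.\<close>

lemma Z_norm_Psi:
  assumes "\<mu> \<in> M_fssep"
  shows "Z_norm (Psi \<mu>) = inverse (emeasure \<mu> hole_at_1)"
  using nn_integral_word_sum_Psi[OF assms, of "\<lambda>_. 1", OF borel_measurable_const]
  by (simp only: Z_norm_eq[OF state_Psi[OF assms]] word_sum_one
      nn_integral_one_state[OF M_fssep_state[OF assms]] divide_ennreal_def mult_1)

lemma Psi_in_M_ssm:
  assumes "\<mu> \<in> M_fssep"
  shows "Psi \<mu> \<in> M_ssm"
proof -
  have "Z_norm (Psi \<mu>) < \<infinity>"
    using M_fssep_hole_pos[OF assms] by (simp add: Z_norm_Psi[OF assms] less_top[symmetric])
  then show ?thesis
    using Psi_TI[OF assms] Z_norm_finite_iff by (simp add: M_ssm_def)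
qed

lemma Phi_Psi:
  assumes "\<mu> \<in> M_fssep"
  shows "Phi (Psi \<mu>) = \<mu>"
proof (rule state_eqI)
  note st = state_Psi[OF assms]
  show "sets (Phi (Psi \<mu>)) = sets borel" by (rule sets_Phi[OF st])
  show "sets \<mu> = sets borel" by (rule sets_state[OF M_fssep_state[OF assms]])
  fix B :: "(int \<Rightarrow> bool) set"
  assume [measurable]: "B \<in> sets borel"
  have "(\<integral>\<^sup>+ \<eta>. indicator B \<eta> \<partial>Phi (Psi \<mu>)) =
      inverse (Z_norm (Psi \<mu>)) * ((\<integral>\<^sup>+ \<eta>. indicator B \<eta> \<partial>\<mu>) / emeasure \<mu> hole_at_1)"
    by (subst nn_integral_Phi[OF st]) (simp_all only: nn_integral_word_sum_Psi[OF assms] borel_measurable_indicator[OF \<open>B \<in> sets borel\<close>])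
  also have "\<dots> = (\<integral>\<^sup>+ \<eta>. indicator B \<eta> \<partial>\<mu>) * (inverse (Z_norm (Psi \<mu>)) * Z_norm (Psi \<mu>))"
    by (simp add: Z_norm_Psi[OF assms] divide_ennreal_def ac_simps)
  also have "\<dots> = (\<integral>\<^sup>+ \<eta>. indicator B \<eta> \<partial>\<mu>)"
    by (simp add: M_ssm_Z_norm[OF Psi_in_M_ssm[OF assms]])
  finally show "(\<integral>\<^sup>+ \<eta>. indicator B \<eta> \<partial>Phi (Psi \<mu>)) = (\<integral>\<^sup>+ \<eta>. indicator B \<eta> \<partial>\<mu>)" .
qed

section \<open>Stationarity\<close>

text \<open>The law at time 1 as an image of the joint law of start and coins. It turns stationarity
  into a fixed-point equation and lets start and coins be translated together.\<close>

definition evolve :: "((int \<Rightarrow> bool) \<Rightarrow> 'c::topological_space \<Rightarrow> 'c) \<Rightarrow> 'c measure \<Rightarrow> 'c measure"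
  where "evolve s \<nu> = distr (\<nu> \<Otimes>\<^sub>M coins) borel (\<lambda>(x, \<omega>). s \<omega> x)"

lemma prob_space_coins: "prob_space coins"
  unfolding coins_def by (intro prob_space_PiM measure_pmf.prob_space_axioms)

interpretation coins: prob_space coins by (rule prob_space_coins)

lemmas [measurable] = coin_measurable

lemma measurable_into_coins:
  assumes "\<And>i. (\<lambda>x. f x i) \<in> measurable M (count_space UNIV)"
  shows "f \<in> measurable M coins"
  unfolding coins_def
proof (rule measurable_PiM_single')
  show "(\<lambda>x. f x i) \<in> measurable M (measure_pmf (bernoulli_pmf (1 / 2)))" for i
    using assms[of i] by (simp cong: measurable_cong_sets)
qed simp

lemma measurable_coins_reindex: "(\<lambda>\<omega> i. \<omega> (g i)) \<in> measurable coins coins"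
  by (rule measurable_into_coins) (rule coin_measurable)

lemma measurable_shift_coins [measurable]: "shift k \<in> measurable coins coins"
  unfolding shift_def by (rule measurable_coins_reindex)

text \<open>Independent fair coins read at distinct places are again independent fair coins. It is
  used both for translations and for reading the coins at the holes only.\<close>

lemma coins_reindex:
  assumes "inj g"
  shows "distr coins coins (\<lambda>\<omega> i. \<omega> (g i)) = coins"
  using distr_PiM_reindex[where K = UNIV and I = UNIV and f = g
      and M = "\<lambda>_. measure_pmf (bernoulli_pmf (1 / 2))"] assms
  by (simp add: coins_def measure_pmf.prob_space_axioms restrict_def)

lemma nn_integral_coins_reindex:
  assumes "inj g" and [measurable]: "G \<in> borel_measurable coins"
  shows "(\<integral>\<^sup>+ \<omega>. G (\<lambda>i. \<omega> (g i)) \<partial>coins) = (\<integral>\<^sup>+ \<omega>. G \<omega> \<partial>coins)"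
proof -
  have "(\<integral>\<^sup>+ \<omega>. G \<omega> \<partial>coins) = (\<integral>\<^sup>+ \<omega>. G \<omega> \<partial>distr coins coins (\<lambda>\<omega> i. \<omega> (g i)))"
    by (simp only: coins_reindex[OF assms(1)])
  also have "\<dots> = (\<integral>\<^sup>+ \<omega>. G (\<lambda>i. \<omega> (g i)) \<partial>coins)"
    by (rule nn_integral_distr) (fact measurable_coins_reindex, measurable)
  finally show ?thesis ..
qed

lemma measurable_ssm_flux [measurable]:
  "(\<lambda>x. ssm_flux (snd x) (fst x) k) \<in> measurable (borel \<Otimes>\<^sub>M coins) (count_space UNIV)"
proof -
  have "(\<lambda>x. (fst x :: int \<Rightarrow> nat) k) \<in> measurable (borel \<Otimes>\<^sub>M coins) (count_space UNIV)" for k :: int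
    by (rule measurable_compose[OF measurable_fst measurable_coord])
  then have [measurable]: "Measurable.pred (borel \<Otimes>\<^sub>M coins) (\<lambda>x. tall (fst x k))" for k :: int
    by (rule measurable_compose) simp
  show ?thesis unfolding ssm_flux_def by measurable
qed

lemma measurable_ssm_step [measurable]:
  "(\<lambda>(n, \<omega>). ssm_step \<omega> n) \<in> measurable (borel \<Otimes>\<^sub>M coins) borel"
proof (rule measurable_config)
  fix k
  have "(\<lambda>x. ssm_flux (snd x) (fst x) (k - 1) - ssm_flux (snd x) (fst x) k) \<in>
      measurable (borel \<Otimes>\<^sub>M coins) (count_space UNIV)"
    by (rule measurable_countable_op2[where h = minus]) measurable
  then have "(\<lambda>x. nat (int (fst x k) +
      (ssm_flux (snd x) (fst x) (k - 1) - ssm_flux (snd x) (fst x) k))) \<in>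
      measurable (borel \<Otimes>\<^sub>M coins) (count_space UNIV)"
    by (intro measurable_countable_op2[where h = "\<lambda>a b. nat (int a + b)"]) simp_all
  then show "(\<lambda>x. (case x of (n, \<omega>) \<Rightarrow> ssm_step \<omega> n) k) \<in>
      measurable (borel \<Otimes>\<^sub>M coins) (count_space UNIV)"
    by (simp add: ssm_step_def split_beta' add_diff_eq)
qed

lemma measurable_fssep_step [measurable]:
  "(\<lambda>(\<eta>, \<omega>). fssep_step \<omega> \<eta>) \<in> measurable (borel \<Otimes>\<^sub>M coins) borel"
proof (rule measurable_config)
  fix k
  show "(\<lambda>x. (case x of (\<eta>, \<omega>) \<Rightarrow> fssep_step \<omega> \<eta>) k) \<in>
      measurable (borel \<Otimes>\<^sub>M coins) (count_space UNIV)"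
    unfolding fssep_step_def right_succeeds_def left_succeeds_def jumps_right_def jumps_left_def
      split_beta'
    by measurable
qed

lemma nn_integral_evolve:
  assumes "state \<nu>"
    and [measurable]: "(\<lambda>(x, \<omega>). s \<omega> x) \<in> measurable (borel \<Otimes>\<^sub>M coins) borel"
      "F \<in> borel_measurable borel"
  shows "(\<integral>\<^sup>+ x. F x \<partial>evolve s \<nu>) = (\<integral>\<^sup>+ x. \<integral>\<^sup>+ \<omega>. F (s \<omega> x) \<partial>coins \<partial>\<nu>)"
proof -
  note [measurable_cong] = sets_state[OF assms(1)]
  have "(\<integral>\<^sup>+ x. F x \<partial>evolve s \<nu>) =
      (\<integral>\<^sup>+ x. F ((\<lambda>(x, \<omega>). s \<omega> x) x) \<partial>(\<nu> \<Otimes>\<^sub>M coins))"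
    unfolding evolve_def by (rule nn_integral_distr) measurable
  also have "\<dots> = (\<integral>\<^sup>+ x. \<integral>\<^sup>+ \<omega>. F ((\<lambda>(x, \<omega>). s \<omega> x) (x, \<omega>)) \<partial>coins \<partial>\<nu>)"
    by (rule coins.nn_integral_fst[symmetric]) measurable
  finally show ?thesis by simp
qed

lemma state_evolve:
  assumes "state \<nu>"
    and [measurable]: "(\<lambda>(x, \<omega>). s \<omega> x) \<in> measurable (borel \<Otimes>\<^sub>M coins) borel"
  shows "state (evolve s \<nu>)"
  unfolding state_def
proof
  note [measurable_cong] = sets_state[OF assms(1)]
  interpret prob_space \<nu> by (rule prob_space_state[OF assms(1)])
  interpret pair_prob_space \<nu> coins ..
  show "sets (evolve s \<nu>) = sets borel" by (simp add: evolve_def)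
  show "prob_space (evolve s \<nu>)"
    unfolding evolve_def by (rule prob_space_distr) measurable
qed

lemma stationary_iff_evolve:
  assumes "state \<nu>"
    and [measurable]: "(\<lambda>(x, \<omega>). s \<omega> x) \<in> measurable (borel \<Otimes>\<^sub>M coins) borel"
    and K: "\<And>x. K x = distr coins borel (\<lambda>\<omega>. s \<omega> x)"
  shows "stationary K \<nu> \<longleftrightarrow> evolve s \<nu> = \<nu>"
proof -
  note se = sets_state[OF state_evolve[OF assms(1,2)]]
  have "(\<integral>\<^sup>+ x. emeasure (K x) B \<partial>\<nu>) = emeasure (evolve s \<nu>) B" if [measurable]: "B \<in> sets borel" for B
  proof -
    have "emeasure (K x) B = (\<integral>\<^sup>+ \<omega>. indicator B (s \<omega> x) \<partial>coins)" for x
    proof -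
      have [measurable]: "(\<lambda>\<omega>. s \<omega> x) \<in> measurable coins borel"
        using measurable_compose[OF measurable_Pair1' assms(2), of x] by simp
      have "emeasure (K x) B = (\<integral>\<^sup>+ y. indicator B y \<partial>distr coins borel (\<lambda>\<omega>. s \<omega> x))"
        by (simp add: K)
      also have "\<dots> = (\<integral>\<^sup>+ \<omega>. indicator B (s \<omega> x) \<partial>coins)" by (rule nn_integral_distr) measurable
      finally show ?thesis .
    qed
    then have "(\<integral>\<^sup>+ x. emeasure (K x) B \<partial>\<nu>) = (\<integral>\<^sup>+ x. indicator B x \<partial>evolve s \<nu>)"
      by (simp add: nn_integral_evolve[OF assms(1,2)] del: nn_integral_indicator)
    then show ?thesis using that by (simp add: se)
  qed
  then have "stationary K \<nu> \<longleftrightarrow> (\<forall>B\<in>sets borel. emeasure (evolve s \<nu>) B = emeasure \<nu> B)"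
    by (simp add: stationary_def)
  also have "\<dots> \<longleftrightarrow> evolve s \<nu> = \<nu>"
    using se sets_state[OF assms(1)] by (auto intro!: measure_eqI)
  finally show ?thesis .
qed

text \<open>Fubini: the coins are translation invariant for each fixed configuration, and then so is
  the configuration. Both dynamics commute only with such joint translations.\<close>

lemma TI_coins_shift:
  fixes \<nu> :: "(int \<Rightarrow> 'a::{countable, t2_space, second_countable_topology}) measure"
  assumes "\<nu> \<in> TI" and [measurable]: "G \<in> borel_measurable (borel \<Otimes>\<^sub>M coins)"
  shows "(\<integral>\<^sup>+ x. G (shift k (fst x), shift k (snd x)) \<partial>(\<nu> \<Otimes>\<^sub>M coins)) =
    (\<integral>\<^sup>+ x. G x \<partial>(\<nu> \<Otimes>\<^sub>M coins))"
proof -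
  note [measurable_cong] = sets_state[OF TI_state[OF assms(1)]]
  have [measurable]: "(\<lambda>\<omega>. G (n, \<omega>)) \<in> borel_measurable coins" for n
    by (rule measurable_compose[OF measurable_Pair1' assms(2)]) simp
  have "(\<integral>\<^sup>+ x. G (shift k (fst x), shift k (snd x)) \<partial>(\<nu> \<Otimes>\<^sub>M coins)) =
      (\<integral>\<^sup>+ n. \<integral>\<^sup>+ \<omega>. G (shift k n, shift k \<omega>) \<partial>coins \<partial>\<nu>)"
    by (subst coins.nn_integral_fst[symmetric]) simp_all
  also have "\<dots> = (\<integral>\<^sup>+ n. \<integral>\<^sup>+ \<omega>. G (shift k n, \<omega>) \<partial>coins \<partial>\<nu>)"
  proof (rule nn_integral_cong)
    fix n
    have "(\<integral>\<^sup>+ \<omega>. G (shift k n, \<lambda>i. \<omega> (i - k)) \<partial>coins) = (\<integral>\<^sup>+ \<omega>. G (shift k n, \<omega>) \<partial>coins)"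
      by (rule nn_integral_coins_reindex[where G = "\<lambda>\<omega>. G (shift k n, \<omega>)"])
        (simp add: inj_def, measurable)
    then show "(\<integral>\<^sup>+ \<omega>. G (shift k n, shift k \<omega>) \<partial>coins) = (\<integral>\<^sup>+ \<omega>. G (shift k n, \<omega>) \<partial>coins)"
      unfolding shift_def[of k "_ :: int \<Rightarrow> bool"] .
  qed
  also have "\<dots> = (\<integral>\<^sup>+ n. \<integral>\<^sup>+ \<omega>. G (n, \<omega>) \<partial>coins \<partial>\<nu>)"
    by (rule TI_nn_integral_shift[OF assms(1), where F = "\<lambda>n. \<integral>\<^sup>+ \<omega>. G (n, \<omega>) \<partial>coins"]) measurable
  also have "\<dots> = (\<integral>\<^sup>+ x. G x \<partial>(\<nu> \<Otimes>\<^sub>M coins))"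
    by (rule coins.nn_integral_fst) measurable
  finally show ?thesis .
qed

lemma evolve_ssm_TI:
  assumes "\<nu> \<in> TI"
  shows "evolve ssm_step \<nu> \<in> TI"
proof (rule TI_I)
  note st = TI_state[OF assms]
  note [measurable_cong] = sets_state[OF st]
  show "state (evolve ssm_step \<nu>)" by (rule state_evolve[OF st]) measurable
  fix B :: "(int \<Rightarrow> nat) set"
  assume [measurable]: "B \<in> sets borel"
  have int: "(\<integral>\<^sup>+ n. F n \<partial>evolve ssm_step \<nu>) =
      (\<integral>\<^sup>+ x. F (ssm_step (snd x) (fst x)) \<partial>(\<nu> \<Otimes>\<^sub>M coins))"
    if [measurable]: "F \<in> borel_measurable borel" for F
    unfolding evolve_def by (subst nn_integral_distr) (simp_all add: split_beta')
  have "(\<integral>\<^sup>+ n. indicator B (shift 1 n) \<partial>evolve ssm_step \<nu>) =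
      (\<integral>\<^sup>+ x. indicator B (shift 1 (ssm_step (snd x) (fst x))) \<partial>(\<nu> \<Otimes>\<^sub>M coins))"
    by (rule int) measurable
  also have "\<dots> = (\<integral>\<^sup>+ x. (\<lambda>x. indicator B (ssm_step (snd x) (fst x)))
      (shift 1 (fst x), shift 1 (snd x)) \<partial>(\<nu> \<Otimes>\<^sub>M coins))"
    by (simp add: ssm_step_shift shift_shift shift_0)
  also have "\<dots> = (\<integral>\<^sup>+ x. indicator B (ssm_step (snd x) (fst x)) \<partial>(\<nu> \<Otimes>\<^sub>M coins))"
    by (rule TI_coins_shift[OF assms]) (use measurable_ssm_step in \<open>simp add: split_beta'\<close>)
  also have "\<dots> = (\<integral>\<^sup>+ n. indicator B n \<partial>evolve ssm_step \<nu>)"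
    by (rule int[symmetric]) measurable
  finally show "(\<integral>\<^sup>+ n. indicator B (shift 1 n) \<partial>evolve ssm_step \<nu>) =
    (\<integral>\<^sup>+ n. indicator B n \<partial>evolve ssm_step \<nu>)" .
qed

text \<open>Aligns the left ends of two windows with the same right end. For f = 1 the translated
  window lacks site 0; for f = -1 it has site -1 in excess.\<close>

lemma sum_shift_left:
  fixes g :: "int \<Rightarrow> ennreal"
  assumes "f = 0 \<or> f = 1 \<or> f = - 1"
  shows "(\<Sum>j\<le>m. g (int j + f)) + (if f = 1 then g 0 else 0) =
    (\<Sum>j\<in>{0..int m + f}. g j) + (if f = - 1 then g (- 1) else 0)"
proof -
  have "(\<Sum>j\<le>m. g (int j + f)) = (\<Sum>j\<in>{f..int m + f}. g j)"
    by (rule sum.reindex_bij_witness[where i = "\<lambda>j. nat (j - f)" and j = "\<lambda>j. int j + f"]) auto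
  moreover have "{-1..int m - 1} = insert (- 1) {0..int m - 1}" "{0..int m + 1} = insert 0 {1..int m + 1}"
    by auto
  ultimately show ?thesis using assms by (auto simp: add.commute)
qed

text \<open>The same comparison at the right end, from \<open>int m + f\<close> to
  \<open>int m\<close>; again without subtraction.\<close>

lemma sum_shift_right:
  fixes g :: "int \<Rightarrow> ennreal"
  assumes "f = 0 \<or> f = 1 \<or> f = - 1"
  shows "(\<Sum>j\<in>{0..int m + f}. g j) + (if f = - 1 then g (int m) else 0) =
    (\<Sum>j\<le>m. g (int j)) + (if f = 1 then g (int m + 1) else 0)"
proof -
  have "(\<Sum>j\<le>m. g (int j)) = (\<Sum>j\<in>{0..int m}. g j)"
    by (rule sum.reindex_bij_witness[where i = nat and j = int]) auto
  moreover have "{0..int m} = insert (int m) {0..int m - 1}"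
    "{0..int m + 1} = insert (int m + 1) {0..int m}"
    by auto
  ultimately show ?thesis using assms by (auto simp: add.commute)
qed

text \<open>The stack at site 1 of the new configuration and the shifted old word cover the same sites up to
  one site at each end; the discrepancies at the two ends are translates of each other.\<close>

lemma nn_integral_word_sum_evolve:
  assumes "\<nu> \<in> TI" and [measurable]: "F \<in> borel_measurable borel" and F: "\<And>\<eta>. F \<eta> \<le> 1"
  shows "(\<integral>\<^sup>+ n. word_sum F n \<partial>evolve ssm_step \<nu>) =
    (\<integral>\<^sup>+ n. word_sum (\<lambda>\<eta>. \<integral>\<^sup>+ \<omega>. F (fssep_step \<omega> \<eta>) \<partial>coins) n \<partial>\<nu>)"
proof -
  note st = TI_state[OF assms(1)]
  note [measurable_cong] = sets_state[OF st]
  let ?P = "\<nu> \<Otimes>\<^sub>M coins"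
  interpret prob_space \<nu> by (rule prob_space_state[OF st])
  interpret P: pair_prob_space \<nu> coins ..
  define g where "g x j = F (shift (- j) (subst_map (ssm_step (snd x) (fst x))))" for x j
  define f where "f x = ssm_flux (snd x) (fst x)" for x
  \<comment> \<open>L is the sum along the old word 1, which after the step lies at offset
    \<open>f x 0\<close> in the coordinates of the new stacks; W is the sum along the new word
    1.\<close>
  define L where "L x = (\<Sum>j\<le>fst x 1. g x (int j + f x 0))" for x
  define W where "W x = word_sum F (ssm_step (snd x) (fst x))" for x
  \<comment> \<open>H and H' correct the left end for flux 1 and -1. Bond (1, 2) of x is bond (0, 1)
    of \<open>T x\<close>, so the same functions at \<open>T x\<close> correct the right
    end.\<close>
  define H where "H x = (if f x 0 = 1 then g x 0 else 0)" for x
  define H' where "H' x = (if f x 0 = - 1 then g x (- 1) else 0)" for x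
  define T :: "(int \<Rightarrow> nat) \<times> (int \<Rightarrow> bool) \<Rightarrow> _" where "T x = (shift (- 1) (fst x), shift (- 1) (snd x))" for x
  have step: "(\<lambda>x. ssm_step (snd x) (fst x)) \<in> measurable (borel \<Otimes>\<^sub>M coins) borel"
    using measurable_ssm_step by (simp add: split_beta')
  have [measurable]: "(\<lambda>x. f x k) \<in> measurable (borel \<Otimes>\<^sub>M coins) (count_space UNIV)" for k
    unfolding f_def by measurable
  have [measurable]: "(\<lambda>x. g x j) \<in> borel_measurable (borel \<Otimes>\<^sub>M coins)" for j
    unfolding g_def
    by (rule measurable_compose[OF step, of "\<lambda>n. F (shift (- j) (subst_map n))"]) measurable
  have "(\<lambda>x. g x (int j + f x 0)) \<in> borel_measurable (borel \<Otimes>\<^sub>M coins)" for j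
    by (rule measurable_compose_countable[where f = "\<lambda>i x. g x (int j + i)" and g = "\<lambda>x. f x 0"]) measurable
  then have Lm: "(\<lambda>x. \<Sum>j\<le>m. g x (int j + f x 0)) \<in> borel_measurable (borel \<Otimes>\<^sub>M coins)" for m :: nat
    by (rule borel_measurable_sum)
  have [measurable]: "L \<in> borel_measurable (borel \<Otimes>\<^sub>M coins)"
    unfolding L_def
    by (rule measurable_compose_countable[where f = "\<lambda>m x. \<Sum>j\<le>m. g x (int j + f x 0)" and g = "\<lambda>x. fst x 1", OF Lm])
      (rule measurable_compose[OF measurable_fst measurable_coord])
  have [measurable]: "W \<in> borel_measurable (borel \<Otimes>\<^sub>M coins)"
    unfolding W_def by (rule measurable_compose[OF step]) measurable
  have [measurable]: "H \<in> borel_measurable (borel \<Otimes>\<^sub>M coins)"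
    "H' \<in> borel_measurable (borel \<Otimes>\<^sub>M coins)"
    unfolding H_def H'_def by measurable
  have T [measurable]: "T \<in> measurable (borel \<Otimes>\<^sub>M coins) (borel \<Otimes>\<^sub>M coins)"
    unfolding T_def by measurable
  have eq: "L x + (H x + H' (T x)) = W x + (H (T x) + H' x)" for x
  proof -
    obtain n \<omega> where x: "x = (n, \<omega>)" by (cases x)
    let ?n' = "ssm_step \<omega> n"
    have fT: "f (T x) 0 = f x 1"
      by (simp add: f_def T_def ssm_flux_shift shift_shift shift_0)
    have "ssm_step (shift (- 1) \<omega>) (shift (- 1) n) = shift (- 1) ?n'"
      by (simp add: ssm_step_shift shift_shift shift_0)
    then have sT: "subst_map (ssm_step (shift (- 1) \<omega>) (shift (- 1) n)) =
        shift (- int (?n' 1 + 1)) (subst_map ?n')"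
      by (simp only: subst_map_shift1)
    have gT: "g (T x) 0 = g x (int (?n' 1) + 1)" "g (T x) (- 1) = g x (int (?n' 1))"
      by (simp_all add: g_def T_def x sT shift_shift algebra_simps)
    define S where "S = (\<Sum>j\<in>{0..int (n 1) + f x 0}. g x j)"
    \<comment> \<open>Particle conservation at stack 1. S runs from the new left end to the old
      right end, so it links L and W one end at a time.\<close>
    have "int (n 1) + f x 0 = int (?n' 1) + f x 1"
      using ssm_step_no_truncation[of \<omega> n 1] by (simp add: x f_def)
    then have S: "S = (\<Sum>j\<in>{0..int (?n' 1) + f x 1}. g x j)" by (simp only: S_def)
    have f: "f x k = 0 \<or> f x k = 1 \<or> f x k = - 1" for k
      unfolding f_def by (rule ssm_flux_cases)
    have "L x + H x = S + H' x"
      using sum_shift_left[OF f[of 0], of "g x" "n 1"] by (simp only: L_def H_def H'_def S_def x fst_conv)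
    moreover have "S + H' (T x) = W x + H (T x)"
    proof -
      have "W x = (\<Sum>j\<le>?n' 1. g x (int j))" by (simp add: W_def word_sum_def g_def x)
      then show ?thesis
        using sum_shift_right[OF f[of 1], of "g x" "?n' 1"] by (simp only: S H_def H'_def fT gT)
    qed
    ultimately show ?thesis by (metis add.assoc add.commute)
  qed
  \<comment> \<open>Boundary terms contain at most one value of F, so their integrals are finite and
    can be cancelled even if those of L and W are infinite.\<close>
  have le1: "(\<integral>\<^sup>+ x. K x \<partial>?P) \<noteq> \<infinity>" if "\<And>x. K x \<le> 1" for K :: "_ \<Rightarrow> ennreal"
  proof -
    have "(\<integral>\<^sup>+ x. K x \<partial>?P) \<le> (\<integral>\<^sup>+ x. 1 \<partial>?P)" by (intro nn_integral_mono that)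
    also have "\<dots> = 1" by (simp add: P.emeasure_space_1)
    finally show ?thesis by (auto simp: top_unique)
  qed
  have fin: "(\<integral>\<^sup>+ x. H x \<partial>?P) \<noteq> \<infinity>" "(\<integral>\<^sup>+ x. H' x \<partial>?P) \<noteq> \<infinity>"
    by (rule le1, simp add: H_def H'_def g_def F)+
  have inv: "(\<integral>\<^sup>+ x. H (T x) \<partial>?P) = (\<integral>\<^sup>+ x. H x \<partial>?P)" "(\<integral>\<^sup>+ x. H' (T x) \<partial>?P) = (\<integral>\<^sup>+ x. H' x \<partial>?P)"
    unfolding T_def by (rule TI_coins_shift[OF assms(1)], measurable)+
  have "(\<integral>\<^sup>+ x. L x + (H x + H' (T x)) \<partial>?P) = (\<integral>\<^sup>+ x. L x \<partial>?P) + ((\<integral>\<^sup>+ x. H x \<partial>?P) + (\<integral>\<^sup>+ x. H' x \<partial>?P))"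
    by (simp add: nn_integral_add inv)
  moreover have "(\<integral>\<^sup>+ x. W x + (H (T x) + H' x) \<partial>?P) = (\<integral>\<^sup>+ x. W x \<partial>?P) + ((\<integral>\<^sup>+ x. H x \<partial>?P) + (\<integral>\<^sup>+ x. H' x \<partial>?P))"
    by (simp add: nn_integral_add inv)
  ultimately have "(\<integral>\<^sup>+ x. L x \<partial>?P) + ((\<integral>\<^sup>+ x. H x \<partial>?P) + (\<integral>\<^sup>+ x. H' x \<partial>?P)) =
      (\<integral>\<^sup>+ x. W x \<partial>?P) + ((\<integral>\<^sup>+ x. H x \<partial>?P) + (\<integral>\<^sup>+ x. H' x \<partial>?P))"
    by (simp only: eq)
  then have LW: "(\<integral>\<^sup>+ x. L x \<partial>?P) = (\<integral>\<^sup>+ x. W x \<partial>?P)"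
    using fin ennreal_add_left_cancel[of "(\<integral>\<^sup>+ x. H x \<partial>?P) + (\<integral>\<^sup>+ x. H' x \<partial>?P)"]
    by (simp add: add.commute)
  have "(\<integral>\<^sup>+ n. word_sum F n \<partial>evolve ssm_step \<nu>) = (\<integral>\<^sup>+ x. W x \<partial>?P)"
    unfolding evolve_def W_def by (subst nn_integral_distr) (simp_all add: split_beta')
  also have "\<dots> = (\<integral>\<^sup>+ n. \<integral>\<^sup>+ \<omega>. L (n, \<omega>) \<partial>coins \<partial>\<nu>)"
    unfolding LW[symmetric] by (rule coins.nn_integral_fst[symmetric]) measurable
  also have "\<dots> = (\<integral>\<^sup>+ n. word_sum (\<lambda>\<eta>. \<integral>\<^sup>+ \<omega>. F (fssep_step \<omega> \<eta>) \<partial>coins) n \<partial>\<nu>)"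
  proof (rule nn_integral_cong)
    fix n
    have meas [measurable]: "(\<lambda>\<omega>. g (n, \<omega>) (int j + f (n, \<omega>) 0)) \<in> borel_measurable coins" for j
    proof -
      have "(\<lambda>x. g x (int j + f x 0)) \<in> borel_measurable (borel \<Otimes>\<^sub>M coins)"
        by (rule measurable_compose_countable[where f = "\<lambda>i x. g x (int j + i)" and g = "\<lambda>x. f x 0"]) measurable
      from measurable_compose[OF measurable_Pair1' this, of n] show ?thesis by simp
    qed
    have "(\<integral>\<^sup>+ \<omega>. L (n, \<omega>) \<partial>coins) = (\<Sum>j\<le>n 1. \<integral>\<^sup>+ \<omega>. g (n, \<omega>) (int j + f (n, \<omega>) 0) \<partial>coins)"
      unfolding L_def fst_conv by (rule nn_integral_sum) (rule meas)
    also have "\<dots> = (\<Sum>j\<le>n 1. \<integral>\<^sup>+ \<omega>. F (fssep_step \<omega> (shift (- int j) (subst_map n))) \<partial>coins)"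
    proof (rule sum.cong[OF refl])
      fix j
      \<comment> \<open>The site at which the coin of bond (k, k + 1) is read: the hole of stack k +
        1, moved by the translation by -j.\<close>
      define r where "r k = word_start n (k + 1) - int j" for k
      have "inj r" by (auto simp: r_def inj_def)
      have "fssep_step \<omega> (shift (- int j) (subst_map n)) =
          shift (- (int j + f (n, \<lambda>k. \<omega> (r k)) 0)) (subst_map (ssm_step (\<lambda>k. \<omega> (r k)) n))" for \<omega>
      proof -
        have "fssep_step (shift (int j) \<omega>) (subst_map n) =
            shift (- ssm_flux (\<lambda>k. \<omega> (r k)) n 0) (subst_map (ssm_step (\<lambda>k. \<omega> (r k)) n))"
          by (rule fssep_step_subst_map) (simp add: r_def shift_def)
        then show ?thesis by (simp add: fssep_step_shift shift_shift f_def)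
      qed
      then have "(\<integral>\<^sup>+ \<omega>. F (fssep_step \<omega> (shift (- int j) (subst_map n))) \<partial>coins) =
          (\<integral>\<^sup>+ \<omega>. (\<lambda>\<omega>. g (n, \<omega>) (int j + f (n, \<omega>) 0)) (\<lambda>k. \<omega> (r k)) \<partial>coins)"
        by (simp add: g_def)
      also have "\<dots> = (\<integral>\<^sup>+ \<omega>. g (n, \<omega>) (int j + f (n, \<omega>) 0) \<partial>coins)"
        by (rule nn_integral_coins_reindex[OF \<open>inj r\<close> meas])
      finally show "(\<integral>\<^sup>+ \<omega>. g (n, \<omega>) (int j + f (n, \<omega>) 0) \<partial>coins) =
        (\<integral>\<^sup>+ \<omega>. F (fssep_step \<omega> (shift (- int j) (subst_map n))) \<partial>coins)" ..
    qed
    finally show "(\<integral>\<^sup>+ \<omega>. L (n, \<omega>) \<partial>coins) = word_sum (\<lambda>\<eta>. \<integral>\<^sup>+ \<omega>. F (fssep_step \<omega> \<eta>) \<partial>coins) n"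
      by (simp add: word_sum_def)
  qed
  finally show ?thesis .
qed

text \<open>Conservation of the mean stack height, from F = 1. It keeps the evolution inside
  \<open>M_ssm\<close> and gives both sides of \<open>Phi_evolve\<close> the same
  normalisation.\<close>

lemma Z_norm_evolve:
  assumes "\<nu> \<in> TI"
  shows "Z_norm (evolve ssm_step \<nu>) = Z_norm \<nu>"
proof -
  note st = TI_state[OF assms]
  have "state (evolve ssm_step \<nu>)" by (rule TI_state[OF evolve_ssm_TI[OF assms]])
  with nn_integral_word_sum_evolve[OF assms, of "\<lambda>_. 1"] show ?thesis
    by (simp add: Z_norm_eq st word_sum_one coins.emeasure_space_1 del: of_nat_add)
qed

lemma evolve_ssm_M_ssm: "\<nu> \<in> M_ssm \<Longrightarrow> evolve ssm_step \<nu> \<in> M_ssm"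
  using Z_norm_finite_iff[of \<nu>] Z_norm_finite_iff[of "evolve ssm_step \<nu>"]
  by (simp add: M_ssm_def evolve_ssm_TI Z_norm_evolve)

lemma Phi_evolve:
  assumes "\<nu> \<in> M_ssm"
  shows "Phi (evolve ssm_step \<nu>) = evolve fssep_step (Phi \<nu>)"
proof (rule state_eqI)
  note st = M_ssm_state[OF assms] and st' = M_ssm_state[OF evolve_ssm_M_ssm[OF assms]]
  note sP = state_Phi[OF assms]
  show "sets (Phi (evolve ssm_step \<nu>)) = sets borel" by (rule sets_Phi[OF st'])
  show "sets (evolve fssep_step (Phi \<nu>)) = sets borel" by (simp add: evolve_def)
  fix B :: "(int \<Rightarrow> bool) set"
  assume [measurable]: "B \<in> sets borel"
  have step [measurable]: "(\<lambda>x. fssep_step (snd x) (fst x)) \<in> measurable (borel \<Otimes>\<^sub>M coins) borel"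
    using measurable_fssep_step by (simp add: split_beta')
  have [measurable]: "(\<lambda>\<eta>. \<integral>\<^sup>+ \<omega>. indicator B (fssep_step \<omega> \<eta>) \<partial>coins :: ennreal) \<in> borel_measurable borel"
    by (rule coins.borel_measurable_nn_integral) (simp add: split_beta')
  have "(\<integral>\<^sup>+ x. indicator B x \<partial>evolve fssep_step (Phi \<nu>)) =
      (\<integral>\<^sup>+ \<eta>. \<integral>\<^sup>+ \<omega>. indicator B (fssep_step \<omega> \<eta>) \<partial>coins \<partial>Phi \<nu>)"
    by (rule nn_integral_evolve[OF sP]) measurable
  also have "\<dots> = inverse (Z_norm \<nu>) *
      (\<integral>\<^sup>+ n. word_sum (\<lambda>\<eta>. \<integral>\<^sup>+ \<omega>. indicator B (fssep_step \<omega> \<eta>) \<partial>coins) n \<partial>\<nu>)"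
    by (rule nn_integral_Phi[OF st]) measurable
  also have "(\<integral>\<^sup>+ n. word_sum (\<lambda>\<eta>. \<integral>\<^sup>+ \<omega>. indicator B (fssep_step \<omega> \<eta>) \<partial>coins) n \<partial>\<nu>) =
      (\<integral>\<^sup>+ n. word_sum (indicator B) n \<partial>evolve ssm_step \<nu>)"
    by (rule nn_integral_word_sum_evolve[OF M_ssm_TI[OF assms], symmetric])
      (measurable, simp add: indicator_def)
  also have "inverse (Z_norm \<nu>) * \<dots> = (\<integral>\<^sup>+ x. indicator B x \<partial>Phi (evolve ssm_step \<nu>))"
    by (subst nn_integral_Phi[OF st']) (simp_all add: Z_norm_evolve M_ssm_TI[OF assms])
  finally show "(\<integral>\<^sup>+ x. indicator B x \<partial>Phi (evolve ssm_step \<nu>)) =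
    (\<integral>\<^sup>+ x. indicator B x \<partial>evolve fssep_step (Phi \<nu>))" ..
qed

lemma stationary_Phi_iff:
  assumes "\<nu> \<in> M_ssm"
  shows "stationary fssep_kernel (Phi \<nu>) \<longleftrightarrow> stationary ssm_kernel \<nu>"
proof -
  have "stationary fssep_kernel (Phi \<nu>) \<longleftrightarrow> evolve fssep_step (Phi \<nu>) = Phi \<nu>"
    by (rule stationary_iff_evolve[OF state_Phi[OF assms]]) (measurable, simp add: fssep_kernel_def)
  also have "\<dots> \<longleftrightarrow> Phi (evolve ssm_step \<nu>) = Phi \<nu>" by (simp add: Phi_evolve[OF assms])
  also have "\<dots> \<longleftrightarrow> evolve ssm_step \<nu> = \<nu>"
    by (metis Psi_Phi assms evolve_ssm_M_ssm)
  also have "\<dots> \<longleftrightarrow> stationary ssm_kernel \<nu>"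
    by (rule stationary_iff_evolve[OF M_ssm_state[OF assms], symmetric])
      (measurable, simp add: ssm_kernel_def)
  finally show ?thesis .
qed

section \<open>Densities\<close>

lemma tendsto_mult_Suc_ratio:
  fixes a :: "nat \<Rightarrow> real"
  assumes "(\<lambda>k. a k / real k) \<longlonglongrightarrow> L"
  shows "(\<lambda>k. a k / real (Suc k)) \<longlonglongrightarrow> L"
proof -
  have "(\<lambda>k. (a k / real k) * (real k / real (Suc k))) \<longlonglongrightarrow> L * 1"
    by (rule tendsto_mult[OF assms LIMSEQ_n_over_Suc_n])
  moreover have "\<forall>\<^sub>F k in sequentially. (a k / real k) * (real k / real (Suc k)) = a k / real (Suc k)"
    using eventually_gt_at_top[of 0] by eventually_elim simp
  ultimately have "(\<lambda>k. a k / real (Suc k)) \<longlonglongrightarrow> L * 1" by (rule Lim_transform_eventually)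
  then show ?thesis by (simp only: mult_1_right)
qed

text \<open>Inversion of a renewal sequence: if the k-th point lies near k L, about N / L points lie
  below N. The number of points up to N is caught between consecutive values of s.\<close>

lemma counting_density:
  fixes s :: "nat \<Rightarrow> int"
  assumes "strict_mono s" and lim: "(\<lambda>k. real_of_int (s k) / real k) \<longlonglongrightarrow> L" and "L > 0"
  shows "(\<lambda>N. real (card {k. 1 \<le> s k \<and> s k \<le> int N}) / real N) \<longlonglongrightarrow> 1 / L"
proof -
  \<comment> \<open>The first index beyond x, which is also the number of points at sites up to x,
    including those before site 1.\<close>
  define c where "c x = (LEAST k. x < s k)" for x
  have ge: "s 0 + int k \<le> s k" for k
  proof (induction k)
    case (Suc k)
    moreover have "s k < s (Suc k)" using assms(1) by (simp add: strict_mono_Suc_iff)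
    ultimately show ?case by simp
  qed simp
  have ex: "x < s (nat (x - s 0) + 1)" for x
    using ge[of "nat (x - s 0) + 1"] by linarith
  have c: "s k \<le> x \<longleftrightarrow> k < c x" for k x
  proof
    assume "s k \<le> x"
    moreover have "x < s (c x)" unfolding c_def by (rule LeastI, rule ex)
    ultimately have "s k < s (c x)" by simp
    then show "k < c x" using assms(1) by (simp add: strict_mono_less)
  next
    assume "k < c x"
    then show "s k \<le> x" unfolding c_def using not_less_Least by force
  qed
  have card: "card {k. 1 \<le> s k \<and> s k \<le> int N} = c (int N) - c 0" for N
  proof -
    have "{k. 1 \<le> s k \<and> s k \<le> int N} = {c 0..<c (int N)}"
    proof (rule set_eqI)
      fix k
      have "1 \<le> s k \<longleftrightarrow> \<not> s k \<le> 0" by auto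
      then show "k \<in> {k. 1 \<le> s k \<and> s k \<le> int N} \<longleftrightarrow> k \<in> {c 0..<c (int N)}"
        by (simp add: c not_less)
    qed
    then show ?thesis by simp
  qed
  have c_le: "c 0 \<le> c (int N)" for N
  proof (rule ccontr)
    assume "\<not> c 0 \<le> c (int N)"
    then have "s (c (int N)) \<le> 0" by (simp add: c)
    moreover have "\<not> s (c (int N)) \<le> int N" by (simp add: c)
    ultimately show False by simp
  qed
  have c_top: "filterlim (\<lambda>N. c (int N)) at_top sequentially"
    unfolding filterlim_at_top
  proof
    fix Z :: nat
    show "\<forall>\<^sub>F N in sequentially. Z \<le> c (int N)"
      using eventually_ge_at_top[of "nat (s Z)"]
    proof eventually_elim
      case (elim N)
      then have "s Z \<le> int N" by simp
      then show ?case by (simp add: c)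
    qed
  qed
  \<comment> \<open>Lower bound of the sandwich: the last point up to N has index
    \<open>c (int N) - 1\<close>. The truncation at k = 0 is harmless because c is eventually
    positive.\<close>
  define a where "a k = real_of_int (s (k - 1)) / real k" for k
  have "(\<lambda>k. a (Suc k)) \<longlonglongrightarrow> L"
    using tendsto_mult_Suc_ratio[OF lim] by (simp add: a_def)
  then have a: "a \<longlonglongrightarrow> L" by (rule LIMSEQ_imp_Suc)
  have pos: "\<forall>\<^sub>F N in sequentially. 0 < c (int N)"
    by (rule eventually_compose_filterlim[OF eventually_gt_at_top c_top])
  have "(\<lambda>N. real N / real (c (int N))) \<longlonglongrightarrow> L"
  proof (rule tendsto_sandwich)
    show "(\<lambda>N. a (c (int N))) \<longlonglongrightarrow> L"
      "(\<lambda>N. real_of_int (s (c (int N))) / real (c (int N))) \<longlonglongrightarrow> L"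
      using filterlim_compose[OF a c_top] filterlim_compose[OF lim c_top] by simp_all
    show "\<forall>\<^sub>F N in sequentially. a (c (int N)) \<le> real N / real (c (int N))"
      using pos
    proof eventually_elim
      case (elim N)
      then have "s (c (int N) - 1) \<le> int N" by (simp add: c)
      then have "real_of_int (s (c (int N) - 1)) \<le> real N" by linarith
      then show ?case by (simp add: a_def divide_right_mono)
    qed
    have "int N \<le> s (c (int N))" for N
      using c[of "c (int N)" "int N"] by simp
    then have "real N \<le> real_of_int (s (c (int N)))" for N by (metis of_int_le_iff of_int_of_nat_eq)
    then show "\<forall>\<^sub>F N in sequentially. real N / real (c (int N)) \<le>
        real_of_int (s (c (int N))) / real (c (int N))"
      by (simp add: divide_right_mono)
  qed
  then have "(\<lambda>N. inverse (real N / real (c (int N)))) \<longlonglongrightarrow> inverse L"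
    by (rule tendsto_inverse) (use assms(3) in simp)
  then have "(\<lambda>N. real (c (int N)) / real N) \<longlonglongrightarrow> 1 / L"
    by (simp add: divide_inverse mult.commute)
  \<comment> \<open>The \<open>c 0\<close> points at sites below 1 have to be removed; their share
    tends to 0.\<close>
  then have "(\<lambda>N. real (c (int N)) / real N - real (c 0) / real N) \<longlonglongrightarrow> 1 / L - 0"
    by (intro tendsto_diff lim_const_over_n)
  moreover have "real (c (int N)) / real N - real (c 0) / real N =
      real (card {k. 1 \<le> s k \<and> s k \<le> int N}) / real N" for N
    using c_le[of N] by (simp add: card of_nat_diff diff_divide_distrib)
  ultimately show ?thesis by simp
qed

text \<open>The sequence \<open>s\<close> may start with finitely many holes at sites \<open>x < 1\<close>.\<close>

lemma occupation_density:
  fixes s :: "nat \<Rightarrow> int" and \<zeta> :: "int \<Rightarrow> bool"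
  assumes s: "strict_mono s" "(\<lambda>k. real_of_int (s k) / real k) \<longlonglongrightarrow> 1 + r" and r: "r \<ge> 0"
    and hole: "\<And>x. 1 \<le> x \<Longrightarrow> \<not> \<zeta> x \<longleftrightarrow> x \<in> range s"
  shows "(\<lambda>N. (\<Sum>x\<in>{1..int N}. of_bool (\<zeta> x)) / real N) \<longlonglongrightarrow> r / (1 + r)"
proof -
  have sum: "(\<Sum>x\<in>{1..int N}. of_bool (\<zeta> x)) = real N - real (card {k. 1 \<le> s k \<and> s k \<le> int N})" for N
  proof -
    have "{x\<in>{1..int N}. \<not> \<zeta> x} = s ` {k. 1 \<le> s k \<and> s k \<le> int N}"
      using hole by auto
    moreover have "inj s" using s(1) by (rule strict_mono_imp_inj_on)
    ultimately have "card {x\<in>{1..int N}. \<not> \<zeta> x} = card {k. 1 \<le> s k \<and> s k \<le> int N}"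
      by (simp add: card_image inj_on_subset[OF _ subset_UNIV])
    moreover have "(\<Sum>x\<in>{1..int N}. of_bool (\<zeta> x) :: real) = (\<Sum>x\<in>{1..int N}. 1 - of_bool (\<not> \<zeta> x))"
      by (intro sum.cong) auto
    moreover have "(\<Sum>x\<in>{1..int N}. of_bool (\<not> \<zeta> x) :: real) = real (card {x\<in>{1..int N}. \<not> \<zeta> x})"
      by (simp add: of_bool_def sum.If_cases Int_def)
    ultimately show ?thesis by (simp add: sum_subtractf)
  qed
  have lim: "(\<lambda>N. 1 - real (card {k. 1 \<le> s k \<and> s k \<le> int N}) / real N) \<longlonglongrightarrow> 1 - 1 / (1 + r)"
    by (intro tendsto_diff tendsto_const counting_density s) (use r in simp)
  have eq: "1 - 1 / (1 + r) = r / (1 + r)" using r by (simp add: field_simps)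
  have "\<forall>\<^sub>F N in sequentially. 1 - real (card {k. 1 \<le> s k \<and> s k \<le> int N}) / real N =
      (\<Sum>x\<in>{1..int N}. of_bool (\<zeta> x)) / real N"
    using eventually_gt_at_top[of 0] by eventually_elim (simp add: sum field_simps)
  then show ?thesis by (rule Lim_transform_eventually[OF lim[unfolded eq]])
qed

text \<open>A pathwise statement: k consecutive words contain k holes and about k r particles, so
  the k-th hole is near k (1 + r). The left half-line is treated by reflection.\<close>

lemma subst_map_density:
  assumes pos: "(\<lambda>N. (\<Sum>i\<in>{1..int N}. real (n i)) / real N) \<longlonglongrightarrow> r"
    and neg: "(\<lambda>N. (\<Sum>i\<in>{- int N..-1}. real (n i)) / real N) \<longlonglongrightarrow> r"
    and j: "j \<le> n 1"
  defines "\<eta> \<equiv> shift (- int j) (subst_map n)"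
  shows "(\<lambda>N. (\<Sum>i\<in>{1..int N}. of_bool (\<eta> i)) / real N) \<longlonglongrightarrow> r / (1 + r)"
    and "(\<lambda>N. (\<Sum>i\<in>{- int N..-1}. of_bool (\<eta> i)) / real N) \<longlonglongrightarrow> r / (1 + r)"
proof -
  have r: "r \<ge> 0"
    by (rule LIMSEQ_le_const[OF pos]) (simp add: sum_nonneg)
  have hole: "\<not> \<eta> x \<longleftrightarrow> (\<exists>i. x = word_start n i - int j)" for x
    using hole_subst_map[of n "x + int j"] by (auto simp: \<eta>_def shift_def algebra_simps)
  show "(\<lambda>N. (\<Sum>i\<in>{1..int N}. of_bool (\<eta> i)) / real N) \<longlonglongrightarrow> r / (1 + r)"
  proof (rule occupation_density[where s = "\<lambda>k. word_start n (int k + 1) - int j"])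
    show "strict_mono (\<lambda>k. word_start n (int k + 1) - int j)" by (simp add: strict_mono_def)
    have w: "word_start n (int k + 1) = 1 + int k + (\<Sum>i\<in>{1..int k}. int (n i))" for k
    proof -
      have "{1..<int k + 1} = {1..int k}" "{int k + 1..<1} = {}" by auto
      then show ?thesis by (simp add: word_start_def sum.distrib)
    qed
    have "(\<lambda>k. (1 - real j) / real k + 1 + (\<Sum>i\<in>{1..int k}. real (n i)) / real k) \<longlonglongrightarrow> 0 + 1 + r"
      by (intro tendsto_add tendsto_const lim_const_over_n pos)
    moreover have "\<forall>\<^sub>F k in sequentially.
        (1 - real j) / real k + 1 + (\<Sum>i\<in>{1..int k}. real (n i)) / real k =
        real_of_int (word_start n (int k + 1) - int j) / real k"
      using eventually_gt_at_top[of 0] by eventually_elim (simp add: w add_divide_distrib diff_divide_distrib)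
    ultimately have "(\<lambda>k. real_of_int (word_start n (int k + 1) - int j) / real k) \<longlonglongrightarrow> 0 + 1 + r"
      by (rule Lim_transform_eventually)
    then show "(\<lambda>k. real_of_int (word_start n (int k + 1) - int j) / real k) \<longlonglongrightarrow> 1 + r"
      by (simp only: add_0)
    fix x :: int
    assume x: "1 \<le> x"
    show "\<not> \<eta> x \<longleftrightarrow> x \<in> range (\<lambda>k. word_start n (int k + 1) - int j)"
    proof
      assume "\<not> \<eta> x"
      then obtain i where i: "x = word_start n i - int j" by (auto simp: hole)
      with x have "word_start n 1 \<le> word_start n i" by (simp add: word_start_1)
      then have k: "int (nat (i - 1)) + 1 = i" unfolding word_start_le_iff by simp
      show "x \<in> range (\<lambda>k. word_start n (int k + 1) - int j)"
        by (rule image_eqI[where x = "nat (i - 1)"]) (simp_all only: k i UNIV_I)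
    qed (auto simp: hole)
  qed (rule r)
  have "(\<lambda>N. (\<Sum>x\<in>{1..int N}. of_bool (\<eta> (- x))) / real N) \<longlonglongrightarrow> r / (1 + r)"
  \<comment> \<open>The list starts with hole 1, which translation by -j can carry to a negative
    site; \<open>j \<le> n 1\<close> keeps hole 2 at positive sites.\<close>
  proof (rule occupation_density[where s = "\<lambda>k. int j - word_start n (1 - int k)"])
    show "strict_mono (\<lambda>k. int j - word_start n (1 - int k))" by (simp add: strict_mono_def)
    \<comment> \<open>Stack 0 belongs to neither density average, so its height is split off as a
      bounded term.\<close>
    have w: "- word_start n (- int k) = int k + int (n 0) + (\<Sum>i\<in>{- int k..-1}. int (n i))" for k
    proof -
      have "{- int k..<1} = insert 0 {- int k..-1}" "{1..<- int k} = {}" by auto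
      then show ?thesis by (simp add: word_start_def sum.distrib)
    qed
    have "(\<lambda>k. (real_of_int (int j + int (n 0)) / real k + 1 +
        (\<Sum>i\<in>{- int k..-1}. real (n i)) / real k)) \<longlonglongrightarrow> 0 + 1 + r"
      by (intro tendsto_add tendsto_const lim_const_over_n neg)
    moreover have "\<forall>\<^sub>F k in sequentially. real_of_int (int j + int (n 0)) / real k + 1 +
        (\<Sum>i\<in>{- int k..-1}. real (n i)) / real k =
        real_of_int (int j - word_start n (- int k)) / real k"
      using eventually_gt_at_top[of 0]
    proof eventually_elim
      case (elim k)
      have "int j - word_start n (- int k) = int j + (int k + int (n 0) + (\<Sum>i\<in>{- int k..-1}. int (n i)))"
        using w[of k] by simp
      from arg_cong[OF this, of real_of_int]
      have "real_of_int (int j - word_start n (- int k)) =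
          real j + (real k + real (n 0) + (\<Sum>i\<in>{- int k..-1}. real (n i)))"
        by (simp only: of_int_add of_int_sum of_int_of_nat_eq)
      with elim show ?case by (simp only:) (simp add: add_divide_distrib)
    qed
    ultimately have "(\<lambda>k. real_of_int (int j - word_start n (- int k)) / real k) \<longlonglongrightarrow> 0 + 1 + r"
      by (rule Lim_transform_eventually)
    from tendsto_mult_Suc_ratio[OF this]
    have "(\<lambda>k. real_of_int (int j - word_start n (1 - int (Suc k))) / real (Suc k)) \<longlonglongrightarrow> 1 + r"
      by simp
    then show "(\<lambda>k. real_of_int (int j - word_start n (1 - int k)) / real k) \<longlonglongrightarrow> 1 + r"
      by (rule LIMSEQ_imp_Suc)
    fix x :: int
    assume x: "1 \<le> x"
    show "\<not> \<eta> (- x) \<longleftrightarrow> x \<in> range (\<lambda>k. int j - word_start n (1 - int k))"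
    proof
      assume "\<not> \<eta> (- x)"
      then obtain i where i: "- x = word_start n i - int j" by (auto simp: hole)
      have "word_start n (1 + 1) = 2 + int (n 1)"
        unfolding word_start_step word_start_1 by simp
      with i x j have "word_start n i < word_start n (1 + 1)" by linarith
      then have "i \<le> 1" by (simp only: word_start_less_iff)
      then have k: "1 - int (nat (1 - i)) = i" by simp
      from i have i': "x = int j - word_start n i" by simp
      show "x \<in> range (\<lambda>k. int j - word_start n (1 - int k))"
        by (rule image_eqI[where x = "nat (1 - i)"]) (simp_all only: k i' UNIV_I)
    next
      assume "x \<in> range (\<lambda>k. int j - word_start n (1 - int k))"
      then show "\<not> \<eta> (- x)" by (auto simp: hole)
    qed
  qed (rule r)
  moreover have "(\<Sum>x\<in>{1..int N}. of_bool (\<eta> (- x)) :: real) = (\<Sum>i\<in>{- int N..-1}. of_bool (\<eta> i))" for N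
    by (rule sum.reindex_bij_witness[where i = uminus and j = uminus]) auto
  ultimately show "(\<lambda>N. (\<Sum>i\<in>{- int N..-1}. of_bool (\<eta> i)) / real N) \<longlonglongrightarrow> r / (1 + r)"
    by simp
qed

lemma tendsto_measurable:
  fixes X :: "nat \<Rightarrow> 'a \<Rightarrow> real"
  assumes [measurable]: "\<And>k. X k \<in> borel_measurable M"
  shows "Measurable.pred M (\<lambda>x. (\<lambda>k. X k x) \<longlonglongrightarrow> L)"
proof -
  have "(\<lambda>k. X k x) \<longlonglongrightarrow> L \<longleftrightarrow> (\<forall>m::nat. \<exists>K. \<forall>k\<ge>K. \<bar>X k x - L\<bar> < inverse (real (Suc m)))" for x
  proof
    assume "(\<lambda>k. X k x) \<longlonglongrightarrow> L"
    then show "\<forall>m::nat. \<exists>K. \<forall>k\<ge>K. \<bar>X k x - L\<bar> < inverse (real (Suc m))"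
      by (auto simp: LIMSEQ_iff)
  next
    assume *: "\<forall>m::nat. \<exists>K. \<forall>k\<ge>K. \<bar>X k x - L\<bar> < inverse (real (Suc m))"
    show "(\<lambda>k. X k x) \<longlonglongrightarrow> L"
      unfolding LIMSEQ_iff
    proof (intro allI impI)
      fix e :: real
      assume "e > 0"
      then obtain m where "inverse (real (Suc m)) < e" using reals_Archimedean by blast
      with * show "\<exists>K. \<forall>k\<ge>K. norm (X k x - L) < e" by (metis less_trans real_norm_def)
    qed
  qed
  then show ?thesis by simp
qed

text \<open>A nonnegative integral over the suspension vanishes exactly when almost every fibre sum
  vanishes, since the normalising factor is neither 0 nor infinite.\<close>

lemma AE_Phi_iff:
  assumes "\<nu> \<in> M_ssm" and [measurable]: "Measurable.pred borel P"
  shows "(AE \<eta> in Phi \<nu>. P \<eta>) \<longleftrightarrow> (AE n in \<nu>. \<forall>j\<le>n 1. P (shift (- int j) (subst_map n)))"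
proof -
  note st = M_ssm_state[OF assms(1)]
  note [measurable_cong] = sets_state[OF st] sets_Phi[OF st]
  define F :: "(int \<Rightarrow> bool) \<Rightarrow> ennreal" where "F \<eta> = (if P \<eta> then 0 else 1)" for \<eta>
  have [measurable]: "F \<in> borel_measurable borel" unfolding F_def by measurable
  have "(AE \<eta> in Phi \<nu>. P \<eta>) \<longleftrightarrow> (AE \<eta> in Phi \<nu>. F \<eta> = 0)"
    by (simp add: F_def)
  also have "\<dots> \<longleftrightarrow> (\<integral>\<^sup>+ \<eta>. F \<eta> \<partial>Phi \<nu>) = 0"
    by (rule nn_integral_0_iff_AE[symmetric]) measurable
  also have "\<dots> \<longleftrightarrow> (\<integral>\<^sup>+ n. word_sum F n \<partial>\<nu>) = 0"
    using M_ssm_Z_norm[OF assms(1)] by (simp add: nn_integral_Phi[OF st])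
  also have "\<dots> \<longleftrightarrow> (AE n in \<nu>. word_sum F n = 0)"
    by (rule nn_integral_0_iff_AE) measurable
  also have "\<dots> \<longleftrightarrow> (AE n in \<nu>. \<forall>j\<le>n 1. P (shift (- int j) (subst_map n)))"
  proof -
    have "word_sum F n = 0 \<longleftrightarrow> (\<forall>j\<le>n 1. P (shift (- int j) (subst_map n)))" for n
      by (auto simp: word_sum_def F_def split: if_splits)
    then show ?thesis by (simp only:)
  qed
  finally show ?thesis .
qed

lemma Phi_has_density:
  assumes "\<nu> \<in> M_ssm" "has_density real \<nu> r"
  shows "has_density of_bool (Phi \<nu>) (r / (1 + r))"
proof -
  let ?P = "\<lambda>\<eta>. (\<lambda>N. (\<Sum>i\<in>{1..int N}. of_bool (\<eta> i)) / real N) \<longlonglongrightarrow> r / (1 + r) \<and>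
    (\<lambda>N. (\<Sum>i\<in>{- int N..-1}. of_bool (\<eta> i)) / real N) \<longlonglongrightarrow> r / (1 + r)"
  have [measurable]: "(\<lambda>\<eta>::int \<Rightarrow> bool. of_bool (\<eta> i) :: real) \<in> borel_measurable borel" for i
    by (rule measurable_compose[OF measurable_coord]) simp
  have "Measurable.pred borel ?P"
    by (intro pred_intros_logic tendsto_measurable) measurable
  moreover have "AE n in \<nu>. \<forall>j\<le>n 1. ?P (shift (- int j) (subst_map n))"
    using assms(2) unfolding has_density_def
  proof eventually_elim
    case (elim n)
    then show ?case using subst_map_density[of n r] by blast
  qed
  ultimately show ?thesis
    unfolding has_density_def by (rule AE_Phi_iff[OF assms(1), THEN iffD2])
qed

section \<open>Supports\<close>

lemma ti_set_shift_iff: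
  assumes "ti_set A"
  shows "shift k \<eta> \<in> A \<longleftrightarrow> \<eta> \<in> A"
proof -
  have 1: "shift 1 \<eta> \<in> A \<longleftrightarrow> \<eta> \<in> A" for \<eta>
  proof
    assume "shift 1 \<eta> \<in> A"
    then obtain \<zeta> where "\<zeta> \<in> A" "shift 1 \<eta> = shift 1 \<zeta>" using assms by (auto simp: ti_set_def)
    then have "shift (- 1) (shift 1 \<eta>) = shift (- 1) (shift 1 \<zeta>)" by simp
    with \<open>\<zeta> \<in> A\<close> show "\<eta> \<in> A" by (simp add: shift_shift shift_0)
  qed (use assms in \<open>auto simp: ti_set_def\<close>)
  show ?thesis
  proof (induction k rule: int_induct[where k = 0])
    case (step1 k)
    then show ?case using 1[of "shift k \<eta>"] by (simp add: shift_shift add.commute)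
  next
    case (step2 k)
    then show ?case using 1[of "shift (k - 1) \<eta>"] by (simp add: shift_shift)
  qed (simp add: shift_0)
qed

text \<open>The hull is the union of all integer translates; this countable union is what makes it
  measurable.\<close>

lemma ti_hull_eq: "ti_hull A = {\<eta>. \<exists>k. shift k \<eta> \<in> A}"
proof
  have "ti_set {\<eta>. \<exists>k. shift k \<eta> \<in> A}"
    unfolding ti_set_def
  proof (intro equalityI subsetI)
    fix \<eta>
    assume "\<eta> \<in> shift 1 ` {\<eta>. \<exists>k. shift k \<eta> \<in> A}"
    then obtain \<zeta> k where "\<eta> = shift 1 \<zeta>" "shift k \<zeta> \<in> A" by auto
    then have "shift (k - 1) \<eta> \<in> A" by (simp add: shift_shift)
    then show "\<eta> \<in> {\<eta>. \<exists>k. shift k \<eta> \<in> A}" by blast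
  next
    fix \<eta>
    assume "\<eta> \<in> {\<eta>. \<exists>k. shift k \<eta> \<in> A}"
    then obtain k where "shift k \<eta> \<in> A" by auto
    then have "shift (k + 1) (shift (- 1) \<eta>) \<in> A" by (simp add: shift_shift)
    moreover have "\<eta> = shift 1 (shift (- 1) \<eta>)" by (simp add: shift_shift shift_0)
    ultimately show "\<eta> \<in> shift 1 ` {\<eta>. \<exists>k. shift k \<eta> \<in> A}" by blast
  qed
  moreover have "A \<subseteq> {\<eta>. \<exists>k. shift k \<eta> \<in> A}" by (auto intro: exI[of _ 0] simp: shift_0)
  ultimately show "ti_hull A \<subseteq> {\<eta>. \<exists>k. shift k \<eta> \<in> A}" unfolding ti_hull_def by blast
  show "{\<eta>. \<exists>k. shift k \<eta> \<in> A} \<subseteq> ti_hull A"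
    unfolding ti_hull_def using ti_set_shift_iff by blast
qed

text \<open>If a translate of \<open>subst_map n\<close> is \<open>subst_map m\<close>, then it has
  a hole at site 1, so the translation brings some hole of \<open>subst_map n\<close> there. Hence m
  is a translate of n and lies in the same invariant sets.\<close>

lemma subst_map_in_hull_iff:
  assumes "ti_set A'"
  shows "subst_map n \<in> ti_hull (subst_map ` A') \<longleftrightarrow> n \<in> A'"
proof
  assume "subst_map n \<in> ti_hull (subst_map ` A')"
  then obtain k m where m: "shift k (subst_map n) = subst_map m" "m \<in> A'"
    by (auto simp: ti_hull_eq)
  have "\<not> subst_map n (1 - k)"
    using not_subst_map_word_start[of m 1] unfolding m(1)[symmetric] by (simp add: shift_def word_start_1)
  then obtain i where i: "1 - k = word_start n i" by (auto simp: hole_subst_map)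
  then have k: "k = 1 - word_start n (1 + (i - 1))" by simp
  have "shift k (subst_map n) = subst_map (shift (- (i - 1)) n)"
    by (simp only: subst_map_shift k[symmetric])
  then have "m = shift (- (i - 1)) n" using m(1) by (metis stack_map_subst_map)
  with m(2) show "n \<in> A'" using ti_set_shift_iff[OF assms] by blast
next
  assume "n \<in> A'"
  then show "subst_map n \<in> ti_hull (subst_map ` A')"
    by (auto simp: ti_hull_eq shift_0 intro!: exI[of _ 0])
qed

text \<open>Images of Borel sets are not Borel in general. Here the measurable left inverse
  describes the image: \<open>\<eta>\<close> is reproduced from its stacks, and these stacks lie in
  A'.\<close>

lemma sets_hull_subst_map:
  assumes [measurable]: "A' \<in> sets borel"
  shows "ti_hull (subst_map ` A') \<in> sets borel"
proof -
  have "subst_map ` A' = {\<eta>. (\<forall>i. subst_map (stack_map \<eta>) i = \<eta> i) \<and> stack_map \<eta> \<in> A'}"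
    by (auto simp: fun_eq_iff[symmetric] image_iff) metis
  moreover have "(\<lambda>\<eta>. subst_map (stack_map \<eta>) i) \<in> measurable borel (count_space UNIV)" for i
    using measurable_compose[OF measurable_compose[OF measurable_stack_map measurable_subst_map]
        measurable_coord[of i]] by simp
  then have "Measurable.pred borel
      (\<lambda>\<eta>. (\<forall>i. subst_map (stack_map \<eta>) i = \<eta> i) \<and> stack_map \<eta> \<in> A')"
    by measurable
  ultimately have [measurable]: "subst_map ` A' \<in> sets borel" by (simp add: pred_def)
  have "Measurable.pred borel (\<lambda>\<eta>. \<exists>k. shift k \<eta> \<in> subst_map ` A')" by measurable
  then show ?thesis by (simp add: ti_hull_eq pred_def)
qed

lemma Phi_support_iff:
  assumes "\<nu> \<in> M_ssm" and [measurable]: "A' \<in> sets borel" and "ti_set A'"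
  shows "measure (Phi \<nu>) (ti_hull (subst_map ` A')) = 1 \<longleftrightarrow> measure \<nu> A' = 1"
proof -
  note st = M_ssm_state[OF assms(1)]
  let ?A = "ti_hull (subst_map ` A')"
  interpret N: prob_space \<nu> by (rule prob_space_state[OF st])
  interpret P: prob_space "Phi \<nu>" by (rule prob_space_state[OF state_Phi[OF assms(1)]])
  have [measurable]: "?A \<in> sets borel" by (rule sets_hull_subst_map) measurable
  have "measure (Phi \<nu>) ?A = 1 \<longleftrightarrow> (AE \<eta> in Phi \<nu>. \<eta> \<in> ?A)"
    by (rule P.prob_eq_1) (simp add: sets_Phi[OF st])
  also have "\<dots> \<longleftrightarrow> (AE n in \<nu>. \<forall>j\<le>n 1. shift (- int j) (subst_map n) \<in> ?A)"
    by (rule AE_Phi_iff[OF assms(1)]) measurable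
  also have "\<dots> \<longleftrightarrow> (AE n in \<nu>. n \<in> A')"
  proof -
    have "shift (- int j) (subst_map n) \<in> ?A \<longleftrightarrow> n \<in> A'" for j n
    proof -
      have "shift (- int j) (subst_map n) \<in> ?A \<longleftrightarrow> subst_map n \<in> ?A"
      proof
        assume "shift (- int j) (subst_map n) \<in> ?A"
        then show "subst_map n \<in> ?A" by (auto simp: ti_hull_eq shift_shift)
      next
        assume "subst_map n \<in> ?A"
        then obtain k where "shift k (subst_map n) \<in> subst_map ` A'" by (auto simp: ti_hull_eq)
        then have "shift (k + int j) (shift (- int j) (subst_map n)) \<in> subst_map ` A'"
          by (simp add: shift_shift)
        then show "shift (- int j) (subst_map n) \<in> ?A" unfolding ti_hull_eq by blast
      qed
      also have "\<dots> \<longleftrightarrow> n \<in> A'" by (rule subst_map_in_hull_iff[OF assms(3)])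
      finally show ?thesis .
    qed
    then show ?thesis by auto
  qed
  also have "\<dots> \<longleftrightarrow> measure \<nu> A' = 1"
    by (rule N.prob_eq_1[symmetric]) (simp add: sets_state[OF st])
  finally show ?thesis .
qed

section \<open>Extremality\<close>

definition mix :: "real \<Rightarrow> 'c::topological_space measure \<Rightarrow> 'c measure \<Rightarrow> 'c measure \<Rightarrow> bool"
  where "mix t \<nu> \<mu>\<^sub>1 \<mu>\<^sub>2 \<longleftrightarrow> 0 < t \<and> t < 1 \<and>
    (\<forall>B\<in>sets borel. measure \<nu> B = t * measure \<mu>\<^sub>1 B + (1 - t) * measure \<mu>\<^sub>2 B)"

lemma extremal_iff:
  "\<nu> \<in> extremal S \<longleftrightarrow> \<nu> \<in> S \<and> (\<forall>\<mu>\<^sub>1\<in>S. \<forall>\<mu>\<^sub>2\<in>S. \<forall>t. mix t \<nu> \<mu>\<^sub>1 \<mu>\<^sub>2 \<longrightarrow> \<mu>\<^sub>1 = \<nu> \<and> \<mu>\<^sub>2 = \<nu>)"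
  by (simp add: extremal_def mix_def)

text \<open>A mixture is defined by its values on sets, whereas \<open>Z_norm\<close> and the
  unnormalised \<open>Phi\<close> are integrals of functions.\<close>

lemma nn_integral_mix:
  assumes st: "state \<nu>" "state \<mu>\<^sub>1" "state \<mu>\<^sub>2" and mix: "mix t \<nu> \<mu>\<^sub>1 \<mu>\<^sub>2"
    and "F \<in> borel_measurable borel"
  shows "(\<integral>\<^sup>+ x. F x \<partial>\<nu>) = ennreal t * (\<integral>\<^sup>+ x. F x \<partial>\<mu>\<^sub>1) + ennreal (1 - t) * (\<integral>\<^sup>+ x. F x \<partial>\<mu>\<^sub>2)"
  using assms(5)
proof induction
  note [measurable_cong] = st[THEN sets_state]
  note [simp] = st[THEN sets_state]
  case (set A)
  have "emeasure \<mu> A = ennreal (measure \<mu> A)" if "state \<mu>" for \<mu> :: "'a measure"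
    using prob_space_state[OF that]
    by (simp add: finite_measure.emeasure_eq_measure prob_space_def)
  then show ?case
    using set mix st by (simp add: mix_def ennreal_plus ennreal_mult)
next
  note [measurable_cong] = st[THEN sets_state]
  case (mult u c)
  then show ?case by (simp add: nn_integral_cmult distrib_left ac_simps)
next
  note [measurable_cong] = st[THEN sets_state]
  case (add u v)
  then show ?case by (simp add: nn_integral_add distrib_left ac_simps)
next
  note [measurable_cong] = st[THEN sets_state]
  case (seq U)
  have eq: "(\<integral>\<^sup>+ x. (SUP i. U i) x \<partial>\<mu>) = (SUP i. \<integral>\<^sup>+ x. U i x \<partial>\<mu>)" if "state \<mu>" for \<mu>
  proof -
    note [measurable_cong] = sets_state[OF that]
    show ?thesis
      unfolding SUP_apply by (rule nn_integral_monotone_convergence_SUP) (use seq in auto)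
  qed
  have inc: "incseq (\<lambda>i. c * (\<integral>\<^sup>+ x. U i x \<partial>\<mu>))" for c :: ennreal and \<mu>
    using seq by (auto simp: incseq_def le_fun_def intro!: mult_left_mono nn_integral_mono)
  show ?case
    unfolding eq[OF st(1)] eq[OF st(2)] eq[OF st(3)] SUP_mult_left_ennreal
    by (simp only: seq.IH) (rule ennreal_SUP_add[OF inc inc])
next
  note [simp] = st[THEN space_state]
  case (cong f g)
  then have "f = g" by auto
  with cong show ?case by simp
qed

text \<open>c, \<open>c\<^sub>1\<close> and \<open>c\<^sub>2\<close> are total masses of
  unnormalised measures. Dividing by c leaves a convex combination with first weight
  \<open>t * c\<^sub>1 / c\<close>.\<close>

lemma reweight:
  fixes m m\<^sub>1 m\<^sub>2 :: "'a \<Rightarrow> real"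
  assumes t: "0 < t" "t < 1" and c: "c\<^sub>1 > 0" "c\<^sub>2 > 0" "c = t * c\<^sub>1 + (1 - t) * c\<^sub>2"
    and m: "\<And>B. B \<in> S \<Longrightarrow> c * m B = t * (c\<^sub>1 * m\<^sub>1 B) + (1 - t) * (c\<^sub>2 * m\<^sub>2 B)"
  shows "\<exists>t'. 0 < t' \<and> t' < 1 \<and> (\<forall>B\<in>S. m B = t' * m\<^sub>1 B + (1 - t') * m\<^sub>2 B)"
proof (intro exI conjI ballI)
  have p: "t * c\<^sub>1 > 0" "(1 - t) * c\<^sub>2 > 0" using t c by simp_all
  then have "c > 0" using c(3) by simp
  show "0 < t * c\<^sub>1 / c" "t * c\<^sub>1 / c < 1" using p \<open>c > 0\<close> c(3) by simp_all
  fix B assume "B \<in> S"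
  have "1 - t * c\<^sub>1 / c = (1 - t) * c\<^sub>2 / c" using \<open>c > 0\<close> c(3) by (simp add: field_simps)
  moreover have "m B = (c * m B) / c" using \<open>c > 0\<close> by simp
  ultimately show "m B = t * c\<^sub>1 / c * m\<^sub>1 B + (1 - t * c\<^sub>1 / c) * m\<^sub>2 B"
    by (simp only: m[OF \<open>B \<in> S\<close>]) (simp add: add_divide_distrib ac_simps)
qed

text \<open>Before normalisation \<open>Phi\<close> is an integral against the state, hence affine,
  and so is its mass Z; \<open>reweight\<close> with these masses absorbs the normalisation.\<close>

lemma Phi_mix:
  assumes M: "\<nu> \<in> M_ssm" "\<mu>\<^sub>1 \<in> M_ssm" "\<mu>\<^sub>2 \<in> M_ssm" and mix: "mix t \<nu> \<mu>\<^sub>1 \<mu>\<^sub>2"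
  shows "\<exists>t'. mix t' (Phi \<nu>) (Phi \<mu>\<^sub>1) (Phi \<mu>\<^sub>2)"
proof -
  define z where "z \<mu> = enn2real (Z_norm \<mu>)" for \<mu>
  have t: "0 < t" "t < 1" using mix by (simp_all add: mix_def)
  have z: "Z_norm \<mu> = ennreal (z \<mu>) \<and> z \<mu> > 0" if "\<mu> \<in> M_ssm" for \<mu>
    using M_ssm_Z_norm(1,2)[OF that]
    by (simp add: z_def enn2real_positive_iff less_top zero_less_iff_neq_zero)
  have word: "(\<integral>\<^sup>+ n. word_sum (indicator B) n \<partial>\<mu>) = ennreal (z \<mu> * measure (Phi \<mu>) B)"
    if "\<mu> \<in> M_ssm" and B: "B \<in> sets borel" for \<mu> B
  proof -
    interpret prob_space "Phi \<mu>" by (rule prob_space_state[OF state_Phi[OF that(1)]])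
    have "emeasure (Phi \<mu>) B = inverse (Z_norm \<mu>) * (\<integral>\<^sup>+ n. word_sum (indicator B) n \<partial>\<mu>)"
      using nn_integral_Phi[OF M_ssm_state[OF that(1)], of "indicator B"] B
      by (simp add: sets_Phi[OF M_ssm_state[OF that(1)]])
    then have "Z_norm \<mu> * emeasure (Phi \<mu>) B =
        inverse (Z_norm \<mu>) * Z_norm \<mu> * (\<integral>\<^sup>+ n. word_sum (indicator B) n \<partial>\<mu>)"
      by (simp add: ac_simps)
    then have "(\<integral>\<^sup>+ n. word_sum (indicator B) n \<partial>\<mu>) = Z_norm \<mu> * emeasure (Phi \<mu>) B"
      by (simp only: M_ssm_Z_norm[OF that(1)] mult_1)
    then show ?thesis using z[OF that(1)] by (simp add: emeasure_eq_measure ennreal_mult)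
  qed
  have comb: "ennreal a = ennreal t * ennreal b + ennreal (1 - t) * ennreal d \<Longrightarrow>
      a = t * b + (1 - t) * d" if "a \<ge> 0" "b \<ge> 0" "d \<ge> 0" for a b d
    using that t by (simp flip: ennreal_mult ennreal_plus)
  note nn_mix = nn_integral_mix[OF M[THEN M_ssm_state] mix]
  have "ennreal (z \<nu>) = ennreal t * ennreal (z \<mu>\<^sub>1) + ennreal (1 - t) * ennreal (z \<mu>\<^sub>2)"
  proof -
    have "Z_norm \<nu> = ennreal t * Z_norm \<mu>\<^sub>1 + ennreal (1 - t) * Z_norm \<mu>\<^sub>2"
      unfolding M[THEN M_ssm_state, THEN Z_norm_eq] by (rule nn_mix) measurable
    then show ?thesis using z[OF M(1)] z[OF M(2)] z[OF M(3)] by simp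
  qed
  then have zc: "z \<nu> = t * z \<mu>\<^sub>1 + (1 - t) * z \<mu>\<^sub>2"
    using z M by (intro comb) (auto simp: less_imp_le)
  have "z \<nu> * measure (Phi \<nu>) B =
      t * (z \<mu>\<^sub>1 * measure (Phi \<mu>\<^sub>1) B) + (1 - t) * (z \<mu>\<^sub>2 * measure (Phi \<mu>\<^sub>2) B)"
    if [measurable]: "B \<in> sets borel" for B
  proof (rule comb)
    have "(\<integral>\<^sup>+ n. word_sum (indicator B) n \<partial>\<nu>) = ennreal t * (\<integral>\<^sup>+ n. word_sum (indicator B) n \<partial>\<mu>\<^sub>1) +
        ennreal (1 - t) * (\<integral>\<^sup>+ n. word_sum (indicator B) n \<partial>\<mu>\<^sub>2)"
      by (rule nn_mix) measurable
    then show "ennreal (z \<nu> * measure (Phi \<nu>) B) = ennreal t * ennreal (z \<mu>\<^sub>1 * measure (Phi \<mu>\<^sub>1) B) +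
        ennreal (1 - t) * ennreal (z \<mu>\<^sub>2 * measure (Phi \<mu>\<^sub>2) B)"
      by (simp only: word[OF M(1) that] word[OF M(2) that] word[OF M(3) that])
  qed (use z M in \<open>simp_all add: less_imp_le\<close>)
  with reweight[OF t _ _ zc, of "sets borel"] z M show ?thesis
    unfolding mix_def by blast
qed

text \<open>Restriction to a hole at site 1 is affine in the state; the mass to be divided out is
  the hole probability h.\<close>

lemma Psi_mix:
  assumes M: "\<mu> \<in> M_fssep" "\<mu>\<^sub>1 \<in> M_fssep" "\<mu>\<^sub>2 \<in> M_fssep" and mix: "mix t \<mu> \<mu>\<^sub>1 \<mu>\<^sub>2"
  shows "\<exists>t'. mix t' (Psi \<mu>) (Psi \<mu>\<^sub>1) (Psi \<mu>\<^sub>2)"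
proof -
  define h where "h \<mu> = measure \<mu> hole_at_1" for \<mu>
  have t: "0 < t" "t < 1" using mix by (simp_all add: mix_def)
  have Psi: "h \<mu> > 0" "B \<in> sets borel \<Longrightarrow>
      h \<mu> * measure (Psi \<mu>) B = measure \<mu> (hole_at_1 \<inter> stack_map -` B)"
    if "\<mu> \<in> M_fssep" for \<mu> B
  proof -
    note st = M_fssep_state[OF that]
    interpret prob_space \<mu> by (rule prob_space_state[OF st])
    have h: "emeasure \<mu> hole_at_1 = ennreal (h \<mu>)" by (simp add: h_def emeasure_eq_measure)
    with M_fssep_hole_pos(1)[OF that] show "h \<mu> > 0"
      by (metis ennreal_0 h_def less_le measure_nonneg)
    assume [measurable]: "B \<in> sets borel"
    have "stack_map \<in> measurable (uniform_measure \<mu> hole_at_1) borel"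
      by (simp add: measurable_def sets_state[OF st] space_state[OF st])
        (use measurable_stack_map in \<open>simp add: measurable_def\<close>)
    then have "measure (Psi \<mu>) B = measure (uniform_measure \<mu> hole_at_1) (stack_map -` B)"
      unfolding Psi_def by (subst measure_distr) (simp_all add: space_state[OF st])
    also have "\<dots> = measure \<mu> (hole_at_1 \<inter> stack_map -` B) / h \<mu>"
      unfolding h_def
      by (rule measure_uniform_measure)
        (use M_fssep_hole_pos[OF that] measurable_sets[OF measurable_stack_map, of B]
          in \<open>simp_all add: sets_state[OF st]\<close>)
    finally show "h \<mu> * measure (Psi \<mu>) B = measure \<mu> (hole_at_1 \<inter> stack_map -` B)"
      using \<open>h \<mu> > 0\<close> by simp
  qed
  have "h \<mu> * measure (Psi \<mu>) B =
      t * (h \<mu>\<^sub>1 * measure (Psi \<mu>\<^sub>1) B) + (1 - t) * (h \<mu>\<^sub>2 * measure (Psi \<mu>\<^sub>2) B)"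
    if B: "B \<in> sets borel" for B
  proof -
    have "hole_at_1 \<inter> stack_map -` B \<in> sets borel"
      using measurable_sets[OF measurable_stack_map B] by simp
    then show ?thesis using mix by (simp add: Psi(2) M B mix_def)
  qed
  moreover have "h \<mu> = t * h \<mu>\<^sub>1 + (1 - t) * h \<mu>\<^sub>2" using mix by (simp add: h_def mix_def)
  ultimately show ?thesis
    unfolding mix_def using reweight[OF t Psi(1) Psi(1), of \<mu>\<^sub>1 \<mu>\<^sub>2] M by blast
qed

text \<open>Both weights are positive, so a finite mean of the mixture forces finite means of its
  components.\<close>

lemma regular_ssm_mix:
  assumes "\<nu> \<in> TI" "\<mu>\<^sub>1 \<in> TI" "\<mu>\<^sub>2 \<in> TI" "mix t \<nu> \<mu>\<^sub>1 \<mu>\<^sub>2" "regular_ssm \<nu>"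
  shows "regular_ssm \<mu>\<^sub>1 \<and> regular_ssm \<mu>\<^sub>2"
proof -
  have t: "0 < t" "t < 1" using assms(4) by (simp_all add: mix_def)
  have "(\<integral>\<^sup>+ n. of_nat (n 0) \<partial>\<nu>) =
      ennreal t * (\<integral>\<^sup>+ n. of_nat (n 0) \<partial>\<mu>\<^sub>1) + ennreal (1 - t) * (\<integral>\<^sup>+ n. of_nat (n 0) \<partial>\<mu>\<^sub>2)"
    by (rule nn_integral_mix[OF assms(1-3)[THEN TI_state] assms(4)]) measurable
  then show ?thesis
    using assms(5) t by (auto simp: regular_ssm_def ennreal_mult_less_top)
qed

lemma regular_fssep_mix:
  assumes "mix t \<nu> \<mu>\<^sub>1 \<mu>\<^sub>2" "regular_fssep \<nu>"
  shows "regular_fssep \<mu>\<^sub>1 \<and> regular_fssep \<mu>\<^sub>2"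
proof -
  have "0 < t" "t < 1" and
    "0 = t * measure \<mu>\<^sub>1 {\<lambda>_. True} + (1 - t) * measure \<mu>\<^sub>2 {\<lambda>_. True}"
    using assms by (auto simp: mix_def regular_fssep_def)
  then show ?thesis
    by (simp add: regular_fssep_def) (smt (verit) measure_nonneg mult_eq_0_iff mult_nonneg_nonneg)
qed

text \<open>A decomposition of \<open>f \<nu>\<close> has both components in Q by the face property,
  so g pulls it back to a decomposition of \<open>\<nu>\<close>, possibly with another weight. That
  one is trivial, and f carries the triviality forward. The abstract form serves \<open>Phi\<close>
  and \<open>Psi\<close>, for TI and for TIS states.\<close>

lemma extremal_transfer:
  assumes "\<nu> \<in> extremal S" "R \<nu>"
    and f: "\<And>\<nu>. \<nu> \<in> S \<Longrightarrow> R \<nu> \<Longrightarrow> f \<nu> \<in> T \<and> Q (f \<nu>) \<and> g (f \<nu>) = \<nu>"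
    and g: "\<And>\<mu>. \<mu> \<in> T \<Longrightarrow> Q \<mu> \<Longrightarrow> g \<mu> \<in> S \<and> R (g \<mu>) \<and> f (g \<mu>) = \<mu>"
    and face: "\<And>t \<mu> \<mu>\<^sub>1 \<mu>\<^sub>2. \<mu> \<in> T \<Longrightarrow> \<mu>\<^sub>1 \<in> T \<Longrightarrow> \<mu>\<^sub>2 \<in> T \<Longrightarrow> mix t \<mu> \<mu>\<^sub>1 \<mu>\<^sub>2 \<Longrightarrow> Q \<mu> \<Longrightarrow> Q \<mu>\<^sub>1 \<and> Q \<mu>\<^sub>2"
    and mix: "\<And>t \<mu> \<mu>\<^sub>1 \<mu>\<^sub>2. \<mu> \<in> T \<Longrightarrow> \<mu>\<^sub>1 \<in> T \<Longrightarrow> \<mu>\<^sub>2 \<in> T \<Longrightarrow> Q \<mu> \<Longrightarrow> Q \<mu>\<^sub>1 \<Longrightarrow> Q \<mu>\<^sub>2 \<Longrightarrow>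
      mix t \<mu> \<mu>\<^sub>1 \<mu>\<^sub>2 \<Longrightarrow> \<exists>t'. mix t' (g \<mu>) (g \<mu>\<^sub>1) (g \<mu>\<^sub>2)"
  shows "f \<nu> \<in> extremal T"
proof -
  have \<nu>: "\<nu> \<in> S" and ext: "\<And>\<mu>\<^sub>1 \<mu>\<^sub>2 t. \<mu>\<^sub>1 \<in> S \<Longrightarrow> \<mu>\<^sub>2 \<in> S \<Longrightarrow> mix t \<nu> \<mu>\<^sub>1 \<mu>\<^sub>2 \<Longrightarrow> \<mu>\<^sub>1 = \<nu> \<and> \<mu>\<^sub>2 = \<nu>"
    using assms(1) by (auto simp: extremal_iff)
  note f\<nu> = f[OF \<nu> assms(2)]
  have "\<mu>\<^sub>1 = f \<nu> \<and> \<mu>\<^sub>2 = f \<nu>" if T: "\<mu>\<^sub>1 \<in> T" "\<mu>\<^sub>2 \<in> T" and m: "mix t (f \<nu>) \<mu>\<^sub>1 \<mu>\<^sub>2" for \<mu>\<^sub>1 \<mu>\<^sub>2 t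
  proof -
    have Q: "Q \<mu>\<^sub>1" "Q \<mu>\<^sub>2" using face[OF _ T m] f\<nu> by simp_all
    obtain t' where "mix t' (g (f \<nu>)) (g \<mu>\<^sub>1) (g \<mu>\<^sub>2)"
      using mix[OF _ T _ Q m] f\<nu> by auto
    then have "g \<mu>\<^sub>1 = \<nu> \<and> g \<mu>\<^sub>2 = \<nu>"
      using g[OF T(1) Q(1)] g[OF T(2) Q(2)] f\<nu> by (intro ext) simp_all
    then show ?thesis using g[OF T(1) Q(1)] g[OF T(2) Q(2)] by metis
  qed
  with f\<nu> show ?thesis by (simp add: extremal_iff)
qed

lemma Phi_image_extremal:
  assumes S: "S \<subseteq> TI" and T: "T \<subseteq> TI"
    and iff: "\<And>\<nu>. \<nu> \<in> M_ssm \<Longrightarrow> Phi \<nu> \<in> T \<longleftrightarrow> \<nu> \<in> S"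
  shows "Phi ` {\<nu>\<in>extremal S. regular_ssm \<nu>} = {\<mu>\<in>extremal T. regular_fssep \<mu>}"
proof -
  have f: "Phi \<nu> \<in> T \<and> regular_fssep (Phi \<nu>) \<and> Psi (Phi \<nu>) = \<nu>" if "\<nu> \<in> S" "regular_ssm \<nu>" for \<nu>
    using that S iff Phi_regular Psi_Phi by (auto simp: M_ssm_def)
  have g: "Psi \<mu> \<in> S \<and> regular_ssm (Psi \<mu>) \<and> Phi (Psi \<mu>) = \<mu>" if "\<mu> \<in> T" "regular_fssep \<mu>" for \<mu>
  proof -
    have "\<mu> \<in> M_fssep" using that T by (auto simp: M_fssep_def)
    then have "Psi \<mu> \<in> M_ssm" "Phi (Psi \<mu>) = \<mu>" by (simp_all add: Psi_in_M_ssm Phi_Psi)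
    then show ?thesis using iff[of "Psi \<mu>"] that by (auto simp: M_ssm_def)
  qed
  have 1: "Phi \<nu> \<in> extremal T" if "\<nu> \<in> extremal S" "regular_ssm \<nu>" for \<nu>
    using that f g
  proof (rule extremal_transfer)
    show "regular_fssep \<mu>\<^sub>1 \<and> regular_fssep \<mu>\<^sub>2" if "mix t \<mu> \<mu>\<^sub>1 \<mu>\<^sub>2" "regular_fssep \<mu>" for t \<mu> \<mu>\<^sub>1 \<mu>\<^sub>2
      by (rule regular_fssep_mix[OF that])
    show "\<exists>t'. mix t' (Psi \<mu>) (Psi \<mu>\<^sub>1) (Psi \<mu>\<^sub>2)"
      if "\<mu> \<in> T" "\<mu>\<^sub>1 \<in> T" "\<mu>\<^sub>2 \<in> T" "regular_fssep \<mu>" "regular_fssep \<mu>\<^sub>1" "regular_fssep \<mu>\<^sub>2"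
        "mix t \<mu> \<mu>\<^sub>1 \<mu>\<^sub>2" for t \<mu> \<mu>\<^sub>1 \<mu>\<^sub>2
      by (rule Psi_mix) (use that T in \<open>auto simp: M_fssep_def\<close>)
  qed
  have 2: "Psi \<mu> \<in> extremal S" if "\<mu> \<in> extremal T" "regular_fssep \<mu>" for \<mu>
    using that g f
  proof (rule extremal_transfer)
    show "regular_ssm \<mu>\<^sub>1 \<and> regular_ssm \<mu>\<^sub>2"
      if "\<mu> \<in> S" "\<mu>\<^sub>1 \<in> S" "\<mu>\<^sub>2 \<in> S" "mix t \<mu> \<mu>\<^sub>1 \<mu>\<^sub>2" "regular_ssm \<mu>" for t \<mu> \<mu>\<^sub>1 \<mu>\<^sub>2
      by (rule regular_ssm_mix[OF _ _ _ that(4,5)]) (use that S in auto)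
    show "\<exists>t'. mix t' (Phi \<mu>) (Phi \<mu>\<^sub>1) (Phi \<mu>\<^sub>2)"
      if "\<mu> \<in> S" "\<mu>\<^sub>1 \<in> S" "\<mu>\<^sub>2 \<in> S" "regular_ssm \<mu>" "regular_ssm \<mu>\<^sub>1" "regular_ssm \<mu>\<^sub>2"
        "mix t \<mu> \<mu>\<^sub>1 \<mu>\<^sub>2" for t \<mu> \<mu>\<^sub>1 \<mu>\<^sub>2
      by (rule Phi_mix) (use that S in \<open>auto simp: M_ssm_def\<close>)
  qed
  have ext: "\<nu> \<in> S" if "\<nu> \<in> extremal S" for \<nu> and S :: "'b::topological_space measure set"
    using that by (simp add: extremal_iff)
  show ?thesis
  proof (intro equalityI subsetI)
    show "\<mu> \<in> {\<mu>\<in>extremal T. regular_fssep \<mu>}"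
      if "\<mu> \<in> Phi ` {\<nu>\<in>extremal S. regular_ssm \<nu>}" for \<mu>
      using that 1 f ext by blast
    show "\<mu> \<in> Phi ` {\<nu>\<in>extremal S. regular_ssm \<nu>}"
      if "\<mu> \<in> {\<mu>\<in>extremal T. regular_fssep \<mu>}" for \<mu>
    proof (rule image_eqI)
      have "\<mu> \<in> T" using that ext by blast
      with that 2 g show "\<mu> = Phi (Psi \<mu>)" "Psi \<mu> \<in> {\<nu>\<in>extremal S. regular_ssm \<nu>}" by simp_all
    qed
  qed
qed

section \<open>Bijections between the classes of states\<close>

lemma bij_betw_Phi: "bij_betw Phi M_ssm M_fssep"
  by (rule bij_betw_byWitness[where f' = Psi])
    (auto simp: Psi_Phi Phi_Psi Psi_in_M_ssm Phi_in_M_fssep)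

lemma Phi_image_Ms: "Phi ` Ms_ssm = Ms_fssep"
proof -
  have Ms: "Ms_ssm = {\<nu>\<in>M_ssm. stationary ssm_kernel \<nu>}"
    "Ms_fssep = {\<mu>\<in>M_fssep. stationary fssep_kernel \<mu>}"
    by (auto simp: Ms_ssm_def Ms_fssep_def M_ssm_def M_fssep_def TIS_def)
  have M: "Phi ` M_ssm = M_fssep" using bij_betw_Phi by (rule bij_betw_imp_surj_on)
  have "Ms_ssm = {\<nu>\<in>M_ssm. stationary fssep_kernel (Phi \<nu>)}"
    unfolding Ms by (simp add: stationary_Phi_iff cong: conj_cong)
  then have "Phi ` Ms_ssm = {\<mu>\<in>Phi ` M_ssm. stationary fssep_kernel \<mu>}" by auto
  then show ?thesis by (simp only: M Ms(2))
qed

text \<open>The support condition on a state is equivalent to that on its image, so the bijection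
  restricts to any class once the image of the class is known.\<close>

lemma bij_betw_Phi_supported:
  assumes "S \<subseteq> M_ssm" "Phi ` S = T" "A' \<in> sets borel" "ti_set A'"
  shows "bij_betw Phi (supported_on S A') (supported_on T (ti_hull (subst_map ` A')))"
proof (rule bij_betw_subset[OF bij_betw_Phi])
  show "supported_on S A' \<subseteq> M_ssm" using assms(1) by (auto simp: supported_on_def)
  have "measure (Phi \<nu>) (ti_hull (subst_map ` A')) = 1 \<longleftrightarrow> measure \<nu> A' = 1" if "\<nu> \<in> S" for \<nu>
    using Phi_support_iff assms that by blast
  then show "Phi ` supported_on S A' = supported_on T (ti_hull (subst_map ` A'))"
    using assms(2) by (auto simp: supported_on_def)
qed

theorem theorem2p1:
  shows "bij_betw Phi M_ssm M_fssep \<and>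
    Phi ` Mbar_ssm = Mbar_fssep \<and>
    Phi ` Ms_ssm = Ms_fssep \<and>
    Phi ` Mbars_ssm = Mbars_fssep \<and>
    (\<forall>\<nu>\<in>M_ssm. \<forall>r. has_density real \<nu> r \<longrightarrow> has_density of_bool (Phi \<nu>) (r / (1 + r))) \<and>
    (\<forall>A'. A' \<in> sets borel \<and> ti_set A' \<longrightarrow>
      (let A = ti_hull (subst_map ` A') in
        bij_betw Phi (supported_on M_ssm A') (supported_on M_fssep A) \<and>
        bij_betw Phi (supported_on Mbar_ssm A') (supported_on Mbar_fssep A) \<and>
        bij_betw Phi (supported_on Ms_ssm A') (supported_on Ms_fssep A) \<and>
        bij_betw Phi (supported_on Mbars_ssm A') (supported_on Mbars_fssep A)))"
proof -
  have M: "Phi ` M_ssm = M_fssep" using bij_betw_Phi by (rule bij_betw_imp_surj_on)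
  have Mbar: "Phi ` Mbar_ssm = Mbar_fssep"
    unfolding Mbar_ssm_def Mbar_fssep_def
    by (rule Phi_image_extremal) (simp_all add: Phi_TI M_ssm_TI)
  have Mbars: "Phi ` Mbars_ssm = Mbars_fssep"
    unfolding Mbars_ssm_def Mbars_fssep_def
    by (rule Phi_image_extremal) (auto simp: TIS_def Phi_TI M_ssm_TI stationary_Phi_iff)
  have sub: "Mbar_ssm \<subseteq> M_ssm" "Ms_ssm \<subseteq> M_ssm" "Mbars_ssm \<subseteq> M_ssm"
    by (auto simp: Mbar_ssm_def Ms_ssm_def Mbars_ssm_def M_ssm_def TIS_def extremal_def)
  show ?thesis
    unfolding Let_def
    by (intro conjI ballI allI impI bij_betw_Phi Mbar Phi_image_Ms Mbars Phi_has_density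
        bij_betw_Phi_supported[OF subset_refl M] bij_betw_Phi_supported[OF sub(1) Mbar]
        bij_betw_Phi_supported[OF sub(2) Phi_image_Ms] bij_betw_Phi_supported[OF sub(3) Mbars])
      simp_all
qed

end
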